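(* Let $A>0$, $f\in\operatorname{SLLL}_0[A]$ and $g\in\operatorname{SLLL}^0[A]$. Then, for every $m_0\in\mathcal{P}^p(\mathbb{R}^d)$, $y_0\in\mathbb{R}^{d'}$, $\alpha\in\mathcal{A}[m_0]$ and $\zeta\in\mathcal{V}$, there exists a unique motion $(m(\cdot),y(\cdot))$ generated by $f,g,m_0,y_0,\alpha,\zeta$.
   Context: Fix $T>0$, $p\ge 1$, natural numbers $d,d'$, and compact metric spaces $U,V$ (control spaces of the minor agents and of the major agent). $\mathcal{P}^p(X)$ is the set of Borel probabilities on a Polish space $X$ with finite $p$-th moment, with the $p$-Wasserstein metric $W_p$. For $m\in\mathcal{P}^p(\mathbb{R}^d)$, $\varsigma_p(m)=\big(\int\|x\|^p m(dx)\big)^{1/p}$. $\Gamma=C([0,T];\mathbb{R}^d)$ with the sup norm, $e_t(x(\cdot))=x(t)$, and $h\sharp m$ is the push-forward of $m$ by $h$. For Polish spaces $X,Y$ and a Borel measure $m$ on $X$, $\Lambda(X,m,Y)$ is the set of Borel measures on $X\times Y$ with marginal $m$ on $X$. With $\lambda$ the Lebesgue measure on $[0,T]$, $\mathcal{U}=\Lambda([0,T],\lambda,U)$ and $\mathcal{V}=\Lambda([0,T],\lambda,V)$ are the sets of relaxed controls, with the topology of narrow convergence (they are compact metrizable). $\mathcal{A}[m_0]=\Lambda(\mathbb{R}^d,m_0,\mathcal{U})$ is the set of distributions of minor agents' controls compatible with $m_0$. $\operatorname{SLLL}_0[A]$ is the set of continuous $f:[0,T]\times\mathbb{R}^d\times\mathcal{P}^p(\mathbb{R}^d)\times\mathbb{R}^{d'}\times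 U\times V\to\mathbb{R}^d$ of the form $f(t,x,m,y,u,v)=f_I(t,x,m,y,u)+f_{II}(t,x,m,y,v)$ with $f_I,f_{II}$ continuous, such that: (i) $\|f_I(t,x,m,y,u)\|+\|f_{II}(t,x,m,y,v)\|\le A(1+\|x\|+\varsigma_p(m)+\|y\|)$; (ii) for any $c$ there are constants $B_{I,c},B_{II,c}$ such that for all $t\in[0,T]$, $x_1,x_2\in\mathbb{R}^d$, $m_1,m_2$ with $\varsigma_p(m_i)\le c$, $y_1,y_2$ with $\|y_i\|\le c$, $u\in U$, $v\in V$: $\|f_I(t,x_1,m_1,y_1,u)-f_I(t,x_2,m_2,y_2,u)\|\le B_{I,c}(\|x_1-x_2\|+W_p(m_1,m_2)+\|y_1-y_2\|)$ and $\|f_{II}(t,x_1,m_1,y_1,v)-f_{II}(t,x_2,m_2,y_2,v)\|\le B_{II,c}(\|x_1-x_2\|+W_p(m_1,m_2)+\|y_1-y_2\|)$. $\operatorname{SLLL}^0[A]$ is the set of continuous $g:[0,T]\times\mathbb{R}^{d'}\times\mathcal{P}^p(\mathbb{R}^d)\times V\to\mathbb{R}^{d'}$ such that: (i) $\|g(t,y,m,v)\|\le A(1+\|y\|+\varsigma_p(m))$; (ii) for any $c$ there is $B'_c$ such that for $t\in[0,T]$, $\|y_i\|\le c$, $\varsigma_p(m_i)\le c$ ($i=1,2$), $v\in V$: $\|g(t,y_1,m_1,v)-g(t,y_2,m_2,v)\|\le B'_c(\|y_1-y_2\|+W_p(m_1,m_2))$. Given $m(\cdot),y(\cdot)$, $x_0\in\mathbb{R}^d$,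 $\xi\in\mathcal{U}$, $\zeta\in\mathcal{V}$, let $\mathscr{T}_0[f,m(\cdot),y(\cdot),x_0,\xi,\zeta]\in\Gamma$ be the solution $x(\cdot)$ of $x(t)=x_0+\int_{[0,t]\times U}f_I(\tau,x(\tau),m(\tau),y(\tau),u)\,\xi(d(\tau,u))+\int_{[0,t]\times V}f_{II}(\tau,x(\tau),m(\tau),y(\tau),v)\,\zeta(d(\tau,v))$, and let $\mathscr{T}^0[g,m(\cdot),y_0,\zeta]$ be the solution $y(\cdot)$ of $y(t)=y_0+\int_{[0,t]\times V}g(\tau,y(\tau),m(\tau),v)\,\zeta(d(\tau,v))$. A pair $(m(\cdot),y(\cdot))$ with $m:[0,T]\to\mathcal{P}^p(\mathbb{R}^d)$, $y:[0,T]\to\mathbb{R}^{d'}$ is a motion generated by $f,g,m_0,y_0,\alpha,\zeta$ if there is $\chi\in\mathcal{P}^p(\Gamma)$ such that $y(\cdot)=\mathscr{T}^0[g,m(\cdot),y_0,\zeta]$; $m(t)=e_t\sharp\chi$ for all $t\in[0,T]$; and $\chi=\mathscr{T}_0[f,m(\cdot),y(\cdot),\cdot,\cdot,\zeta]\sharp\alpha$ (push-forward of $\alpha$ under $(x_0,\xi)\mapsto\mathscr{T}_0[f,m(\cdot),y(\cdot),x_0,\xi,\zeta]$). *)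

theory Defs
  imports "HOL-Probability.Probability"
begin

definition borel_of :: "'a topology \<Rightarrow> 'a measure" where
  "borel_of X = sigma (topspace X) {S. openin X S}"

lemma space_borel_of [simp]: "space (borel_of X) = topspace X"
  by (simp add: borel_of_def space_measure_of_conv)

lemma sets_borel_of: "sets (borel_of X) = sigma_sets (topspace X) {S. openin X S}"
  unfolding borel_of_def by (rule sets_measure_of) (auto dest: openin_subset)

lemma borel_of_euclidean: "borel_of euclidean = borel"
  unfolding borel_of_def borel_def by simp

lemma sets_borel_of_top_of_set:
  assumes "S \<in> sets borel"
  shows "sets (borel_of (top_of_set S)) = sets (restrict_space borel S)"
proof -
  have *: "{A. openin (top_of_set S) A} = (\<inter>) S ` {A. open A}"
    by (auto simp: openin_open)
  have "(\<inter>) S ` sigma_sets UNIV {A. open A} = sigma_sets S ((\<inter>) S ` {A. open A})"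
    by (rule sigma_sets_Int) (use assms in \<open>auto simp: borel_def\<close>)
  then show ?thesis
    by (simp add: sets_borel_of sets_restrict_space * borel_def)
qed

text \<open>Lambda(X, m, Y): the Borel measures on X x Y with marginal m on X.\<close>

definition Lambda :: "'a topology \<Rightarrow> 'a measure \<Rightarrow> 'b topology \<Rightarrow> ('a \<times> 'b) measure set" where
  "Lambda X m Y =
    {\<mu>. sets \<mu> = sets (borel_of (prod_topology X Y)) \<and> distr \<mu> (borel_of X) fst = m}"

text \<open>The topology of narrow convergence on a set of finite Borel measures on X: the coarsest
  topology for which integration of every bounded continuous function is continuous.\<close>

definition narrow_topology :: "'a topology \<Rightarrow> 'a measure set \<Rightarrow> 'a measure topology" where
  "narrow_topology X S = topology_generated_by
    {{\<mu> \<in> S. (\<integral>x. \<phi> x \<partial>\<mu>) \<in> W} | \<phi> (W :: real set).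
       continuous_map X euclideanreal \<phi> \<and> bounded (\<phi> ` topspace X) \<and> open W}"

definition P_space :: "real \<Rightarrow> 'a metric \<Rightarrow> 'a measure set" where
  "P_space p X =
    {\<mu>. sets \<mu> = sets (borel_of (mtopology_of X)) \<and> prob_space \<mu> \<and>
        (\<exists>a\<in>mspace X. (\<integral>\<^sup>+ x. ennreal (mdist X x a powr p) \<partial>\<mu>) < \<infinity>)}"

definition couplings :: "'a metric \<Rightarrow> 'a measure \<Rightarrow> 'a measure \<Rightarrow> ('a \<times> 'a) measure set" where
  "couplings X \<mu> \<nu> =
    {\<pi> \<in> Lambda (mtopology_of X) \<mu> (mtopology_of X). distr \<pi> (borel_of (mtopology_of X)) snd = \<nu>}"

definition W_dist :: "real \<Rightarrow> 'a metric \<Rightarrow> 'a measure \<Rightarrow> 'a measure \<Rightarrow> real" where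
  "W_dist p X \<mu> \<nu> =
    enn2real (INF \<pi>\<in>couplings X \<mu> \<nu>. \<integral>\<^sup>+ z. ennreal (mdist X (fst z) (snd z) powr p) \<partial>\<pi>) powr (1 / p)"

text \<open>The topology of the metric W_dist on P_space.  The library constants for metric topologies
  unfold only under a proof that W_dist is a metric; the present form needs none.\<close>

definition W_topology :: "real \<Rightarrow> 'a metric \<Rightarrow> 'a measure topology" where
  "W_topology p X = topology (\<lambda>S. S \<subseteq> P_space p X \<and>
     (\<forall>\<mu>\<in>S. \<exists>r>0. \<forall>\<nu>\<in>P_space p X. W_dist p X \<mu> \<nu> < r \<longrightarrow> \<nu> \<in> S))"

lemma openin_W_topology:
  "openin (W_topology p X) S \<longleftrightarrow> S \<subseteq> P_space p X \<and>
     (\<forall>\<mu>\<in>S. \<exists>r>0. \<forall>\<nu>\<in>P_space p X. W_dist p X \<mu> \<nu> < r \<longrightarrow> \<nu> \<in> S)"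
proof -
  have "istopology (\<lambda>S. S \<subseteq> P_space p X \<and>
     (\<forall>\<mu>\<in>S. \<exists>r>0. \<forall>\<nu>\<in>P_space p X. W_dist p X \<mu> \<nu> < r \<longrightarrow> \<nu> \<in> S))" (is "istopology ?L")
    unfolding istopology_def
  proof (intro conjI allI impI)
    fix S T assume S: "?L S" and T: "?L T"
    show "S \<inter> T \<subseteq> P_space p X" using S by blast
    show "\<forall>\<mu>\<in>S \<inter> T. \<exists>r>0. \<forall>\<nu>\<in>P_space p X. W_dist p X \<mu> \<nu> < r \<longrightarrow> \<nu> \<in> S \<inter> T"
    proof
      fix \<mu> assume "\<mu> \<in> S \<inter> T"
      then obtain r s where "r > 0" "\<forall>\<nu>\<in>P_space p X. W_dist p X \<mu> \<nu> < r \<longrightarrow> \<nu> \<in> S"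
        and "s > 0" "\<forall>\<nu>\<in>P_space p X. W_dist p X \<mu> \<nu> < s \<longrightarrow> \<nu> \<in> T"
        using S T by blast
      then show "\<exists>r>0. \<forall>\<nu>\<in>P_space p X. W_dist p X \<mu> \<nu> < r \<longrightarrow> \<nu> \<in> S \<inter> T"
        by (intro exI[of _ "min r s"]) auto
    qed
  next
    fix K assume K: "\<forall>S\<in>K. ?L S"
    show "\<Union>K \<subseteq> P_space p X" using K by blast
    show "\<forall>\<mu>\<in>\<Union>K. \<exists>r>0. \<forall>\<nu>\<in>P_space p X. W_dist p X \<mu> \<nu> < r \<longrightarrow> \<nu> \<in> \<Union>K"
      using K by (meson Union_iff)
  qed
  then show ?thesis
    by (simp add: W_topology_def topology_inverse')
qed

lemma topspace_W_topology [simp]: "topspace (W_topology p X) = P_space p X"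
proof
  show "topspace (W_topology p X) \<subseteq> P_space p X"
    using openin_topspace[of "W_topology p X"] unfolding openin_W_topology by blast
  have "openin (W_topology p X) (P_space p X)"
    unfolding openin_W_topology using zero_less_one by blast
  then show "P_space p X \<subseteq> topspace (W_topology p X)"
    by (rule openin_subset)
qed

definition moment :: "real \<Rightarrow> 'a::real_normed_vector measure \<Rightarrow> real" where
  "moment p m = (\<integral>x. norm x powr p \<partial>m) powr (1 / p)"

definition relaxed_controls :: "real \<Rightarrow> (real \<times> 'u::topological_space) measure set" where
  "relaxed_controls T = Lambda (top_of_set {0..T}) (restrict_space lborel {0..T}) euclidean"

definition relaxed_topology :: "real \<Rightarrow> (real \<times> 'u::topological_space) measure topology" where
  "relaxed_topology T =
    narrow_topology (prod_topology (top_of_set {0..T}) euclidean) (relaxed_controls T)"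

lemma topspace_relaxed_topology [simp]: "topspace (relaxed_topology T) = relaxed_controls T"
proof -
  have "\<exists>\<phi> (W :: real set). relaxed_controls T = {\<mu> \<in> relaxed_controls T. (\<integral>x. \<phi> x \<partial>\<mu>) \<in> W} \<and>
      continuous_map (prod_topology (top_of_set {0..T}) (euclidean :: 'a topology)) euclideanreal \<phi> \<and>
      bounded (\<phi> ` topspace (prod_topology (top_of_set {0..T}) (euclidean :: 'a topology))) \<and> open W"
    by (rule exI[of _ "\<lambda>_. 0"], rule exI[of _ UNIV]) (auto simp: image_constant_conv)
  then show ?thesis
    unfolding relaxed_topology_def narrow_topology_def topology_generated_by_topspace
    by blast
qed

definition control_distributions ::
  "real \<Rightarrow> 'a::euclidean_space measure \<Rightarrow> ('a \<times> (real \<times> 'u::topological_space) measure) measure set"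
  where "control_distributions T m0 = Lambda euclidean m0 (relaxed_topology T)"

text \<open>Membership of f in SLLL_0[A], with the decomposition of f into fI and fII made explicit,
  since the dynamics of the minor agents refers to the two summands.\<close>

definition SLLL_minor ::
  "real \<Rightarrow> real \<Rightarrow> real
   \<Rightarrow> (real \<Rightarrow> 'a::euclidean_space \<Rightarrow> 'a measure \<Rightarrow> 'b::euclidean_space
        \<Rightarrow> 'u::metric_space \<Rightarrow> 'v::metric_space \<Rightarrow> 'a)
   \<Rightarrow> (real \<Rightarrow> 'a \<Rightarrow> 'a measure \<Rightarrow> 'b \<Rightarrow> 'u \<Rightarrow> 'a)
   \<Rightarrow> (real \<Rightarrow> 'a \<Rightarrow> 'a measure \<Rightarrow> 'b \<Rightarrow> 'v \<Rightarrow> 'a) \<Rightarrow> bool" where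
  "SLLL_minor p T A f fI fII \<longleftrightarrow>
    (let \<P> = P_space p (euclidean_metric :: 'a metric);
         \<T> = W_topology p (euclidean_metric :: 'a metric);
         W = W_dist p (euclidean_metric :: 'a metric)
     in
      continuous_map
        (prod_topology (top_of_set {0..T}) (prod_topology euclidean (prod_topology \<T>
          (prod_topology euclidean (prod_topology euclidean euclidean))))) euclidean
        (\<lambda>(t, x, m, y, u, v). f t x m y u v) \<and>
      continuous_map
        (prod_topology (top_of_set {0..T}) (prod_topology euclidean (prod_topology \<T>
          (prod_topology euclidean euclidean)))) euclidean
        (\<lambda>(t, x, m, y, u). fI t x m y u) \<and>
      continuous_map
        (prod_topology (top_of_set {0..T}) (prod_topology euclidean (prod_topology \<T>
          (prod_topology euclidean euclidean)))) euclidean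
        (\<lambda>(t, x, m, y, v). fII t x m y v) \<and>
      (\<forall>t\<in>{0..T}. \<forall>x. \<forall>m\<in>\<P>. \<forall>y u v. f t x m y u v = fI t x m y u + fII t x m y v) \<and>
      (\<forall>t\<in>{0..T}. \<forall>x. \<forall>m\<in>\<P>. \<forall>y u v.
        norm (fI t x m y u) + norm (fII t x m y v) \<le> A * (1 + norm x + moment p m + norm y)) \<and>
      (\<forall>c. \<exists>BI BII. \<forall>t\<in>{0..T}. \<forall>x1 x2. \<forall>m1\<in>\<P>. \<forall>m2\<in>\<P>. \<forall>y1 y2 u v.
        moment p m1 \<le> c \<and> moment p m2 \<le> c \<and> norm y1 \<le> c \<and> norm y2 \<le> c \<longrightarrow>
          norm (fI t x1 m1 y1 u - fI t x2 m2 y2 u)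
            \<le> BI * (norm (x1 - x2) + W m1 m2 + norm (y1 - y2)) \<and>
          norm (fII t x1 m1 y1 v - fII t x2 m2 y2 v)
            \<le> BII * (norm (x1 - x2) + W m1 m2 + norm (y1 - y2))))"

definition SLLL_major ::
  "real \<Rightarrow> real \<Rightarrow> real
   \<Rightarrow> (real \<Rightarrow> 'b::euclidean_space \<Rightarrow> 'a::euclidean_space measure \<Rightarrow> 'v::metric_space \<Rightarrow> 'b)
   \<Rightarrow> bool" where
  "SLLL_major p T A g \<longleftrightarrow>
    (let \<P> = P_space p (euclidean_metric :: 'a metric);
         \<T> = W_topology p (euclidean_metric :: 'a metric);
         W = W_dist p (euclidean_metric :: 'a metric)
     in
      continuous_map
        (prod_topology (top_of_set {0..T}) (prod_topology euclidean (prod_topology \<T> euclidean)))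
        euclidean (\<lambda>(t, y, m, v). g t y m v) \<and>
      (\<forall>t\<in>{0..T}. \<forall>y. \<forall>m\<in>\<P>. \<forall>v. norm (g t y m v) \<le> A * (1 + norm y + moment p m)) \<and>
      (\<forall>c. \<exists>B. \<forall>t\<in>{0..T}. \<forall>y1 y2. \<forall>m1\<in>\<P>. \<forall>m2\<in>\<P>. \<forall>v.
        norm y1 \<le> c \<and> norm y2 \<le> c \<and> moment p m1 \<le> c \<and> moment p m2 \<le> c \<longrightarrow>
          norm (g t y1 m1 v - g t y2 m2 v) \<le> B * (norm (y1 - y2) + W m1 m2)))"

text \<open>C([0,T]; R^d) with the sup metric; its points are functions extensional on [0,T].\<close>

abbreviation path_space :: "real \<Rightarrow> (real \<Rightarrow> 'a::euclidean_space) metric" where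
  "path_space T \<equiv> cfunspace (top_of_set {0..T}) euclidean_metric"

text \<open>Integrability is required explicitly because the Bochner integral of a non-integrable
  function is 0.\<close>

definition solves_minor where
  "solves_minor T fI fII m y x0 \<xi> \<zeta> x \<longleftrightarrow>
    x \<in> mspace (path_space T) \<and>
    (\<forall>t\<in>{0..T}.
      set_integrable \<xi> ({0..t} \<times> UNIV) (\<lambda>(\<tau>, u). fI \<tau> (x \<tau>) (m \<tau>) (y \<tau>) u) \<and>
      set_integrable \<zeta> ({0..t} \<times> UNIV) (\<lambda>(\<tau>, v). fII \<tau> (x \<tau>) (m \<tau>) (y \<tau>) v) \<and>
      x t = x0
        + set_lebesgue_integral \<xi> ({0..t} \<times> UNIV) (\<lambda>(\<tau>, u). fI \<tau> (x \<tau>) (m \<tau>) (y \<tau>) u)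
        + set_lebesgue_integral \<zeta> ({0..t} \<times> UNIV) (\<lambda>(\<tau>, v). fII \<tau> (x \<tau>) (m \<tau>) (y \<tau>) v))"

definition solves_major where
  "solves_major T g m y0 \<zeta> y \<longleftrightarrow>
    y \<in> mspace (path_space T) \<and>
    (\<forall>t\<in>{0..T}.
      set_integrable \<zeta> ({0..t} \<times> UNIV) (\<lambda>(\<tau>, v). g \<tau> (y \<tau>) (m \<tau>) v) \<and>
      y t = y0 + set_lebesgue_integral \<zeta> ({0..t} \<times> UNIV) (\<lambda>(\<tau>, v). g \<tau> (y \<tau>) (m \<tau>) v))"

definition minor_trajectory where
  "minor_trajectory T fI fII m y x0 \<xi> \<zeta> = (THE x. solves_minor T fI fII m y x0 \<xi> \<zeta> x)"

definition major_trajectory where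
  "major_trajectory T g m y0 \<zeta> = (THE y. solves_major T g m y0 \<zeta> y)"

text \<open>The initial distribution of the minor agents enters only as the marginal of alpha.
  Maps on [0,T] are taken extensional, so that equality of motions is equality on [0,T].\<close>

definition is_motion ::
  "real \<Rightarrow> real
   \<Rightarrow> (real \<Rightarrow> 'a::euclidean_space \<Rightarrow> 'a measure \<Rightarrow> 'b::euclidean_space \<Rightarrow> 'u::metric_space \<Rightarrow> 'a)
   \<Rightarrow> (real \<Rightarrow> 'a \<Rightarrow> 'a measure \<Rightarrow> 'b \<Rightarrow> 'v::metric_space \<Rightarrow> 'a)
   \<Rightarrow> (real \<Rightarrow> 'b \<Rightarrow> 'a measure \<Rightarrow> 'v \<Rightarrow> 'b)
   \<Rightarrow> 'b \<Rightarrow> ('a \<times> (real \<times> 'u) measure) measure \<Rightarrow> (real \<times> 'v) measure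
   \<Rightarrow> (real \<Rightarrow> 'a measure) \<Rightarrow> (real \<Rightarrow> 'b) \<Rightarrow> bool" where
  "is_motion p T fI fII g y0 \<alpha> \<zeta> m y \<longleftrightarrow>
    m \<in> {0..T} \<rightarrow>\<^sub>E P_space p euclidean_metric \<and>
    y \<in> {0..T} \<rightarrow>\<^sub>E UNIV \<and>
    (\<exists>\<eta>\<in>P_space p (path_space T :: (real \<Rightarrow> 'a) metric).
      y = major_trajectory T g m y0 \<zeta> \<and>
      (\<forall>t\<in>{0..T}. m t = distr \<eta> borel (\<lambda>x. x t)) \<and>
      \<eta> = distr \<alpha> (borel_of (mtopology_of (path_space T)))
            (\<lambda>(x0, \<xi>). minor_trajectory T fI fII m y x0 \<xi> \<zeta>))"

end

theory Submission
  imports Defs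
begin

text \<open>The state of the system is a pair \<open>(X, y)\<close>, where \<open>X\<close> assigns to each datum
  \<open>\<omega> = (x\<^sub>0, \<xi>)\<close> of a minor agent a path, and the curve of distributions is
  \<open>t \<mapsto> X(\<cdot>, t)\<sharp>\<alpha>\<close>. Everything is measured pointwise in \<open>\<omega>\<close>, in the norm
  \<open>sup e\<^bsup>-Kt\<^esup> \<bar>X(\<omega>, t)\<bar> / (1 + \<bar>x\<^sub>0\<bar>)\<close>. A pointwise bound
  \<open>\<bar>X - X'\<bar> \<le> D (1 + \<bar>x\<^sub>0\<bar>)\<close> gives \<open>W\<^sub>p \<le> \<rho> D\<close> for the laws, by the coupling
  \<open>(X, X')\<sharp>\<alpha>\<close>, so that neither the triangle inequality nor completeness of \<open>W\<^sub>p\<close> is needed.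
  Linear growth makes a set of states of exponential growth invariant under the Picard map; there
  the local Lipschitz condition holds with a single constant and the map is a contraction for large
  \<open>K\<close>. Continuity of \<open>X\<close> in \<open>\<omega>\<close>, preserved by the iteration, makes the laws meaningful.

  The argument is run for a general functional from \<open>X\<close> to curves of distributions. With a constant
  functional it yields the trajectories driven by a prescribed curve, hence that the
  \<open>THE\<close> in the definition of a motion denotes; with the law under \<open>\<alpha>\<close> it yields the motion.\<close>

section \<open>Fixed points in weighted sup norms\<close>

text \<open>The Lipschitz constants depend on a bound for the moments and the major state, and that
  bound must not depend on the Lipschitz constant in turn. Hence there are two exponential rates.
  The one in the growth bounds is determined by \<open>A\<close> and \<open>\<rho>\<close> and fixes
  the invariant set; the Lipschitz constant on that set is read off afterwards, and the rate of the
  contracting norm is chosen from it. The Lipschitz condition is global in x, which is why paths may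
  be unbounded in x0. Linear growth makes a path of the order of 1 + |x0|, and this weight is
  p-integrable under \<alpha> because m0 has a finite p-th moment. Uniqueness is claimed among all
  motions, and a motion comes with no bounds and no continuity in time of its curve; both are
  recovered from the measure on path space whose images are the m(t). Two states may be infinitely
  far apart in the weighted norm. So no metric space of states is formed: a relation bounding the
  difference by D times the weights, with D halved at each step, serves both existence and
  uniqueness.\<close>

definition near ::
  "('i \<Rightarrow> real) \<Rightarrow> ('j \<Rightarrow> real) \<Rightarrow> real \<Rightarrow> ('i \<Rightarrow> 'a::real_normed_vector) \<times> ('j \<Rightarrow> 'b::real_normed_vector)
    \<Rightarrow> ('i \<Rightarrow> 'a) \<times> ('j \<Rightarrow> 'b) \<Rightarrow> bool" where
  "near u v D z z' \<longleftrightarrow>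
    (\<forall>i. norm (fst z i - fst z' i) \<le> D * u i) \<and> (\<forall>j. norm (snd z j - snd z' j) \<le> D * v j)"

lemma near_triangle: "near u v D x y \<Longrightarrow> near u v E y z \<Longrightarrow> near u v (D + E) x z"
  unfolding near_def distrib_right
  by (auto intro!: norm_diff_triangle_le)

lemma near_sym: "near u v D x y \<Longrightarrow> near u v D y x"
  by (simp add: near_def norm_minus_commute)

lemma near_mono:
  assumes "near u v D x y" "D \<le> E" "\<And>i. u i \<ge> 0" "\<And>j. v j \<ge> 0"
  shows "near u v E x y"
  using assms(1) mult_right_mono[OF assms(2,3)] mult_right_mono[OF assms(2,4)]
  unfolding near_def by (blast intro: order.trans)

text \<open>The bounds on successive differences sum to a geometric series. \<open>D\<close> and
  \<open>w\<close> are separate parameters because the limit is taken at each index with its own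
  weight \<open>w\<close> and a common \<open>D\<close>.\<close>

lemma geometric_convergence:
  fixes a :: "nat \<Rightarrow> 'a::banach"
  assumes step: "\<And>n. norm (a n - a (Suc n)) \<le> D * w / 2 ^ n"
  shows "convergent a" and "norm (a n - lim a) \<le> 2 * D * w / 2 ^ n"
proof -
  \<comment> \<open>The subtracted term \<open>1 / 2 ^ (n + k)\<close> is what lets the induction on
    \<open>k\<close> close.\<close>
  have far: "norm (a n - a (n + k)) \<le> 2 * (D * w) * (1 / 2 ^ n - 1 / 2 ^ (n + k))" for n k
  proof (induction k)
    case (Suc k)
    have "norm (a n - a (n + Suc k)) \<le> norm (a n - a (n + k)) + norm (a (n + k) - a (Suc (n + k)))"
      using norm_triangle_ineq[of "a n - a (n + k)" "a (n + k) - a (Suc (n + k))"] by simp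
    also have "\<dots> \<le> 2 * (D * w) * (1 / 2 ^ n - 1 / 2 ^ (n + k)) + D * w / 2 ^ (n + k)"
      using Suc step by (intro add_mono) auto
    also have "\<dots> = 2 * (D * w) * (1 / 2 ^ n - 1 / 2 ^ (n + Suc k))"
      by (simp add: field_simps)
    finally show ?case .
  qed simp
  have Dw: "0 \<le> D * w"
    using order_trans[OF norm_ge_zero step[of 0]] by simp
  have far': "norm (a n - a m) \<le> 2 * D * w / 2 ^ n" if "n \<le> m" for n m
  proof -
    have "norm (a n - a m) \<le> 2 * (D * w) * (1 / 2 ^ n - 1 / 2 ^ m)"
      using far[of n "m - n"] that by simp
    also have "\<dots> \<le> 2 * (D * w) * (1 / 2 ^ n)"
      using Dw by (intro mult_left_mono) auto
    finally show ?thesis by simp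
  qed
  have tends: "(\<lambda>n. 2 * D * w / 2 ^ n) \<longlonglongrightarrow> 0"
    using tendsto_mult_right_zero[OF LIMSEQ_power_zero[of "1/2::real"], of "2 * D * w"]
    by (simp add: power_divide)
  have "Cauchy a"
  proof (rule metric_CauchyI)
    fix e :: real assume "e > 0"
    then obtain N where N: "2 * D * w / 2 ^ N < e / 2"
      using order_tendstoD(2)[OF tends, of "e / 2"] by (auto simp: eventually_sequentially)
    have "dist (a m) (a n) < e" if "m \<ge> N" "n \<ge> N" for m n
    proof (rule dist_triangle_half_r[of "a N"])
      show "dist (a N) (a m) < e / 2" "dist (a N) (a n) < e / 2"
        using far'[OF that(1)] far'[OF that(2)] N by (auto simp: dist_norm)
    qed
    then show "\<exists>M. \<forall>m\<ge>M. \<forall>n\<ge>M. dist (a m) (a n) < e" by blast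
  qed
  then show conv: "convergent a" by (rule Cauchy_convergent)
  have "(\<lambda>m. norm (a n - a m)) \<longlonglongrightarrow> norm (a n - lim a)"
    using conv by (intro tendsto_intros) (simp add: convergent_LIMSEQ_iff)
  then show "norm (a n - lim a) \<le> 2 * D * w / 2 ^ n"
    by (rule Lim_bounded[where M = n]) (use far' in auto)
qed

lemma halving_imp_zero:
  fixes a b :: real
  assumes "\<And>n::nat. a \<le> b / 2 ^ n"
  shows "a \<le> 0"
proof (rule LIMSEQ_le_const)
  show "(\<lambda>n. b / 2 ^ n) \<longlonglongrightarrow> 0"
    using tendsto_mult_right_zero[OF LIMSEQ_power_zero[of "1/2::real"], of b]
    by (simp add: power_divide)
qed (use assms in auto)

text \<open>Banach's argument with \<open>near\<close> in place of a distance. The iterates are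
  Cauchy at every index, and the limit inherits the weighted estimate, so it is approximated from
  within \<open>M\<close>; closedness is asked in just that form. Contraction towards the iterates
  makes the image of the limit agree with the limit up to a multiple of \<open>1 / 2 ^ n\<close> for
  every \<open>n\<close>.\<close>

lemma weighted_fixpoint:
  fixes \<Phi> :: "('i \<Rightarrow> 'a::banach) \<times> ('j \<Rightarrow> 'b::banach) \<Rightarrow> ('i \<Rightarrow> 'a) \<times> ('j \<Rightarrow> 'b)"
  assumes start: "z0 \<in> M" "near u v D0 z0 (\<Phi> z0)"
    and D0: "D0 \<ge> 0" and uv: "\<And>i. u i \<ge> 0" "\<And>j. v j \<ge> 0"
    and maps: "\<And>z. z \<in> M \<Longrightarrow> \<Phi> z \<in> M"
    and contr: "\<And>z z' D. z \<in> M \<Longrightarrow> z' \<in> M \<Longrightarrow> D \<ge> 0 \<Longrightarrow> near u v D z z'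
      \<Longrightarrow> near u v (D / 2) (\<Phi> z) (\<Phi> z')"
    and closed: "\<And>z. (\<And>e. e > 0 \<Longrightarrow> \<exists>z'\<in>M. near u v e z' z) \<Longrightarrow> z \<in> M"
  shows "\<exists>z\<in>M. \<Phi> z = z"
proof -
  define zs where "zs n = (\<Phi> ^^ n) z0" for n
  have M: "zs n \<in> M" for n
    by (induction n) (auto simp: zs_def start maps)
  have step: "near u v (D0 / 2 ^ n) (zs n) (zs (Suc n))" for n
  proof (induction n)
    case (Suc n)
    then show ?case
      using contr[OF M[of n] M[of "Suc n"], of "D0 / 2 ^ n"] D0 by (simp add: zs_def field_simps)
  qed (use start in \<open>simp add: zs_def\<close>)
  define z where "z = ((\<lambda>i. lim (\<lambda>n. fst (zs n) i)), (\<lambda>j. lim (\<lambda>n. snd (zs n) j)))"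
  have lim: "near u v (2 * D0 / 2 ^ n) (zs n) z" for n
    using geometric_convergence(2)[where a = "\<lambda>n. fst (zs n) _" and D = D0]
      geometric_convergence(2)[where a = "\<lambda>n. snd (zs n) _" and D = D0] step
    by (simp add: near_def z_def)
  have small: "\<exists>n. 2 * D0 / 2 ^ n < e" if "e > 0" for e :: real
  proof -
    have "(\<lambda>n. 2 * D0 / 2 ^ n) \<longlonglongrightarrow> 0"
      using tendsto_mult_right_zero[OF LIMSEQ_power_zero[of "1/2::real"], of "2 * D0"]
      by (simp add: power_divide)
    then show ?thesis
      using order_tendstoD(2)[of _ 0 sequentially e] that by (auto simp: eventually_sequentially)
  qed
  have "z \<in> M"
  proof (rule closed)
    fix e :: real assume "e > 0"
    then obtain n where n: "2 * D0 / 2 ^ n < e" using small by blast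
    have "near u v e (zs n) z"
      by (rule near_mono[OF lim less_imp_le[OF n] uv])
    then show "\<exists>z'\<in>M. near u v e z' z"
      using M by blast
  qed
  have "near u v (D0 / 2 ^ n + 2 * D0 / 2 ^ Suc n) (\<Phi> z) z" for n
  proof (rule near_triangle)
    have "near u v (2 * D0 / 2 ^ n / 2) (\<Phi> z) (\<Phi> (zs n))"
      using contr[OF M \<open>z \<in> M\<close> _ lim] D0 by (simp add: near_sym)
    then show "near u v (D0 / 2 ^ n) (\<Phi> z) (zs (Suc n))"
      by (simp add: zs_def)
  qed (rule lim)
  then have close: "near u v (2 * D0 / 2 ^ n) (\<Phi> z) z" for n
    by (simp add: field_simps)
  have "fst (\<Phi> z) i = fst z i" for i
    using halving_imp_zero[of "norm (fst (\<Phi> z) i - fst z i)" "2 * D0 * u i"] close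
    by (simp add: near_def)
  moreover have "snd (\<Phi> z) j = snd z j" for j
    using halving_imp_zero[of "norm (snd (\<Phi> z) j - snd z j)" "2 * D0 * v j"] close
    by (simp add: near_def)
  ultimately show ?thesis
    using \<open>z \<in> M\<close> by (intro bexI[of _ z]) (auto simp: prod_eq_iff)
qed

section \<open>Integration against relaxed controls\<close>

lemma continuous_map_imp_measurable_borel_of:
  assumes "continuous_map X Y f"
  shows "f \<in> borel_of X \<rightarrow>\<^sub>M borel_of Y"
  unfolding borel_of_def[of Y]
proof (rule measurable_measure_of)
  show "{S. openin Y S} \<subseteq> Pow (topspace Y)"
    by (auto dest: openin_subset)
  show "f \<in> space (borel_of X) \<rightarrow> topspace Y"
    using assms by (auto simp: continuous_map_def)
  fix S assume "S \<in> {S. openin Y S}"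
  then have "openin X {x \<in> topspace X. f x \<in> S}"
    using assms by (simp add: continuous_map_def)
  moreover have "{x \<in> topspace X. f x \<in> S} = f -` S \<inter> space (borel_of X)"
    by auto
  ultimately show "f -` S \<inter> space (borel_of X) \<in> sets (borel_of X)"
    by (simp add: sets_borel_of sigma_sets.Basic)
qed

lemma openin_imp_sets_borel_of: "openin X S \<Longrightarrow> S \<in> sets (borel_of X)"
  by (simp add: sets_borel_of sigma_sets.Basic)

lemma continuous_map_imp_borel_measurable:
  fixes f :: "'a \<Rightarrow> 'b::topological_space"
  assumes "continuous_map X euclidean f" "sets M = sets (borel_of X)"
  shows "f \<in> borel_measurable M"
  using continuous_map_imp_measurable_borel_of[OF assms(1)] assms(2)
  by (simp add: borel_of_euclidean cong: measurable_cong_sets)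

abbreviation strip :: "real \<Rightarrow> (real \<times> 'u::topological_space) topology" where
  "strip T \<equiv> prod_topology (top_of_set {0..T}) euclidean"

abbreviation relaxed_int ::
  "(real \<times> 'u) measure \<Rightarrow> real \<Rightarrow> (real \<times> 'u \<Rightarrow> 'a::euclidean_space) \<Rightarrow> 'a" where
  "relaxed_int \<mu> t \<phi> \<equiv> set_lebesgue_integral \<mu> ({0..t} \<times> UNIV) \<phi>"

context
  fixes T :: real and \<mu> :: "(real \<times> 'u::topological_space) measure"
  assumes \<mu>: "\<mu> \<in> relaxed_controls T"
begin

lemma sets_relaxed_control: "sets \<mu> = sets (borel_of (strip T))"
  and time_marginal: "distr \<mu> (borel_of (top_of_set {0..T})) fst = restrict_space lborel {0..T}"
  using \<mu> by (simp_all add: relaxed_controls_def Lambda_def)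

lemma space_relaxed_control: "space \<mu> = {0..T} \<times> UNIV"
  using sets_eq_imp_space_eq[OF sets_relaxed_control] by simp

lemma fst_measurable_relaxed: "fst \<in> \<mu> \<rightarrow>\<^sub>M borel_of (top_of_set {0..T})"
  using continuous_map_imp_measurable_borel_of[OF continuous_map_fst, of "top_of_set {0..T}" "euclidean :: 'u topology"]
    sets_relaxed_control
  by (simp cong: measurable_cong_sets)

text \<open>An integrand of time alone sees only the time marginal, which is Lebesgue measure for
  every relaxed control. The norm bounds below go through this and are therefore uniform over
  controls.\<close>

lemma has_bochner_integral_time:
  fixes k :: "real \<Rightarrow> real"
  assumes k: "has_bochner_integral lborel (\<lambda>\<tau>. indicator {0..T} \<tau> *\<^sub>R k \<tau>) r"
    and [measurable]: "k \<in> borel_measurable borel"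
  shows "has_bochner_integral \<mu> (\<lambda>z. k (fst z)) r"
proof -
  have "has_bochner_integral (restrict_space lborel {0..T}) k r"
    using k by (simp add: has_bochner_integral_restrict_space)
  then have "has_bochner_integral (distr \<mu> (borel_of (top_of_set {0..T})) fst) k r"
    by (simp add: time_marginal)
  moreover have "k \<in> borel_measurable (borel_of (top_of_set {0..T}))"
    using measurable_restrict_space1[of k borel borel "{0..T}"] sets_borel_of_top_of_set[of "{0..T}"]
    by (simp cong: measurable_cong_sets)
  ultimately show ?thesis
    using fst_measurable_relaxed
    by (simp add: has_bochner_integral_iff integrable_distr_eq integral_distr)
qed

text \<open>\<open>Lambda\<close> asks nothing of the total mass; the marginal makes it the length
  of the interval, so that bounded continuous integrands are integrable.\<close>

lemma finite_measure_relaxed: "finite_measure \<mu>"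
proof -
  have "has_bochner_integral \<mu> (\<lambda>z. 1 :: real) (measure lborel {0..T})"
    by (rule has_bochner_integral_time[where k = "\<lambda>_. 1"])
      (auto simp: has_bochner_integral_iff integrable_indicator_iff emeasure_lborel_Icc_eq)
  then have "integrable \<mu> (\<lambda>z. 1 :: real)"
    by (simp add: has_bochner_integral_iff)
  also have "?this \<longleftrightarrow> integrable \<mu> (indicator (space \<mu>) :: _ \<Rightarrow> real)"
    by (intro Bochner_Integration.integrable_cong) (auto simp: indicator_def)
  finally show ?thesis
    by (intro finite_measureI) (auto simp: integrable_indicator_iff top.not_eq_extremum)
qed

lemma strip_sets: "t \<in> {0..T} \<Longrightarrow> {0..t} \<times> UNIV \<in> sets \<mu>"
proof -
  assume "t \<in> {0..T}"
  then have "closedin (strip T) ({0..t} \<times> (UNIV :: 'u set))"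
    by (auto simp: closedin_prod_Times_iff closedin_closed intro!: exI[of _ "{0..t}"])
  then have "openin (strip T) (topspace (strip T) - {0..t} \<times> (UNIV :: 'u set))"
    by blast
  from openin_imp_sets_borel_of[OF this] have "space \<mu> - {0..t} \<times> UNIV \<in> sets \<mu>"
    by (simp add: sets_relaxed_control space_relaxed_control)
  from sets.compl_sets[OF this] have "space \<mu> - (space \<mu> - {0..t} \<times> UNIV) \<in> sets \<mu>" .
  also have "space \<mu> - (space \<mu> - {0..t} \<times> UNIV) = {0..t} \<times> UNIV"
    using \<open>t \<in> {0..T}\<close> by (auto simp: space_relaxed_control)
  finally show ?thesis .
qed

lemma integrable_relaxed:
  fixes \<phi> :: "real \<times> 'u \<Rightarrow> 'a::euclidean_space"
  assumes "continuous_map (strip T) euclidean \<phi>"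
    and "\<And>\<tau> u. \<tau> \<in> {0..T} \<Longrightarrow> norm (\<phi> (\<tau>, u)) \<le> b"
  shows "integrable \<mu> \<phi>"
  using assms(2)
  by (intro finite_measure.integrable_const_bound[where B = b] finite_measure_relaxed
      continuous_map_imp_borel_measurable[OF assms(1) sets_relaxed_control])
    (auto simp: space_relaxed_control intro!: AE_I2)

lemma set_integrable_relaxed:
  fixes \<phi> :: "real \<times> 'u \<Rightarrow> 'a::euclidean_space"
  assumes "continuous_map (strip T) euclidean \<phi>"
    and "\<And>\<tau> u. \<tau> \<in> {0..T} \<Longrightarrow> norm (\<phi> (\<tau>, u)) \<le> b" "t \<in> {0..T}"
  shows "set_integrable \<mu> ({0..t} \<times> UNIV) \<phi>"
  unfolding set_integrable_def
  by (intro integrable_mult_indicator strip_sets assms integrable_relaxed[OF assms(1,2)])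

lemma norm_integral_time_le:
  fixes \<psi> :: "real \<times> 'u \<Rightarrow> 'a::euclidean_space" and k :: "real \<Rightarrow> real"
  assumes "integrable \<mu> \<psi>"
    and "\<And>\<tau> u. \<tau> \<in> {0..T} \<Longrightarrow> norm (\<psi> (\<tau>, u)) \<le> k \<tau>"
    and "has_bochner_integral lborel (\<lambda>\<tau>. indicator {0..T} \<tau> *\<^sub>R k \<tau>) r"
    and "k \<in> borel_measurable borel"
  shows "norm (integral\<^sup>L \<mu> \<psi>) \<le> r"
proof -
  have "has_bochner_integral \<mu> (\<lambda>z. k (fst z)) r"
    by (rule has_bochner_integral_time[OF assms(3,4)])
  then have k: "integrable \<mu> (\<lambda>z. k (fst z))" "(\<integral>z. k (fst z) \<partial>\<mu>) = r"
    by (simp_all add: has_bochner_integral_iff)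
  have "norm (integral\<^sup>L \<mu> \<psi>) \<le> (\<integral>z. norm (\<psi> z) \<partial>\<mu>)"
    by (rule integral_norm_bound)
  also have "\<dots> \<le> (\<integral>z. k (fst z) \<partial>\<mu>)"
    using assms(1,2) k(1) by (intro integral_mono) (auto simp: space_relaxed_control)
  finally show ?thesis
    using k(2) by simp
qed

text \<open>The factor \<open>1 / K\<close> gained by integrating \<open>exp (K * \<tau>)\<close> is
  the source of both invariance and contraction: a large \<open>K\<close> absorbs all other
  constants.\<close>

lemma norm_relaxed_int_exp_le:
  fixes \<phi> :: "real \<times> 'u \<Rightarrow> 'a::euclidean_space"
  assumes "continuous_map (strip T) euclidean \<phi>"
    and bound: "\<And>\<tau> u. \<tau> \<in> {0..T} \<Longrightarrow> norm (\<phi> (\<tau>, u)) \<le> a * exp (K * \<tau>)"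
    and "K > 0" "t \<in> {0..T}"
  shows "norm (relaxed_int \<mu> t \<phi>) \<le> a / K * exp (K * t)"
proof -
  \<comment> \<open>Time 0 gives the sign of \<open>a\<close>; \<open>undefined\<close> serves as an
    arbitrary point of the control space.\<close>
  have "norm (\<phi> (0, undefined)) \<le> a"
    using bound[of 0] assms(4) by simp
  then have a: "a \<ge> 0"
    using norm_ge_zero order_trans by blast
  have "norm (\<phi> (\<tau>, u)) \<le> a * exp (K * T)" if "\<tau> \<in> {0..T}" for \<tau> u
    using bound[OF that, of u] that a \<open>K > 0\<close> by (smt (verit) atLeastAtMost_iff exp_le_cancel_iff mult_left_mono)
  then have int: "set_integrable \<mu> ({0..t} \<times> UNIV) \<phi>"
    using assms by (intro set_integrable_relaxed)
  \<comment> \<open>Cutting off at \<open>t\<close> turns the integral over the whole interval into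
    one over \<open>{0..t}\<close>, which the fundamental theorem of calculus evaluates.\<close>
  define k where "k \<tau> = a * exp (K * \<tau>) * indicator {0..t} \<tau>" for \<tau>
  have "has_bochner_integral lborel k (a / K * exp (K * t) - a / K * exp (K * 0))"
    unfolding k_def using assms a
    by (intro has_bochner_integral_FTC_Icc_nonneg) (auto intro!: derivative_eq_intros)
  also have "k = (\<lambda>\<tau>. indicator {0..T} \<tau> *\<^sub>R k \<tau>)"
    using assms by (auto simp: k_def indicator_def)
  finally have "norm (relaxed_int \<mu> t \<phi>) \<le> a / K * exp (K * t) - a / K * exp (K * 0)"
    unfolding set_lebesgue_integral_def
    by (rule norm_integral_time_le[rotated 2])
       (use int bound a in \<open>auto simp: k_def set_integrable_def indicator_def\<close>)
  also have "\<dots> \<le> a / K * exp (K * t)"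
    using a \<open>K > 0\<close> by simp
  finally show ?thesis .
qed

text \<open>Every relaxed control gives the time window from \<open>s\<close> to \<open>t\<close> a
  mass of at most \<open>t - s\<close>. This controls differences of time cutoffs uniformly in the
  control.\<close>

lemma norm_integral_window_le:
  fixes \<psi> :: "real \<times> 'u \<Rightarrow> 'a::euclidean_space"
  assumes "integrable \<mu> \<psi>" and "s \<le> t" "b \<ge> 0"
    and bound: "\<And>\<tau> u. \<tau> \<in> {0..T} \<Longrightarrow> norm (\<psi> (\<tau>, u)) \<le> b * indicator {s..t} \<tau>"
  shows "norm (integral\<^sup>L \<mu> \<psi>) \<le> b * (t - s)"
proof -
  have "has_bochner_integral lborel (\<lambda>\<tau>. b * indicator ({0..T} \<inter> {s..t}) \<tau>)
      (b * measure lborel ({0..T} \<inter> {s..t}))"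
    using emeasure_bounded_finite[of "{0..T} \<inter> {s..t}"]
    by (intro has_bochner_integral_mult_right has_bochner_integral_real_indicator)
       (auto simp: bounded_Int)
  also have "(\<lambda>\<tau>. b * indicator ({0..T} \<inter> {s..t}) \<tau>)
      = (\<lambda>\<tau>. indicator {0..T} \<tau> *\<^sub>R (b * indicator {s..t} \<tau>))"
    by (auto simp: indicator_def)
  finally have "norm (integral\<^sup>L \<mu> \<psi>) \<le> b * measure lborel ({0..T} \<inter> {s..t})"
    by (rule norm_integral_time_le[rotated 2]) (use assms in auto)
  also have "measure lborel ({0..T} \<inter> {s..t}) \<le> measure lborel {s..t}"
    by (rule measure_mono_fmeasurable) (auto simp: fmeasurable_def emeasure_lborel_Icc_eq)
  then have "b * measure lborel ({0..T} \<inter> {s..t}) \<le> b * (t - s)"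
    using assms by (intro mult_left_mono) auto
  finally show ?thesis .
qed

text \<open>The indicators of \<open>{0..t}\<close> and \<open>{0..s}\<close> differ only at times
  between \<open>s\<close> and \<open>t\<close>, so the window estimate applies.\<close>

lemma relaxed_int_lipschitz:
  fixes \<phi> :: "real \<times> 'u \<Rightarrow> 'a::euclidean_space"
  assumes \<phi>: "continuous_map (strip T) euclidean \<phi>"
    and bound: "\<And>\<tau> u. \<tau> \<in> {0..T} \<Longrightarrow> norm (\<phi> (\<tau>, u)) \<le> b"
    and st: "s \<in> {0..T}" "t \<in> {0..T}"
  shows "norm (relaxed_int \<mu> t \<phi> - relaxed_int \<mu> s \<phi>) \<le> b * \<bar>t - s\<bar>"
proof -
  have b: "b \<ge> 0"
    using bound[OF st(1), of undefined] norm_ge_zero order_trans by blast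
  have *: "norm (relaxed_int \<mu> t \<phi> - relaxed_int \<mu> s \<phi>) \<le> b * (t - s)"
    if st: "s \<in> {0..T}" "t \<in> {0..T}" "s \<le> t" for s t
  proof -
    have int: "integrable \<mu> (\<lambda>z. indicator ({0..r} \<times> UNIV) z *\<^sub>R \<phi> z)" if "r \<in> {0..T}" for r
      using set_integrable_relaxed[OF \<phi> bound that] by (simp add: set_integrable_def)
    have "norm (\<integral>z. indicator ({0..t} \<times> UNIV) z *\<^sub>R \<phi> z - indicator ({0..s} \<times> UNIV) z *\<^sub>R \<phi> z \<partial>\<mu>)
        \<le> b * (t - s)"
      by (rule norm_integral_window_le)
         (use int st b bound in \<open>auto simp: indicator_def\<close>)
    then show ?thesis
      using int st by (simp add: set_lebesgue_integral_def)
  qed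
  show ?thesis
    using *[of s t] *[of t s] st by (cases "s \<le> t") (auto simp: norm_minus_commute)
qed

lemma relaxed_int_diff:
  fixes \<phi> \<psi> :: "real \<times> 'u \<Rightarrow> 'a::euclidean_space"
  assumes "continuous_map (strip T) euclidean \<phi>" "\<And>\<tau> u. \<tau> \<in> {0..T} \<Longrightarrow> norm (\<phi> (\<tau>, u)) \<le> b"
    and "continuous_map (strip T) euclidean \<psi>" "\<And>\<tau> u. \<tau> \<in> {0..T} \<Longrightarrow> norm (\<psi> (\<tau>, u)) \<le> c"
    and "t \<in> {0..T}"
  shows "relaxed_int \<mu> t \<phi> - relaxed_int \<mu> t \<psi> = relaxed_int \<mu> t (\<lambda>z. \<phi> z - \<psi> z)"
  using set_integral_diff(2)[OF set_integrable_relaxed[OF assms(1,2,5)] set_integrable_relaxed[OF assms(3,4,5)]]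
  by simp

end

section \<open>Narrow neighbourhoods\<close>

lemma openin_narrow_ball:
  fixes \<psi> :: "real \<times> 'u::topological_space \<Rightarrow> real"
  assumes "continuous_map (strip T) euclidean \<psi>"
    and "\<And>\<tau> u. \<tau> \<in> {0..T} \<Longrightarrow> \<bar>\<psi> (\<tau>, u)\<bar> \<le> b"
  shows "openin (relaxed_topology T) {\<xi>' \<in> relaxed_controls T. \<bar>(\<integral>z. \<psi> z \<partial>\<xi>') - r\<bar> < e}"
proof -
  have *: "{\<xi>' \<in> relaxed_controls T. \<bar>(\<integral>z. \<psi> z \<partial>\<xi>') - r\<bar> < e}
      = {\<xi>' \<in> relaxed_controls T. (\<integral>z. \<psi> z \<partial>\<xi>') \<in> ball r e}"
    by (auto simp: dist_real_def abs_minus_commute)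
  have "bounded (\<psi> ` topspace (strip T :: (real \<times> 'u) topology))"
    using assms(2) by (auto intro!: boundedI[of _ b])
  then show ?thesis
    unfolding relaxed_topology_def narrow_topology_def *
    by (intro topology_generated_by_Basis) (use assms(1) in blast)
qed

text \<open>The narrow topology tests real functions only, so \<open>\<psi>\<close> is tested
  coordinate by coordinate: finitely many open conditions with tolerance \<open>e / DIM('a)\<close>
  bound the sum of the coordinates of the difference, which dominates its norm.\<close>

lemma narrow_neighbourhood:
  fixes \<psi> :: "real \<times> 'u::topological_space \<Rightarrow> 'a::euclidean_space"
  assumes \<psi>: "continuous_map (strip T) euclidean \<psi>"
    and bound: "\<And>\<tau> u. \<tau> \<in> {0..T} \<Longrightarrow> norm (\<psi> (\<tau>, u)) \<le> b"
    and "\<xi> \<in> relaxed_controls T" "e > 0"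
  shows "\<exists>N. openin (relaxed_topology T) N \<and> \<xi> \<in> N \<and>
    (\<forall>\<xi>'\<in>N. norm (integral\<^sup>L \<xi>' \<psi> - integral\<^sup>L \<xi> \<psi>) < e)"
proof -
  define \<delta> where "\<delta> = e / DIM('a)"
  define N where "N i = {\<xi>' \<in> relaxed_controls T.
    \<bar>(\<integral>z. \<psi> z \<bullet> i \<partial>\<xi>') - (\<integral>z. \<psi> z \<bullet> i \<partial>\<xi>)\<bar> < \<delta>}" for i :: 'a
  have "\<delta> > 0"
    using assms(4) by (simp add: \<delta>_def)
  have "openin (relaxed_topology T) (N i)" if "i \<in> Basis" for i
    unfolding N_def
  proof (rule openin_narrow_ball)
    show "continuous_map (strip T) euclidean (\<lambda>z. \<psi> z \<bullet> i)"
      using continuous_map_compose[OF \<psi>, of euclidean "\<lambda>x. x \<bullet> i"]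
      by (simp add: o_def continuous_intros)
    show "\<bar>\<psi> (\<tau>, u) \<bullet> i\<bar> \<le> b" if "\<tau> \<in> {0..T}" for \<tau> u
      using bound[OF that, of u] Basis_le_norm[OF \<open>i \<in> Basis\<close>, of "\<psi> (\<tau>, u)"] by simp
  qed
  then have "openin (relaxed_topology T) ((\<Inter>i\<in>Basis. N i) \<inter> topspace (relaxed_topology T))"
    by (intro openin_INT) auto
  moreover have "\<xi> \<in> (\<Inter>i\<in>Basis. N i) \<inter> topspace (relaxed_topology T)"
    using assms(3) \<open>\<delta> > 0\<close> by (simp add: N_def)
  moreover have "norm (integral\<^sup>L \<xi>' \<psi> - integral\<^sup>L \<xi> \<psi>) < e"
    if \<xi>': "\<xi>' \<in> (\<Inter>i\<in>Basis. N i) \<inter> topspace (relaxed_topology T)" for \<xi>'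
  proof -
    have "(integral\<^sup>L \<nu> \<psi>) \<bullet> i = (\<integral>z. \<psi> z \<bullet> i \<partial>\<nu>)" if "\<nu> \<in> relaxed_controls T" for \<nu> i
      using integral_inner_left[OF integrable_relaxed[OF that \<psi> bound]] by simp
    then have "\<bar>(integral\<^sup>L \<xi>' \<psi> - integral\<^sup>L \<xi> \<psi>) \<bullet> i\<bar> < \<delta>" if "i \<in> Basis" for i
      using \<xi>' that assms(3) by (auto simp: N_def inner_diff_left)
    then have "(\<Sum>i\<in>Basis. \<bar>(integral\<^sup>L \<xi>' \<psi> - integral\<^sup>L \<xi> \<psi>) \<bullet> i\<bar>) < (\<Sum>i\<in>(Basis :: 'a set). \<delta>)"
      by (intro sum_strict_mono) auto
    also have "\<dots> = e"
      by (simp add: \<delta>_def)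
    finally show ?thesis
      using norm_le_l1 order_le_less_trans by blast
  qed
  ultimately show ?thesis by blast
qed

text \<open>The indicator of \<open>[0,t]\<close> is replaced by one of finitely many continuous cutoffs, which it
  differs from only on a short time window; its mass does not depend on the control.\<close>

lemma narrow_neighbourhood_uniform:
  fixes \<phi> :: "real \<times> 'u::topological_space \<Rightarrow> 'a::euclidean_space"
  assumes \<phi>: "continuous_map (strip T) euclidean \<phi>"
    and bound: "\<And>\<tau> u. \<tau> \<in> {0..T} \<Longrightarrow> norm (\<phi> (\<tau>, u)) \<le> b"
    and \<xi>: "\<xi> \<in> relaxed_controls T" and "e > 0"
  shows "\<exists>N. openin (relaxed_topology T) N \<and> \<xi> \<in> N \<and>
    (\<forall>\<xi>'\<in>N. \<forall>t\<in>{0..T}. norm (relaxed_int \<xi>' t \<phi> - relaxed_int \<xi> t \<phi>) < e)"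
proof (cases "T \<ge> 0")
  case True
  have b: "b \<ge> 0"
    using order_trans[OF norm_ge_zero bound[of 0 undefined]] True by simp
  \<comment> \<open>A time window of length \<open>h\<close> contributes at most
    \<open>e / 4\<close>; the \<open>+ 1\<close> keeps the quotient meaningful when
    \<open>b = 0\<close>.\<close>
  define h where "h = e / (4 * (b + 1))"
  have h: "h > 0"
    using b \<open>e > 0\<close> by (simp add: h_def)
  have bh: "b * h \<le> e / 4"
    using b \<open>e > 0\<close> by (simp add: h_def field_simps)
  \<comment> \<open>The cutoff is 1 up to time \<open>k * h\<close>, falls linearly, and vanishes
    from \<open>(k + 1) * h\<close> on.\<close>
  define \<theta> where "\<theta> k \<tau> = max 0 (min 1 (real k + 1 - \<tau> / h))" for k :: nat and \<tau> :: real
  define \<psi> where "\<psi> k z = \<theta> k (fst z) *\<^sub>R \<phi> z" for k z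
  have \<theta>: "0 \<le> \<theta> k \<tau>" "\<theta> k \<tau> \<le> 1" for k \<tau>
    by (auto simp: \<theta>_def)
  have \<psi>_bound: "norm (\<psi> k (\<tau>, u)) \<le> b" if "\<tau> \<in> {0..T}" for k \<tau> u
    using mult_mono[OF \<theta>(2)[of k \<tau>] bound[OF that, of u]] \<theta>[of k \<tau>] by (simp add: \<psi>_def)
  have \<psi>_cont: "continuous_map (strip T) euclidean (\<psi> k)" for k
  proof -
    have "continuous_map (strip T) euclidean (\<lambda>z :: real \<times> 'u. fst z)"
      using continuous_map_fst continuous_map_into_fulltopology by blast
    then have "continuous_map (strip T) euclidean (\<lambda>z :: real \<times> 'u. \<theta> k (fst z))"
      using continuous_map_compose[of _ euclidean fst euclidean "\<theta> k"] h
      by (auto simp: o_def \<theta>_def intro!: continuous_intros)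
    then have "continuous_map (strip T) euclidean (\<lambda>z :: real \<times> 'u. (\<theta> k (fst z), \<phi> z))"
      using continuous_map_pairedI[OF _ \<phi>, of euclidean] by simp
    then show ?thesis
      using continuous_map_compose[of _ euclidean "\<lambda>z. (\<theta> k (fst z), \<phi> z)" euclidean "\<lambda>q. fst q *\<^sub>R snd q"]
      by (simp add: o_def \<psi>_def[abs_def] continuous_intros)
  qed
  \<comment> \<open>The grid indices up to \<open>n\<close> cover all times of the interval, so only
    finitely many neighbourhoods are intersected.\<close>
  define n where "n = nat \<lfloor>T / h\<rfloor>"
  have "\<exists>N. openin (relaxed_topology T) N \<and> \<xi> \<in> N \<and>
    (\<forall>\<xi>'\<in>N. norm (integral\<^sup>L \<xi>' (\<psi> k) - integral\<^sup>L \<xi> (\<psi> k)) < e / 2)" for k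
    by (rule narrow_neighbourhood[OF \<psi>_cont \<psi>_bound \<xi>]) (use \<open>e > 0\<close> in auto)
  then obtain N where N: "\<And>k. openin (relaxed_topology T) (N k)" "\<And>k. \<xi> \<in> N k"
    "\<And>k \<xi>'. \<xi>' \<in> N k \<Longrightarrow> norm (integral\<^sup>L \<xi>' (\<psi> k) - integral\<^sup>L \<xi> (\<psi> k)) < e / 2"
    by metis
  have "openin (relaxed_topology T) ((\<Inter>k\<in>{..n}. N k) \<inter> topspace (relaxed_topology T))"
    using N(1) by (intro openin_INT) auto
  moreover have "norm (relaxed_int \<xi>' t \<phi> - relaxed_int \<xi> t \<phi>) < e"
    if \<xi>': "\<xi>' \<in> (\<Inter>k\<in>{..n}. N k) \<inter> topspace (relaxed_topology T)" and t: "t \<in> {0..T}" for \<xi>' t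
  proof -
    \<comment> \<open>The grid cell containing \<open>t\<close>: outside it the indicator of
      \<open>{0..t}\<close> and the cutoff \<open>\<theta> k\<close> agree.\<close>
    define k where "k = nat \<lfloor>t / h\<rfloor>"
    have "real k = real_of_int \<lfloor>t / h\<rfloor>"
      using t h by (simp add: k_def)
    then have "real k \<le> t / h" "t / h < real k + 1"
      by linarith+
    then have k: "real k * h \<le> t" "t < (real k + 1) * h"
      using h by (simp_all add: field_simps)
    have "k \<le> n"
      unfolding k_def n_def using t h by (intro nat_mono floor_mono divide_right_mono) auto
    have close: "norm (relaxed_int \<nu> t \<phi> - integral\<^sup>L \<nu> (\<psi> k)) \<le> e / 4" if \<nu>: "\<nu> \<in> relaxed_controls T" for \<nu>
    proof -
      have int: "integrable \<nu> (\<lambda>z. indicator ({0..t} \<times> UNIV) z *\<^sub>R \<phi> z)" "integrable \<nu> (\<psi> k)"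
        using set_integrable_relaxed[OF \<nu> \<phi> bound t] integrable_relaxed[OF \<nu> \<psi>_cont \<psi>_bound]
        by (simp_all add: set_integrable_def)
      have "norm (\<integral>z. indicator ({0..t} \<times> UNIV) z *\<^sub>R \<phi> z - \<psi> k z \<partial>\<nu>) \<le> b * ((real k + 1) * h - real k * h)"
      proof (rule norm_integral_window_le[OF \<nu>])
        fix \<tau> u assume \<tau>: "\<tau> \<in> {0..T}"
        have *: "indicator ({0..t} \<times> UNIV) (\<tau>, u) *\<^sub>R \<phi> (\<tau>, u) - \<psi> k (\<tau>, u)
            = (indicator {0..t} \<tau> - \<theta> k \<tau>) *\<^sub>R \<phi> (\<tau>, u)"
          by (simp add: \<psi>_def indicator_def algebra_simps)
        have "\<bar>indicator {0..t} \<tau> - \<theta> k \<tau>\<bar> \<le> indicator {real k * h..(real k + 1) * h} \<tau>"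
        proof -
          consider "\<tau> < real k * h" | "\<tau> \<in> {real k * h..(real k + 1) * h}" | "\<tau> > (real k + 1) * h"
            by force
          then show ?thesis
          proof cases
            case 1
            then have "\<tau> / h \<le> real k" "\<tau> \<le> t"
              using h k by (simp_all add: field_simps)
            then show ?thesis using 1 \<tau> by (simp add: \<theta>_def)
          next
            case 2
            then show ?thesis using \<theta>[of k \<tau>] by (auto simp: indicator_def)
          next
            case 3
            then have "\<tau> / h \<ge> real k + 1" "\<tau> > t"
              using h k by (simp_all add: field_simps)
            then show ?thesis using 3 \<tau> by (simp add: \<theta>_def)
          qed
        qed
        then show "norm (indicator ({0..t} \<times> UNIV) (\<tau>, u) *\<^sub>R \<phi> (\<tau>, u) - \<psi> k (\<tau>, u))
            \<le> b * indicator {real k * h..(real k + 1) * h} \<tau>"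
          unfolding * norm_scaleR using bound[OF \<tau>, of u] b
          by (subst mult.commute) (intro mult_mono, auto)
      qed (use int b h in auto)
      also have "\<dots> \<le> e / 4"
        using bh by (simp add: algebra_simps)
      finally show ?thesis
        using int by (simp add: set_lebesgue_integral_def)
    qed
    have "\<xi>' \<in> relaxed_controls T" "\<xi>' \<in> N k"
      using \<xi>' \<open>k \<le> n\<close> by auto
    then have "norm (relaxed_int \<xi>' t \<phi> - integral\<^sup>L \<xi>' (\<psi> k)) \<le> e / 4"
      "norm (relaxed_int \<xi> t \<phi> - integral\<^sup>L \<xi> (\<psi> k)) \<le> e / 4"
      "norm (integral\<^sup>L \<xi>' (\<psi> k) - integral\<^sup>L \<xi> (\<psi> k)) < e / 2"
      using close N(3) \<xi> by blast+
    then show ?thesis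
      by norm
  qed
  ultimately show ?thesis
    using N(2) \<xi> by (intro exI[of _ "(\<Inter>k\<in>{..n}. N k) \<inter> topspace (relaxed_topology T)"]) auto
next
  \<comment> \<open>With negative \<open>T\<close> there are no times to test, and the whole set of
    controls serves as neighbourhood.\<close>
  case False
  then show ?thesis
    using \<xi> openin_topspace[of "relaxed_topology T"] by (intro exI[of _ "relaxed_controls T"]) auto
qed

section \<open>Wasserstein estimates by coupling\<close>

text \<open>An open set of \<open>W_topology\<close> contains a ball around each of its points, and
  nothing more is used. Balls are not claimed to be open, so the triangle inequality does not
  enter.\<close>

lemma continuous_map_W_topology:
  fixes m :: "'t::metric_space \<Rightarrow> 'a measure"
  assumes "\<And>t. t \<in> S \<Longrightarrow> m t \<in> P_space p X"
    and lim: "\<And>t. t \<in> S \<Longrightarrow> ((\<lambda>s. W_dist p X (m t) (m s)) \<longlongrightarrow> 0) (at t within S)"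
  shows "continuous_map (top_of_set S) (W_topology p X) m"
  unfolding continuous_map_def openin_W_topology topspace_W_topology
proof (intro conjI allI impI)
  show "m \<in> topspace (top_of_set S) \<rightarrow> P_space p X"
    using assms(1) by simp
  fix U assume U: "U \<subseteq> P_space p X \<and> (\<forall>\<mu>\<in>U. \<exists>r>0. \<forall>\<nu>\<in>P_space p X. W_dist p X \<mu> \<nu> < r \<longrightarrow> \<nu> \<in> U)"
  show "openin (top_of_set S) {x \<in> topspace (top_of_set S). m x \<in> U}"
    unfolding openin_euclidean_subtopology_iff
  proof (intro conjI ballI)
    fix t assume "t \<in> {x \<in> topspace (top_of_set S). m x \<in> U}"
    then have t: "t \<in> S" "m t \<in> U" by auto
    then obtain r where r: "r > 0" "\<And>\<nu>. \<nu> \<in> P_space p X \<Longrightarrow> W_dist p X (m t) \<nu> < r \<Longrightarrow> \<nu> \<in> U"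
      using U by metis
    then obtain d where "d > 0"
      "\<And>s. s \<in> S \<Longrightarrow> s \<noteq> t \<Longrightarrow> dist s t < d \<Longrightarrow> W_dist p X (m t) (m s) < r"
      using order_tendstoD(2)[OF lim[OF t(1)]] unfolding eventually_at by blast
    then show "\<exists>e>0. \<forall>s\<in>S. dist s t < e \<longrightarrow> s \<in> {x \<in> topspace (top_of_set S). m x \<in> U}"
      using r(2) t assms(1) by (intro exI[of _ d]) (auto; metis)
  qed auto
qed

text \<open>The joint law of \<open>X\<close> and \<open>Y\<close> is a coupling, so its cost bounds
  the infimum. Integrability turns this cost into a real number, and \<open>enn2real\<close>
  respects an upper bound of that kind.\<close>

lemma W_dist_law_le:
  fixes X Y :: "'w \<Rightarrow> 'a::euclidean_space"
  assumes [measurable]: "X \<in> borel_measurable M" "Y \<in> borel_measurable M"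
    and int: "integrable M (\<lambda>\<omega>. norm (X \<omega> - Y \<omega>) powr p)" and "p > 0"
  shows "W_dist p euclidean_metric (distr M borel X) (distr M borel Y)
    \<le> (\<integral>\<omega>. norm (X \<omega> - Y \<omega>) powr p \<partial>M) powr (1 / p)"
proof -
  define \<pi> where "\<pi> = distr M borel (\<lambda>\<omega>. (X \<omega>, Y \<omega>))"
  have "\<pi> \<in> couplings euclidean_metric (distr M borel X) (distr M borel Y)"
    by (simp add: couplings_def Lambda_def borel_of_euclidean \<pi>_def distr_distr o_def borel_prod
        flip: borel_prod)
  then have "(INF \<pi>\<in>couplings euclidean_metric (distr M borel X) (distr M borel Y).
      \<integral>\<^sup>+ z. ennreal (mdist euclidean_metric (fst z) (snd z) powr p) \<partial>\<pi>)
    \<le> (\<integral>\<^sup>+ z. ennreal (mdist euclidean_metric (fst z) (snd z) powr p) \<partial>\<pi>)"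
    by (rule INF_lower)
  also have "\<dots> = (\<integral>\<^sup>+ \<omega>. ennreal (norm (X \<omega> - Y \<omega>) powr p) \<partial>M)"
    unfolding \<pi>_def by (subst nn_integral_distr) (auto simp: dist_norm simp flip: borel_prod)
  also have "\<dots> = ennreal (\<integral>\<omega>. norm (X \<omega> - Y \<omega>) powr p \<partial>M)"
    by (rule nn_integral_eq_integral[OF int]) simp
  finally have "enn2real (INF \<pi>\<in>couplings euclidean_metric (distr M borel X) (distr M borel Y).
      \<integral>\<^sup>+ z. ennreal (mdist euclidean_metric (fst z) (snd z) powr p) \<partial>\<pi>)
    \<le> (\<integral>\<omega>. norm (X \<omega> - Y \<omega>) powr p \<partial>M)"
    by (intro enn2real_leI) simp_all
  then show ?thesis
    unfolding W_dist_def using \<open>p > 0\<close> by (intro powr_mono2) auto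
qed

lemma moment_law:
  assumes "X \<in> borel_measurable M"
  shows "moment p (distr M borel X) = (\<integral>\<omega>. norm (X \<omega>) powr p \<partial>M) powr (1 / p)"
  using assms by (simp add: moment_def integral_distr)

lemma law_in_P_space:
  fixes X :: "'w \<Rightarrow> 'a::euclidean_space"
  assumes "prob_space M" and [measurable]: "X \<in> borel_measurable M"
    and int: "integrable M (\<lambda>\<omega>. norm (X \<omega>) powr p)"
  shows "distr M borel X \<in> P_space p euclidean_metric"
proof -
  have "(\<integral>\<^sup>+ x. ennreal (dist x 0 powr p) \<partial>distr M borel X) = (\<integral>\<^sup>+ \<omega>. ennreal (norm (X \<omega>) powr p) \<partial>M)"
    by (simp add: nn_integral_distr)
  also have "\<dots> < \<infinity>"
    using nn_integral_eq_integral[OF int] by simp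
  finally show ?thesis
    unfolding P_space_def using prob_space.prob_space_distr[OF assms(1,2)]
    by (auto simp: borel_of_euclidean intro!: exI[of _ 0])
qed

text \<open>\<open>R\<close> will be the weight \<open>1 + |x0|\<close>, or a variable that
  dominates a whole path at once.\<close>

lemma integrable_powr_dominated:
  fixes X :: "'w \<Rightarrow> 'a::euclidean_space"
  assumes "integrable M (\<lambda>\<omega>. R \<omega> powr p)" and [measurable]: "X \<in> borel_measurable M"
    and "p \<ge> 0" "D \<ge> 0" "\<And>\<omega>. \<omega> \<in> space M \<Longrightarrow> norm (X \<omega>) \<le> D * R \<omega>" "\<And>\<omega>. \<omega> \<in> space M \<Longrightarrow> R \<omega> \<ge> 0"
  shows "integrable M (\<lambda>\<omega>. norm (X \<omega>) powr p)"
    and "(\<integral>\<omega>. norm (X \<omega>) powr p \<partial>M) \<le> D powr p * (\<integral>\<omega>. R \<omega> powr p \<partial>M)"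
proof -
  have le: "norm (X \<omega>) powr p \<le> D powr p * R \<omega> powr p" if "\<omega> \<in> space M" for \<omega>
    using powr_mono2[OF assms(3) norm_ge_zero assms(5)[OF that]] assms(4) assms(6)[OF that]
    by (simp add: powr_mult)
  show int: "integrable M (\<lambda>\<omega>. norm (X \<omega>) powr p)"
    using le by (intro Bochner_Integration.integrable_bound[OF integrable_mult_right[OF assms(1), of "D powr p"]])
      (auto intro!: AE_I2)
  show "(\<integral>\<omega>. norm (X \<omega>) powr p \<partial>M) \<le> D powr p * (\<integral>\<omega>. R \<omega> powr p \<partial>M)"
    using integral_mono[OF int integrable_mult_right[OF assms(1), of "D powr p"]] le by simp
qed

lemma powr_mean_scale:
  fixes D r p :: real
  assumes "D \<ge> 0" "r \<ge> 0" "p > 0" "s \<le> D powr p * r" "s \<ge> 0"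
  shows "s powr (1 / p) \<le> D * r powr (1 / p)"
proof -
  have "s powr (1 / p) \<le> (D powr p * r) powr (1 / p)"
    using assms by (intro powr_mono2) auto
  also have "\<dots> = D * r powr (1 / p)"
    using assms by (simp add: powr_mult powr_powr)
  finally show ?thesis .
qed

text \<open>Splitting at \<open>d \<omega> \<le> c\<close> bounds the sum by twice its larger term.
  The purpose is to move the reference point of a moment condition.\<close>

lemma integrable_powr_shift:
  fixes d :: "'w \<Rightarrow> real"
  assumes "finite_measure M" and [measurable]: "d \<in> borel_measurable M"
    and "\<And>\<omega>. d \<omega> \<ge> 0" "c \<ge> 0" "p \<ge> 0" and fin: "(\<integral>\<^sup>+ \<omega>. ennreal (d \<omega> powr p) \<partial>M) < \<infinity>"
  shows "integrable M (\<lambda>\<omega>. (c + d \<omega>) powr p)"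
proof -
  interpret finite_measure M by fact
  have le: "(c + d \<omega>) powr p \<le> (2 * c) powr p + 2 powr p * d \<omega> powr p" for \<omega>
  proof (cases "d \<omega> \<le> c")
    case True
    then have "(c + d \<omega>) powr p \<le> (2 * c) powr p"
      using assms by (intro powr_mono2) auto
    then show ?thesis by (simp add: add_increasing2)
  next
    case False
    then have "(c + d \<omega>) powr p \<le> (2 * d \<omega>) powr p"
      using assms by (intro powr_mono2) auto
    then show ?thesis using assms by (simp add: powr_mult add_increasing)
  qed
  have "integrable M (\<lambda>\<omega>. d \<omega> powr p)"
    using fin by (intro integrableI_bounded) auto
  then have "integrable M (\<lambda>\<omega>. (2 * c) powr p + 2 powr p * d \<omega> powr p)"
    by auto
  then show ?thesis
    by (rule Bochner_Integration.integrable_bound) (use le in \<open>auto intro!: AE_I2\<close>)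
qed

section \<open>Estimates for the dynamics\<close>

text \<open>A continuous function on a compact interval is bounded, so the boundedness built into
  \<open>cfunspace\<close> leaves no trace.\<close>

lemma mspace_path_space:
  "x \<in> mspace (path_space T) \<longleftrightarrow> x \<in> extensional {0..T} \<and> continuous_on {0..T} x"
proof -
  have "bounded (x ` {0..T})" if "continuous_on {0..T} x"
    using compact_continuous_image[OF that] by (simp add: compact_imp_bounded)
  then show ?thesis by (auto simp: mbounded_iff_bounded)
qed

definition bounded_path :: "real \<Rightarrow> real \<Rightarrow> (real \<Rightarrow> 'a::real_normed_vector) \<Rightarrow> bool" where
  "bounded_path T b x \<longleftrightarrow> continuous_on {0..T} x \<and> (\<forall>t\<in>{0..T}. norm (x t) \<le> b)"

lemma path_space_bounded:
  assumes "x \<in> mspace (path_space T)"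
  obtains b where "bounded_path T b x"
proof -
  have c: "continuous_on {0..T} x"
    using assms unfolding mspace_path_space by simp
  moreover have "bounded (x ` {0..T})"
    using compact_continuous_image[OF c] by (simp add: compact_imp_bounded)
  ultimately show thesis
    using that by (auto simp: bounded_path_def bounded_iff)
qed

lemma norm_add3_le:
  fixes x u v :: "'a::real_normed_vector"
  assumes "norm u \<le> r" "norm v \<le> r"
  shows "norm (x + u + v) \<le> norm x + 2 * r"
  using assms by norm

lemma norm_add3_diff_le:
  fixes x u v :: "'a::real_normed_vector"
  assumes "norm (u - u') \<le> r" "norm (v - v') \<le> r"
  shows "norm (x + u + v - (x + u' + v')) \<le> 2 * r"
  using assms by norm

text \<open>\<open>\<alpha>\<close> is left out: the estimates hold for each datum separately, and
  trajectories along a prescribed curve do not involve the distribution of the data.\<close>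

locale mean_field =
  fixes T p A :: real
    and f :: "real \<Rightarrow> 'a::euclidean_space \<Rightarrow> 'a measure \<Rightarrow> 'b::euclidean_space
              \<Rightarrow> 'u::metric_space \<Rightarrow> 'v::metric_space \<Rightarrow> 'a"
    and fI :: "real \<Rightarrow> 'a \<Rightarrow> 'a measure \<Rightarrow> 'b \<Rightarrow> 'u \<Rightarrow> 'a"
    and fII :: "real \<Rightarrow> 'a \<Rightarrow> 'a measure \<Rightarrow> 'b \<Rightarrow> 'v \<Rightarrow> 'a"
    and g :: "real \<Rightarrow> 'b \<Rightarrow> 'a measure \<Rightarrow> 'v \<Rightarrow> 'b"
    and y0 :: 'b
    and \<zeta> :: "(real \<times> 'v) measure"
  assumes T_pos: "T > 0" and p_ge_1: "p \<ge> 1" and A_pos: "A > 0"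
    and minor: "SLLL_minor p T A f fI fII"
    and major: "SLLL_major p T A g"
    and \<zeta>: "\<zeta> \<in> relaxed_controls T"
begin

abbreviation \<P> :: "'a measure set" where "\<P> \<equiv> P_space p euclidean_metric"
abbreviation W :: "'a measure \<Rightarrow> 'a measure \<Rightarrow> real" where "W \<equiv> W_dist p euclidean_metric"

text \<open>The bound \<open>c\<close> selects the Lipschitz constants; continuity makes the drifts
  along the curve continuous, hence measurable, integrands.\<close>

definition curve :: "real \<Rightarrow> (real \<Rightarrow> 'a measure) \<Rightarrow> bool" where
  "curve c m \<longleftrightarrow> continuous_map (top_of_set {0..T}) (W_topology p euclidean_metric) m
    \<and> (\<forall>t\<in>{0..T}. moment p (m t) \<le> c)"

lemma curve_in_P: "curve c m \<Longrightarrow> t \<in> {0..T} \<Longrightarrow> m t \<in> \<P>"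
  by (auto simp: curve_def continuous_map_def)

lemma W_nonneg: "W \<mu> \<nu> \<ge> 0"
  by (simp add: W_dist_def)

lemma continuous_map_time:
  fixes x :: "real \<Rightarrow> 'c::topological_space"
  assumes "continuous_on {0..T} x"
  shows "continuous_map (prod_topology (top_of_set {0..T}) Y) euclidean (\<lambda>z. x (fst z))"
  using continuous_map_compose[OF continuous_map_fst, of "top_of_set {0..T}" euclidean x] assms
  by (simp add: o_def)

lemma continuous_map_curve:
  assumes "curve c m"
  shows "continuous_map (prod_topology (top_of_set {0..T}) Y) (W_topology p euclidean_metric) (\<lambda>z. m (fst z))"
  using assms continuous_map_compose[OF continuous_map_fst] by (auto simp: curve_def o_def)

text \<open>The growth condition bounds the sum of the norms of both parts; taking the other control
  arbitrary and dropping its term leaves a single part.\<close>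

lemma growth:
  assumes "t \<in> {0..T}" "\<mu> \<in> \<P>"
  shows "norm (fI t x \<mu> y u) \<le> A * (1 + norm x + moment p \<mu> + norm y)"
    and "norm (fII t x \<mu> y v) \<le> A * (1 + norm x + moment p \<mu> + norm y)"
    and "norm (g t y \<mu> v) \<le> A * (1 + norm y + moment p \<mu>)"
proof -
  have *: "norm (fI t x \<mu> y u) + norm (fII t x \<mu> y v) \<le> A * (1 + norm x + moment p \<mu> + norm y)" for u v
    using minor assms unfolding SLLL_minor_def Let_def by blast
  show "norm (fI t x \<mu> y u) \<le> A * (1 + norm x + moment p \<mu> + norm y)"
    using *[of u undefined] norm_ge_zero[of "fII t x \<mu> y undefined"] by linarith
  show "norm (fII t x \<mu> y v) \<le> A * (1 + norm x + moment p \<mu> + norm y)"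
    using *[of undefined v] norm_ge_zero[of "fI t x \<mu> y undefined"] by linarith
  show "norm (g t y \<mu> v) \<le> A * (1 + norm y + moment p \<mu>)"
    using major assms unfolding SLLL_major_def Let_def by blast
qed

text \<open>\<open>c\<close> restricts the moments and the major states but not \<open>x1\<close>
  and \<open>x2\<close>. This is what admits paths whose size grows with the initial point.\<close>

definition lip :: "real \<Rightarrow> real \<Rightarrow> bool" where
  "lip c L \<longleftrightarrow> L \<ge> 0 \<and> (\<forall>t\<in>{0..T}. \<forall>x1 x2. \<forall>m1\<in>\<P>. \<forall>m2\<in>\<P>. \<forall>y1 y2 u v.
    moment p m1 \<le> c \<and> moment p m2 \<le> c \<and> norm y1 \<le> c \<and> norm y2 \<le> c \<longrightarrow>
      norm (fI t x1 m1 y1 u - fI t x2 m2 y2 u) \<le> L * (norm (x1 - x2) + W m1 m2 + norm (y1 - y2)) \<and>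
      norm (fII t x1 m1 y1 v - fII t x2 m2 y2 v) \<le> L * (norm (x1 - x2) + W m1 m2 + norm (y1 - y2)) \<and>
      norm (g t y1 m1 v - g t y2 m2 v) \<le> L * (norm (y1 - y2) + W m1 m2))"

lemma ex_lip: obtains L where "lip c L"
proof -
  have "\<exists>BI BII. \<forall>t\<in>{0..T}. \<forall>x1 x2. \<forall>m1\<in>\<P>. \<forall>m2\<in>\<P>. \<forall>y1 y2 u v.
        moment p m1 \<le> c \<and> moment p m2 \<le> c \<and> norm y1 \<le> c \<and> norm y2 \<le> c \<longrightarrow>
          norm (fI t x1 m1 y1 u - fI t x2 m2 y2 u)
            \<le> BI * (norm (x1 - x2) + W m1 m2 + norm (y1 - y2)) \<and>
          norm (fII t x1 m1 y1 v - fII t x2 m2 y2 v)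
            \<le> BII * (norm (x1 - x2) + W m1 m2 + norm (y1 - y2))"
    using minor unfolding SLLL_minor_def Let_def by blast
  then obtain BI BII where BI: "\<And>t x1 x2 m1 m2 y1 y2 u v. t \<in> {0..T} \<Longrightarrow> m1 \<in> \<P> \<Longrightarrow> m2 \<in> \<P> \<Longrightarrow>
        moment p m1 \<le> c \<and> moment p m2 \<le> c \<and> norm y1 \<le> c \<and> norm y2 \<le> c \<Longrightarrow>
          norm (fI t x1 m1 y1 u - fI t x2 m2 y2 u)
            \<le> BI * (norm (x1 - x2) + W m1 m2 + norm (y1 - y2)) \<and>
          norm (fII t x1 m1 y1 v - fII t x2 m2 y2 v)
            \<le> BII * (norm (x1 - x2) + W m1 m2 + norm (y1 - y2))"
    by blast
  have "\<exists>B. \<forall>t\<in>{0..T}. \<forall>y1 y2. \<forall>m1\<in>\<P>. \<forall>m2\<in>\<P>. \<forall>v.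
        norm y1 \<le> c \<and> norm y2 \<le> c \<and> moment p m1 \<le> c \<and> moment p m2 \<le> c \<longrightarrow>
          norm (g t y1 m1 v - g t y2 m2 v) \<le> B * (norm (y1 - y2) + W m1 m2)"
    using major unfolding SLLL_major_def Let_def by blast
  then obtain B where B: "\<And>t m1 m2 y1 y2 v. t \<in> {0..T} \<Longrightarrow> m1 \<in> \<P> \<Longrightarrow> m2 \<in> \<P> \<Longrightarrow>
        moment p m1 \<le> c \<and> moment p m2 \<le> c \<and> norm y1 \<le> c \<and> norm y2 \<le> c \<Longrightarrow>
          norm (g t y1 m1 v - g t y2 m2 v) \<le> B * (norm (y1 - y2) + W m1 m2)"
    by blast
  \<comment> \<open>The three constants obtained may be negative; absolute values give a common
    upper bound that is not.\<close>
  define L where "L = \<bar>BI\<bar> + \<bar>BII\<bar> + \<bar>B\<bar>"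
  have up: "s \<le> L * q" if "s \<le> C * q" "q \<ge> 0" "C \<le> L" for s q C
    using that mult_right_mono[of C L q] by linarith
  have "lip c L"
    unfolding lip_def
  proof (intro conjI ballI allI impI)
    fix t x1 x2 m1 m2 u v and y1 y2 :: 'b
    assume *: "t \<in> {0..T}" "m1 \<in> \<P>" "m2 \<in> \<P>"
      "moment p m1 \<le> c \<and> moment p m2 \<le> c \<and> norm y1 \<le> c \<and> norm y2 \<le> c"
    show "norm (fI t x1 m1 y1 u - fI t x2 m2 y2 u) \<le> L * (norm (x1 - x2) + W m1 m2 + norm (y1 - y2))"
      by (rule up[of _ BI]) (use BI[OF *] W_nonneg in \<open>auto simp: L_def\<close>)
    show "norm (fII t x1 m1 y1 v - fII t x2 m2 y2 v) \<le> L * (norm (x1 - x2) + W m1 m2 + norm (y1 - y2))"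
      by (rule up[of _ BII]) (use BI[OF *] W_nonneg in \<open>auto simp: L_def\<close>)
    show "norm (g t y1 m1 v - g t y2 m2 v) \<le> L * (norm (y1 - y2) + W m1 m2)"
      by (rule up[of _ B]) (use B[OF *] W_nonneg in \<open>auto simp: L_def\<close>)
  qed (simp add: L_def)
  then show thesis by (rule that)
qed

section \<open>Continuity of the drifts along continuous curves, and the integral operators\<close>

abbreviation "drift_I m y x \<equiv> \<lambda>(\<tau>, u). fI \<tau> (x \<tau>) (m \<tau>) (y \<tau>) u"
abbreviation "drift_II m y x \<equiv> \<lambda>(\<tau>, v). fII \<tau> (x \<tau>) (m \<tau>) (y \<tau>) v"
abbreviation "drift_major m y \<equiv> \<lambda>(\<tau>, v). g \<tau> (y \<tau>) (m \<tau>) v"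

lemma continuous_drift_minor:
  assumes "curve c m" "continuous_on {0..T} y" "continuous_on {0..T} x"
  shows "continuous_map (strip T) euclidean (drift_I m y x)"
    and "continuous_map (strip T) euclidean (drift_II m y x)"
proof -
  have *: "continuous_map (prod_topology (top_of_set {0..T}) Y)
    (prod_topology (top_of_set {0..T}) (prod_topology euclidean
      (prod_topology (W_topology p euclidean_metric) (prod_topology euclidean Y))))
    (\<lambda>z. (fst z, x (fst z), m (fst z), y (fst z), snd z))" for Y :: "'z topology"
    by (intro continuous_map_pairedI continuous_map_fst continuous_map_snd continuous_map_time
        continuous_map_curve[OF assms(1)] assms)
  have I: "continuous_map
        (prod_topology (top_of_set {0..T}) (prod_topology euclidean
          (prod_topology (W_topology p euclidean_metric) (prod_topology euclidean euclidean)))) euclidean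
        (\<lambda>(t, x, m, y, u). fI t x m y u)"
    and II: "continuous_map
        (prod_topology (top_of_set {0..T}) (prod_topology euclidean
          (prod_topology (W_topology p euclidean_metric) (prod_topology euclidean euclidean)))) euclidean
        (\<lambda>(t, x, m, y, v). fII t x m y v)"
    using minor unfolding SLLL_minor_def Let_def by blast+
  show "continuous_map (strip T) euclidean (drift_I m y x)"
    using continuous_map_compose[OF * I] by (simp add: o_def case_prod_beta')
  show "continuous_map (strip T) euclidean (drift_II m y x)"
    using continuous_map_compose[OF * II] by (simp add: o_def case_prod_beta')
qed

lemma continuous_drift_major:
  assumes "curve c m" "continuous_on {0..T} y"
  shows "continuous_map (strip T) euclidean (drift_major m y)"
proof -
  have *: "continuous_map (strip T)
    (prod_topology (top_of_set {0..T}) (prod_topology euclidean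
      (prod_topology (W_topology p euclidean_metric) euclidean)))
    (\<lambda>z :: real \<times> 'v. (fst z, y (fst z), m (fst z), snd z))"
    by (intro continuous_map_pairedI continuous_map_fst continuous_map_time continuous_map_snd
        continuous_map_curve[OF assms(1)] assms)
  have "continuous_map
        (prod_topology (top_of_set {0..T}) (prod_topology euclidean
          (prod_topology (W_topology p euclidean_metric) euclidean)))
        euclidean (\<lambda>(t, y, m, v). g t y m v)"
    using major unfolding SLLL_major_def Let_def by blast
  from continuous_map_compose[OF * this] show ?thesis
    by (simp add: o_def case_prod_beta')
qed

definition minor_step ::
  "(real \<Rightarrow> 'a measure) \<Rightarrow> (real \<Rightarrow> 'b) \<Rightarrow> 'a \<times> (real \<times> 'u) measure \<Rightarrow> (real \<Rightarrow> 'a) \<Rightarrow> real \<Rightarrow> 'a" where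
  "minor_step m y \<omega> x t =
    fst \<omega> + relaxed_int (snd \<omega>) t (drift_I m y x) + relaxed_int \<zeta> t (drift_II m y x)"

definition major_step :: "(real \<Rightarrow> 'a measure) \<Rightarrow> (real \<Rightarrow> 'b) \<Rightarrow> real \<Rightarrow> 'b" where
  "major_step m y t = y0 + relaxed_int \<zeta> t (drift_major m y)"

section \<open>Regularity and growth of the integral operators\<close>

context
  fixes c :: real and m :: "real \<Rightarrow> 'a measure" and y :: "real \<Rightarrow> 'b"
  assumes m: "curve c m" and y: "bounded_path T c y"
begin

lemma drift_major_le:
  assumes "\<tau> \<in> {0..T}"
  shows "norm (drift_major m y (\<tau>, v)) \<le> A * (1 + 2 * c)"
proof -
  have "norm (y \<tau>) \<le> c" "moment p (m \<tau>) \<le> c"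
    using m y assms by (simp_all add: curve_def bounded_path_def)
  then have "1 + norm (y \<tau>) + moment p (m \<tau>) \<le> 1 + 2 * c"
    by linarith
  then have "A * (1 + norm (y \<tau>) + moment p (m \<tau>)) \<le> A * (1 + 2 * c)"
    using A_pos by (intro mult_left_mono) auto
  from order_trans[OF growth(3)[OF assms curve_in_P[OF m assms]] this] show ?thesis
    by simp
qed

lemma drift_minor_le:
  assumes "bounded_path T b x" "\<tau> \<in> {0..T}"
  shows "norm (drift_I m y x (\<tau>, u)) \<le> A * (1 + b + 2 * c)"
    and "norm (drift_II m y x (\<tau>, v)) \<le> A * (1 + b + 2 * c)"
proof -
  have "norm (x \<tau>) \<le> b" "moment p (m \<tau>) \<le> c" "norm (y \<tau>) \<le> c"
    using m y assms by (simp_all add: curve_def bounded_path_def)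
  then have "1 + norm (x \<tau>) + moment p (m \<tau>) + norm (y \<tau>) \<le> 1 + b + 2 * c"
    by linarith
  then have *: "A * (1 + norm (x \<tau>) + moment p (m \<tau>) + norm (y \<tau>)) \<le> A * (1 + b + 2 * c)"
    using A_pos by (intro mult_left_mono) auto
  show "norm (drift_I m y x (\<tau>, u)) \<le> A * (1 + b + 2 * c)"
    using order_trans[OF growth(1)[OF assms(2) curve_in_P[OF m assms(2)]] *] by simp
  show "norm (drift_II m y x (\<tau>, v)) \<le> A * (1 + b + 2 * c)"
    using order_trans[OF growth(2)[OF assms(2) curve_in_P[OF m assms(2)]] *] by simp
qed

lemma cont_y: "continuous_on {0..T} y"
  using y by (simp add: bounded_path_def)

lemmas cont_drift_major = continuous_drift_major[OF m cont_y]

lemma cont_drift_minor: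
  assumes "bounded_path T b x"
  shows "continuous_map (strip T) euclidean (drift_I m y x)"
    and "continuous_map (strip T) euclidean (drift_II m y x)"
  using continuous_drift_minor[OF m cont_y] assms by (simp_all add: bounded_path_def)

text \<open>In the bounded class the drift is bounded and continuous, so integrability is automatic
  and only the fixed point equation remains.\<close>

lemma solves_major_iff:
  "solves_major T g m y0 \<zeta> y \<longleftrightarrow> y \<in> extensional {0..T} \<and> (\<forall>t\<in>{0..T}. y t = major_step m y t)"
  using set_integrable_relaxed[OF \<zeta> cont_drift_major drift_major_le] cont_y
  by (auto simp: solves_major_def mspace_path_space major_step_def simp del: mspace_cfunspace)

lemma solves_minor_iff:
  assumes "bounded_path T b x" "\<xi> \<in> relaxed_controls T"
  shows "solves_minor T fI fII m y x0 \<xi> \<zeta> x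
    \<longleftrightarrow> x \<in> extensional {0..T} \<and> (\<forall>t\<in>{0..T}. x t = minor_step m y (x0, \<xi>) x t)"
  using set_integrable_relaxed[OF assms(2) cont_drift_minor(1) drift_minor_le(1), OF assms(1,1)]
    set_integrable_relaxed[OF \<zeta> cont_drift_minor(2) drift_minor_le(2), OF assms(1,1)] assms(1)
  by (auto simp: solves_minor_def mspace_path_space minor_step_def bounded_path_def
      simp del: mspace_cfunspace)

lemma minor_step_lipschitz:
  assumes "bounded_path T b x" "snd \<omega> \<in> relaxed_controls T" "s \<in> {0..T}" "t \<in> {0..T}"
  shows "norm (minor_step m y \<omega> x t - minor_step m y \<omega> x s) \<le> 2 * A * (1 + b + 2 * c) * \<bar>t - s\<bar>"
proof -
  have "norm (relaxed_int (snd \<omega>) t (drift_I m y x) - relaxed_int (snd \<omega>) s (drift_I m y x))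
      \<le> A * (1 + b + 2 * c) * \<bar>t - s\<bar>"
    by (rule relaxed_int_lipschitz[OF assms(2) cont_drift_minor(1) drift_minor_le(1)]) (use assms in auto)
  moreover have "norm (relaxed_int \<zeta> t (drift_II m y x) - relaxed_int \<zeta> s (drift_II m y x))
      \<le> A * (1 + b + 2 * c) * \<bar>t - s\<bar>"
    by (rule relaxed_int_lipschitz[OF \<zeta> cont_drift_minor(2) drift_minor_le(2)]) (use assms in auto)
  ultimately show ?thesis
    unfolding minor_step_def mult.assoc by (intro norm_add3_diff_le) (simp_all add: mult.assoc)
qed

lemma major_step_lipschitz:
  assumes "s \<in> {0..T}" "t \<in> {0..T}"
  shows "norm (major_step m y t - major_step m y s) \<le> A * (1 + 2 * c) * \<bar>t - s\<bar>"
  using relaxed_int_lipschitz[OF \<zeta> cont_drift_major drift_major_le assms]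
  by (simp add: major_step_def)

text \<open>Exponential bounds of rate \<open>K\<close> on the inputs come back with a factor
  \<open>1 / K\<close>. The constant 1 of the growth condition is absorbed in \<open>1 + a\<close>,
  as \<open>exp (K * \<tau>) \<ge> 1\<close>, and the 2 counts the two integrals.\<close>

lemma minor_step_growth:
  assumes x: "bounded_path T b x" and \<xi>: "snd \<omega> \<in> relaxed_controls T" and "t \<in> {0..T}" "K > 0"
    and exp: "\<And>\<tau>. \<tau> \<in> {0..T} \<Longrightarrow> norm (x \<tau>) + moment p (m \<tau>) + norm (y \<tau>) \<le> a * exp (K * \<tau>)"
  shows "norm (minor_step m y \<omega> x t) \<le> norm (fst \<omega>) + 2 * (A * (1 + a) / K * exp (K * t))"
proof -
  have *: "A * (1 + norm (x \<tau>) + moment p (m \<tau>) + norm (y \<tau>)) \<le> A * (1 + a) * exp (K * \<tau>)"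
    if "\<tau> \<in> {0..T}" for \<tau>
  proof -
    have "1 \<le> exp (K * \<tau>)" using that \<open>K > 0\<close> by simp
    then have "1 + (norm (x \<tau>) + moment p (m \<tau>) + norm (y \<tau>)) \<le> (1 + a) * exp (K * \<tau>)"
      using exp[OF that] unfolding distrib_right by linarith
    then show ?thesis
      using A_pos by (simp add: mult.assoc add.assoc)
  qed
  have "norm (relaxed_int (snd \<omega>) t (drift_I m y x)) \<le> A * (1 + a) / K * exp (K * t)"
    by (rule norm_relaxed_int_exp_le[OF \<xi> cont_drift_minor(1)[OF x]])
      (use order_trans[OF growth(1)[OF _ curve_in_P[OF m]] *] assms in auto)
  moreover have "norm (relaxed_int \<zeta> t (drift_II m y x)) \<le> A * (1 + a) / K * exp (K * t)"
    by (rule norm_relaxed_int_exp_le[OF \<zeta> cont_drift_minor(2)[OF x]])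
      (use order_trans[OF growth(2)[OF _ curve_in_P[OF m]] *] assms in auto)
  ultimately show ?thesis
    unfolding minor_step_def by (rule norm_add3_le)
qed

lemma major_step_growth:
  assumes "t \<in> {0..T}" "K > 0"
    and exp: "\<And>\<tau>. \<tau> \<in> {0..T} \<Longrightarrow> moment p (m \<tau>) + norm (y \<tau>) \<le> a * exp (K * \<tau>)"
  shows "norm (major_step m y t) \<le> norm y0 + A * (1 + a) / K * exp (K * t)"
proof -
  have *: "A * (1 + norm (y \<tau>) + moment p (m \<tau>)) \<le> A * (1 + a) * exp (K * \<tau>)"
    if "\<tau> \<in> {0..T}" for \<tau>
  proof -
    have "1 \<le> exp (K * \<tau>)" using that \<open>K > 0\<close> by simp
    then have "1 + (norm (y \<tau>) + moment p (m \<tau>)) \<le> (1 + a) * exp (K * \<tau>)"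
      using exp[OF that] unfolding distrib_right by linarith
    then show ?thesis
      using A_pos by (simp add: mult.assoc add.assoc)
  qed
  have "norm (relaxed_int \<zeta> t (drift_major m y)) \<le> A * (1 + a) / K * exp (K * t)"
    by (rule norm_relaxed_int_exp_le[OF \<zeta> cont_drift_major])
      (use order_trans[OF growth(3)[OF _ curve_in_P[OF m]] *] assms in auto)
  then show ?thesis
    unfolding major_step_def by (meson add_left_mono norm_triangle_ineq order_trans)
qed

end

section \<open>Stability of the integral operators under changes of curve, path and major
  state\<close>

context
  fixes c L :: real and m m' :: "real \<Rightarrow> 'a measure" and y y' :: "real \<Rightarrow> 'b"
  assumes m: "curve c m" "curve c m'" and y: "bounded_path T c y" "bounded_path T c y'"
    and L: "lip c L"
begin

lemma drift_diff_le:
  assumes "\<tau> \<in> {0..T}"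
  shows "norm (drift_I m y x (\<tau>, u) - drift_I m' y' x' (\<tau>, u))
      \<le> L * (norm (x \<tau> - x' \<tau>) + W (m \<tau>) (m' \<tau>) + norm (y \<tau> - y' \<tau>))"
    and "norm (drift_II m y x (\<tau>, v) - drift_II m' y' x' (\<tau>, v))
      \<le> L * (norm (x \<tau> - x' \<tau>) + W (m \<tau>) (m' \<tau>) + norm (y \<tau> - y' \<tau>))"
    and "norm (drift_major m y (\<tau>, v) - drift_major m' y' (\<tau>, v))
      \<le> L * (norm (y \<tau> - y' \<tau>) + W (m \<tau>) (m' \<tau>))"
proof -
  have *: "moment p (m \<tau>) \<le> c \<and> moment p (m' \<tau>) \<le> c \<and> norm (y \<tau>) \<le> c \<and> norm (y' \<tau>) \<le> c"
    "m \<tau> \<in> \<P>" "m' \<tau> \<in> \<P>"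
    using m y assms curve_in_P by (auto simp: curve_def bounded_path_def)
  then show "norm (drift_I m y x (\<tau>, u) - drift_I m' y' x' (\<tau>, u))
      \<le> L * (norm (x \<tau> - x' \<tau>) + W (m \<tau>) (m' \<tau>) + norm (y \<tau> - y' \<tau>))"
    and "norm (drift_II m y x (\<tau>, v) - drift_II m' y' x' (\<tau>, v))
      \<le> L * (norm (x \<tau> - x' \<tau>) + W (m \<tau>) (m' \<tau>) + norm (y \<tau> - y' \<tau>))"
    and "norm (drift_major m y (\<tau>, v) - drift_major m' y' (\<tau>, v))
      \<le> L * (norm (y \<tau> - y' \<tau>) + W (m \<tau>) (m' \<tau>))"
    using L assms unfolding lip_def case_prod_conv by blast+
qed

text \<open>Both evaluations use the same datum, so the initial points cancel and only differences
  of drifts under the same controls remain; each of the two integrals gains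
  \<open>1 / K\<close>.\<close>

lemma minor_step_diff:
  assumes x: "bounded_path T b x" "bounded_path T b' x'" and \<xi>: "snd \<omega> \<in> relaxed_controls T"
    and t: "t \<in> {0..T}" and "K > 0"
    and exp: "\<And>\<tau>. \<tau> \<in> {0..T} \<Longrightarrow>
      norm (x \<tau> - x' \<tau>) + W (m \<tau>) (m' \<tau>) + norm (y \<tau> - y' \<tau>) \<le> a * exp (K * \<tau>)"
  shows "norm (minor_step m y \<omega> x t - minor_step m' y' \<omega> x' t) \<le> 2 * (L * a / K * exp (K * t))"
proof -
  have *: "L * (norm (x \<tau> - x' \<tau>) + W (m \<tau>) (m' \<tau>) + norm (y \<tau> - y' \<tau>)) \<le> L * a * exp (K * \<tau>)"
    if "\<tau> \<in> {0..T}" for \<tau>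
    using mult_left_mono[OF exp[OF that], of L] L by (simp add: lip_def mult.assoc)
  note I = cont_drift_minor(1)[OF m(1) y(1) x(1)] cont_drift_minor(1)[OF m(2) y(2) x(2)]
  note II = cont_drift_minor(2)[OF m(1) y(1) x(1)] cont_drift_minor(2)[OF m(2) y(2) x(2)]
  have "norm (relaxed_int (snd \<omega>) t (\<lambda>z. drift_I m y x z - drift_I m' y' x' z)) \<le> L * a / K * exp (K * t)"
    using order_trans[OF drift_diff_le(1)[of _ x _ x'] *] t \<open>K > 0\<close>
    by (intro norm_relaxed_int_exp_le[OF \<xi> continuous_map_diff[OF I]])
  then have "norm (relaxed_int (snd \<omega>) t (drift_I m y x) - relaxed_int (snd \<omega>) t (drift_I m' y' x'))
      \<le> L * a / K * exp (K * t)"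
    using relaxed_int_diff[OF \<xi> I(1) drift_minor_le(1)[OF m(1) y(1) x(1)] I(2) drift_minor_le(1)[OF m(2) y(2) x(2)] t]
    by simp
  moreover have "norm (relaxed_int \<zeta> t (\<lambda>z. drift_II m y x z - drift_II m' y' x' z)) \<le> L * a / K * exp (K * t)"
    using order_trans[OF drift_diff_le(2)[of _ x _ x'] *] t \<open>K > 0\<close>
    by (intro norm_relaxed_int_exp_le[OF \<zeta> continuous_map_diff[OF II]])
  then have "norm (relaxed_int \<zeta> t (drift_II m y x) - relaxed_int \<zeta> t (drift_II m' y' x'))
      \<le> L * a / K * exp (K * t)"
    using relaxed_int_diff[OF \<zeta> II(1) drift_minor_le(2)[OF m(1) y(1) x(1)] II(2) drift_minor_le(2)[OF m(2) y(2) x(2)] t]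
    by simp
  ultimately show ?thesis
    unfolding minor_step_def by (rule norm_add3_diff_le)
qed

lemma major_step_diff:
  assumes t: "t \<in> {0..T}" and "K > 0"
    and exp: "\<And>\<tau>. \<tau> \<in> {0..T} \<Longrightarrow> W (m \<tau>) (m' \<tau>) + norm (y \<tau> - y' \<tau>) \<le> a * exp (K * \<tau>)"
  shows "norm (major_step m y t - major_step m' y' t) \<le> L * a / K * exp (K * t)"
proof -
  have *: "L * (norm (y \<tau> - y' \<tau>) + W (m \<tau>) (m' \<tau>)) \<le> L * a * exp (K * \<tau>)"
    if "\<tau> \<in> {0..T}" for \<tau>
    using mult_left_mono[OF exp[OF that], of L] L by (simp add: lip_def mult.assoc add.commute)
  note c = cont_drift_major[OF m(1) y(1)] cont_drift_major[OF m(2) y(2)]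
  have "norm (relaxed_int \<zeta> t (\<lambda>z. drift_major m y z - drift_major m' y' z)) \<le> L * a / K * exp (K * t)"
    using order_trans[OF drift_diff_le(3) *] t \<open>K > 0\<close>
    by (intro norm_relaxed_int_exp_le[OF \<zeta> continuous_map_diff[OF c]])
  then show ?thesis
    using relaxed_int_diff[OF \<zeta> c(1) drift_major_le[OF m(1) y(1)] c(2) drift_major_le[OF m(2) y(2)] t]
    by (simp add: major_step_def)
qed

end

end

section \<open>Processes depending continuously on the data\<close>

text \<open>The diagonal coupling has zero cost: both variables of the coupling estimate are the
  identity.\<close>

lemma W_dist_self:
  fixes \<mu> :: "'a::euclidean_space measure"
  assumes "\<mu> \<in> P_space p euclidean_metric" "p > 0"
  shows "W_dist p euclidean_metric \<mu> \<mu> = 0"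
proof -
  have "sets \<mu> = sets borel"
    using assms by (simp add: P_space_def borel_of_euclidean)
  then have m: "(\<lambda>x. x) \<in> borel_measurable \<mu>" and d: "distr \<mu> borel (\<lambda>x. x) = \<mu>"
    by (auto simp: distr_id2 cong: measurable_cong_sets)
  have "W_dist p euclidean_metric \<mu> \<mu> \<le> 0"
    using W_dist_law_le[OF m m, of p] assms(2) by (simp add: d)
  then show ?thesis
    by (simp add: W_dist_def order.antisym)
qed

lemma le_of_le_add_small:
  fixes a B k :: real
  assumes "\<And>e. e > 0 \<Longrightarrow> a \<le> B + e * k" "k \<ge> 0"
  shows "a \<le> B"
proof (rule field_le_epsilon)
  fix e :: real assume "e > 0"
  then have "a \<le> B + e / (k + 1) * k"
    using assms(1)[of "e / (k + 1)"] assms(2) by simp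
  also have "e / (k + 1) * k \<le> e"
    using \<open>e > 0\<close> assms(2) by (simp add: field_simps)
  finally show "a \<le> B + e" by simp
qed

context mean_field
begin

abbreviation data :: "('a \<times> (real \<times> 'u) measure) topology" where
  "data \<equiv> prod_topology euclidean (relaxed_topology T)"

abbreviation weight :: "'a \<times> (real \<times> 'u) measure \<Rightarrow> real" where
  "weight \<omega> \<equiv> 1 + norm (fst \<omega>)"

text \<open>Continuity for the sup norm over \<open>{0..T}\<close>, written out because the paths
  \<open>X \<omega>\<close> need not be extensional and so need not be points of the path
  space.\<close>

definition continuous_in_data :: "('a \<times> (real \<times> 'u) measure \<Rightarrow> real \<Rightarrow> 'a) \<Rightarrow> bool" where
  "continuous_in_data X \<longleftrightarrow> (\<forall>\<omega>\<in>topspace data. \<forall>e>0. \<exists>N. openin data N \<and> \<omega> \<in> N \<and>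
    (\<forall>\<omega>'\<in>N. \<forall>t\<in>{0..T}. norm (X \<omega>' t - X \<omega> t) < e))"

text \<open>The Lipschitz bound in time yields continuity of each path and, after integration over
  the data, of the curve of laws. Both bounds scale with the weight because the drifts grow linearly
  in the path.\<close>

definition process :: "real \<Rightarrow> real \<Rightarrow> ('a \<times> (real \<times> 'u) measure \<Rightarrow> real \<Rightarrow> 'a) \<Rightarrow> bool" where
  "process b l X \<longleftrightarrow> continuous_in_data X \<and> (\<forall>\<omega>\<in>topspace data.
    (\<forall>t\<in>{0..T}. norm (X \<omega> t) \<le> b * weight \<omega>) \<and>
    (\<forall>s\<in>{0..T}. \<forall>t\<in>{0..T}. norm (X \<omega> t - X \<omega> s) \<le> l * weight \<omega> * \<bar>t - s\<bar>))"

lemma bounded_pathI_lipschitz: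
  assumes "\<And>t. t \<in> {0..T} \<Longrightarrow> norm (x t) \<le> b"
    and "\<And>s t. s \<in> {0..T} \<Longrightarrow> t \<in> {0..T} \<Longrightarrow> norm (x t - x s) \<le> l * \<bar>t - s\<bar>"
  shows "bounded_path T b x"
proof -
  have "\<bar>l\<bar>-lipschitz_on {0..T} x"
  proof (rule lipschitz_onI)
    fix s t assume "s \<in> {0..T}" "t \<in> {0..T}"
    then have "norm (x s - x t) \<le> l * \<bar>s - t\<bar>" using assms(2) by blast
    also have "\<dots> \<le> \<bar>l\<bar> * \<bar>s - t\<bar>" by (intro mult_right_mono) auto
    finally show "dist (x s) (x t) \<le> \<bar>l\<bar> * dist s t" by (simp add: dist_norm)
  qed simp
  then show ?thesis
    using assms(1) lipschitz_on_continuous_on by (auto simp: bounded_path_def)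
qed

lemma process_path:
  assumes "process b l X" "\<omega> \<in> topspace data"
  shows "bounded_path T (b * weight \<omega>) (X \<omega>)"
  by (rule bounded_pathI_lipschitz[where l = "l * weight \<omega>"])
    (use assms in \<open>unfold process_def, blast+\<close>)

text \<open>The difference splits into the change of the path under the control of \<omega>',
  handled by stability; the change of the initial point; and the change of the control along the
  fixed path \<open>X \<omega>\<close>. The narrow neighbourhood for the last term depends on the
  integrand, which is why the path is held at \<omega> there.\<close>

lemma minor_step_continuous_in_data:
  assumes m: "curve c m" and y: "bounded_path T c y" and X: "process b l X"
  shows "continuous_in_data (\<lambda>\<omega>. minor_step m y \<omega> (X \<omega>))"
  unfolding continuous_in_data_def
proof (intro ballI allI impI)
  fix \<omega> e assume \<omega>: "\<omega> \<in> topspace data" and e: "(e :: real) > 0"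
  obtain L where L: "lip c L" by (rule ex_lip)
  then have L0: "L \<ge> 0" by (simp add: lip_def)
  \<comment> \<open>Chosen so that the stability bound with rate 1,
    \<open>2 * (L * \<delta> * exp T)\<close>, is at most \<open>e / 3\<close>; \<open>L + 1\<close>
    covers the case \<open>L = 0\<close>.\<close>
  define \<delta> where "\<delta> = e / (6 * (L + 1) * exp T)"
  have \<delta>: "\<delta> > 0" using e L0 by (simp add: \<delta>_def)
  have "2 * (L * \<delta> * exp T) = e / 3 * (L / (L + 1))"
  proof -
    have "L + 1 \<noteq> 0" using L0 by simp
    then show ?thesis by (simp add: \<delta>_def divide_simps)
  qed
  also have "\<dots> \<le> e / 3 * 1"
    using L0 e by (intro mult_left_mono) auto
  finally have \<delta>_le: "2 * (L * \<delta> * exp T) \<le> e / 3" by simp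
  have "continuous_in_data X" using X by (simp add: process_def)
  from this[unfolded continuous_in_data_def, rule_format, OF \<omega> \<delta>]
  obtain N1 where N1: "openin data N1" "\<omega> \<in> N1"
    "\<And>\<omega>' t. \<omega>' \<in> N1 \<Longrightarrow> t \<in> {0..T} \<Longrightarrow> norm (X \<omega>' t - X \<omega> t) < \<delta>"
    by blast
  note x = process_path[OF X \<omega>]
  have \<xi>: "snd \<omega> \<in> relaxed_controls T" using \<omega> by auto
  have "\<exists>N. openin (relaxed_topology T) N \<and> snd \<omega> \<in> N \<and>
    (\<forall>\<xi>'\<in>N. \<forall>t\<in>{0..T}. norm (relaxed_int \<xi>' t (drift_I m y (X \<omega>))
      - relaxed_int (snd \<omega>) t (drift_I m y (X \<omega>))) < e / 3)"
    by (rule narrow_neighbourhood_uniform[OF cont_drift_minor(1)[OF m y x] drift_minor_le(1)[OF m y x] \<xi>])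
      (use e in auto)
  then obtain N2 where N2: "openin (relaxed_topology T) N2" "snd \<omega> \<in> N2"
    "\<And>\<xi>' t. \<xi>' \<in> N2 \<Longrightarrow> t \<in> {0..T} \<Longrightarrow> norm (relaxed_int \<xi>' t (drift_I m y (X \<omega>))
      - relaxed_int (snd \<omega>) t (drift_I m y (X \<omega>))) < e / 3"
    by blast
  define N where "N = N1 \<inter> (ball (fst \<omega>) (e / 3) \<times> N2)"
  have "openin data (ball (fst \<omega>) (e / 3) \<times> N2)"
    using N2(1) by (simp add: openin_prod_Times_iff)
  then have "openin data N"
    unfolding N_def using N1(1) by (rule openin_Int[rotated])
  moreover have "\<omega> \<in> N"
    using N1(2) N2(2) e by (cases \<omega>) (simp add: N_def)
  moreover have "norm (minor_step m y \<omega>' (X \<omega>') t - minor_step m y \<omega> (X \<omega>) t) < e"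
    if \<omega>': "\<omega>' \<in> N" and t: "t \<in> {0..T}" for \<omega>' t
  proof -
    have \<omega>'_data: "\<omega>' \<in> topspace data"
      using \<open>openin data N\<close> \<omega>' openin_subset by blast
    then have \<xi>': "snd \<omega>' \<in> relaxed_controls T" by auto
    have "norm (minor_step m y \<omega>' (X \<omega>') t - minor_step m y \<omega>' (X \<omega>) t) \<le> 2 * (L * \<delta> / 1 * exp (1 * t))"
    proof (rule minor_step_diff[OF m m y y L process_path[OF X \<omega>'_data] x \<xi>' t])
      fix \<tau> assume \<tau>: "\<tau> \<in> {0..T}"
      have "W (m \<tau>) (m \<tau>) = 0"
        using W_dist_self[OF curve_in_P[OF m \<tau>]] p_ge_1 by simp
      moreover have "norm (X \<omega>' \<tau> - X \<omega> \<tau>) < \<delta>"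
        using N1(3) \<omega>' \<tau> by (simp add: N_def)
      moreover have "\<delta> * 1 \<le> \<delta> * exp (1 * \<tau>)"
        using \<delta> \<tau> by (intro mult_left_mono) auto
      ultimately show "norm (X \<omega>' \<tau> - X \<omega> \<tau>) + W (m \<tau>) (m \<tau>) + norm (y \<tau> - y \<tau>) \<le> \<delta> * exp (1 * \<tau>)"
        by simp
    qed simp
    also have "\<dots> \<le> 2 * (L * \<delta> * exp T)"
      using t L0 \<delta> by (simp add: mult_left_mono)
    finally have 1: "norm (minor_step m y \<omega>' (X \<omega>') t - minor_step m y \<omega>' (X \<omega>) t) \<le> e / 3"
      using \<delta>_le by linarith
    have 2: "norm (fst \<omega>' - fst \<omega>) < e / 3"
      using \<omega>' by (auto simp: N_def dist_norm norm_minus_commute)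
    have 3: "norm (relaxed_int (snd \<omega>') t (drift_I m y (X \<omega>))
      - relaxed_int (snd \<omega>) t (drift_I m y (X \<omega>))) < e / 3"
      using N2(3) \<omega>' t by (auto simp: N_def)
    have "minor_step m y \<omega>' (X \<omega>') t - minor_step m y \<omega> (X \<omega>) t =
        (minor_step m y \<omega>' (X \<omega>') t - minor_step m y \<omega>' (X \<omega>) t) + (fst \<omega>' - fst \<omega>)
        + (relaxed_int (snd \<omega>') t (drift_I m y (X \<omega>)) - relaxed_int (snd \<omega>) t (drift_I m y (X \<omega>)))"
      by (simp add: minor_step_def)
    moreover have "norm (\<dots>) < e / 3 + e / 3 + e / 3"
      using 1 2 3 by (intro order.strict_trans1[OF norm_triangle_ineq] add_le_less_mono
          order.trans[OF norm_triangle_ineq] add_mono) auto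
    ultimately have "norm (minor_step m y \<omega>' (X \<omega>') t - minor_step m y \<omega> (X \<omega>) t) < e / 3 + e / 3 + e / 3"
      by (simp only:)
    then show ?thesis by simp
  qed
  ultimately show "\<exists>N. openin data N \<and> \<omega> \<in> N \<and>
      (\<forall>\<omega>'\<in>N. \<forall>t\<in>{0..T}. norm (minor_step m y \<omega>' (X \<omega>') t - minor_step m y \<omega> (X \<omega>) t) < e)"
    by blast
qed

end

section \<open>The coupled system for a general law functional\<close>

lemma norm_le_approx:
  fixes a a' :: "'a::real_normed_vector"
  assumes "norm (a' - a) \<le> r" "norm a' \<le> B"
  shows "norm a \<le> B + r"
  using assms by norm

lemma norm_diff_le_approx:
  fixes a a' b b' :: "'a::real_normed_vector"
  assumes "norm (a' - a) \<le> r" "norm (b' - b) \<le> s" "norm (a' - b') \<le> B"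
  shows "norm (a - b) \<le> B + (r + s)"
  using assms by norm

text \<open>What the argument needs to know about the laws, with a single constant
  \<open>\<rho>\<close>. The moment bound is asked for \<open>D \<ge> 1\<close> only, because the
  moments of a constant functional do not shrink with \<open>D\<close>.\<close>

locale law_functional = mean_field T p A f fI fII g y0 \<zeta>
  for T p A :: real
    and f :: "real \<Rightarrow> 'a::euclidean_space \<Rightarrow> 'a measure \<Rightarrow> 'b::euclidean_space
              \<Rightarrow> 'u::metric_space \<Rightarrow> 'v::metric_space \<Rightarrow> 'a"
    and fI fII g y0 \<zeta> +
  fixes \<Psi> :: "('a \<times> (real \<times> 'u) measure \<Rightarrow> real \<Rightarrow> 'a) \<Rightarrow> real \<Rightarrow> 'a measure" and \<rho> :: real
  assumes \<rho>: "\<rho> \<ge> 0"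
    and law_continuous: "\<And>b l X. process b l X \<Longrightarrow>
      continuous_map (top_of_set {0..T}) (W_topology p euclidean_metric) (\<Psi> X)"
    and law_moment: "\<And>b l X t D. process b l X \<Longrightarrow> t \<in> {0..T} \<Longrightarrow> D \<ge> 1 \<Longrightarrow>
      (\<And>\<omega>. \<omega> \<in> topspace data \<Longrightarrow> norm (X \<omega> t) \<le> D * weight \<omega>) \<Longrightarrow> moment p (\<Psi> X t) \<le> \<rho> * D"
    and law_dist: "\<And>b l X b' l' X' t D. process b l X \<Longrightarrow> process b' l' X' \<Longrightarrow> t \<in> {0..T} \<Longrightarrow> D \<ge> 0 \<Longrightarrow>
      (\<And>\<omega>. \<omega> \<in> topspace data \<Longrightarrow> norm (X \<omega> t - X' \<omega> t) \<le> D * weight \<omega>) \<Longrightarrow>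
      W (\<Psi> X t) (\<Psi> X' t) \<le> \<rho> * D"
begin

text \<open>Datum and time are paired so that a state consists of two functions of one index each,
  as \<open>near\<close> expects.\<close>

type_synonym ('x, 'y, 'w) state = "('w \<times> real \<Rightarrow> 'x) \<times> (real \<Rightarrow> 'y)"

text \<open>In \<open>2 + \<rho>\<close> one unit stands for the path, one for the major state, and
  \<open>\<rho>\<close> for the law. The factor 4 leaves 1/4 per integral, hence 1/2 for the two
  integrals of the minor dynamics; \<open>+ 1\<close> keeps the rate positive when
  \<open>L = 0\<close>.\<close>

definition contraction_rate :: "real \<Rightarrow> real" where
  "contraction_rate L = 4 * L * (2 + \<rho>) + 1"

lemma minor_contraction:
  assumes X: "process b l X" "process b' l' X'" and m: "curve c (\<Psi> X)" "curve c (\<Psi> X')"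
    and y: "bounded_path T c y" "bounded_path T c y'" and L: "lip c L"
    and D: "D \<ge> 0" and K: "K = contraction_rate L" and t: "t \<in> {0..T}"
    and near_X: "\<And>\<omega> \<tau>. \<omega> \<in> topspace data \<Longrightarrow> \<tau> \<in> {0..T} \<Longrightarrow>
      norm (X \<omega> \<tau> - X' \<omega> \<tau>) \<le> D * (exp (K * \<tau>) * weight \<omega>)"
    and near_y: "\<And>\<tau>. \<tau> \<in> {0..T} \<Longrightarrow> norm (y \<tau> - y' \<tau>) \<le> D * exp (K * \<tau>)"
  shows "\<omega> \<in> topspace data \<Longrightarrow>
      norm (minor_step (\<Psi> X) y \<omega> (X \<omega>) t - minor_step (\<Psi> X') y' \<omega> (X' \<omega>) t)
        \<le> D / 2 * (exp (K * t) * weight \<omega>)"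
    and "norm (major_step (\<Psi> X) y t - major_step (\<Psi> X') y' t) \<le> D / 2 * exp (K * t)"
proof -
  have L0: "L \<ge> 0" using L by (simp add: lip_def)
  have K_pos: "K > 0" using L0 \<rho> by (simp add: K contraction_rate_def add_nonneg_pos)
  have rate: "L * (2 + \<rho>) / K \<le> 1 / 4"
    using L0 \<rho> K_pos by (simp add: K contraction_rate_def field_simps)
  have W: "W (\<Psi> X \<tau>) (\<Psi> X' \<tau>) \<le> \<rho> * (D * exp (K * \<tau>))" if "\<tau> \<in> {0..T}" for \<tau>
    using law_dist[OF X that] near_X D that by (simp add: mult.assoc)
  {
    assume \<omega>: "\<omega> \<in> topspace data"
    then have \<xi>: "snd \<omega> \<in> relaxed_controls T" by auto
    have "norm (minor_step (\<Psi> X) y \<omega> (X \<omega>) t - minor_step (\<Psi> X') y' \<omega> (X' \<omega>) t)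
        \<le> 2 * (L * (D * (2 + \<rho>) * weight \<omega>) / K * exp (K * t))"
    proof (rule minor_step_diff[OF m y L process_path[OF X(1) \<omega>] process_path[OF X(2) \<omega>] \<xi> t K_pos])
      fix \<tau> assume \<tau>: "\<tau> \<in> {0..T}"
      have "norm (X \<omega> \<tau> - X' \<omega> \<tau>) + W (\<Psi> X \<tau>) (\<Psi> X' \<tau>) + norm (y \<tau> - y' \<tau>)
          \<le> D * (exp (K * \<tau>) * weight \<omega>) + \<rho> * (D * exp (K * \<tau>)) * weight \<omega> + D * exp (K * \<tau>) * weight \<omega>"
      proof (intro add_mono near_X \<omega> \<tau>)
        \<comment> \<open>The bounds for law and major state carry no weight of their own; since
          \<open>weight \<omega> \<ge> 1\<close>, it may be attached to both.\<close>
        have "\<rho> * (D * exp (K * \<tau>)) * 1 \<le> \<rho> * (D * exp (K * \<tau>)) * weight \<omega>"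
          using \<rho> D by (intro mult_left_mono) auto
        then show "W (\<Psi> X \<tau>) (\<Psi> X' \<tau>) \<le> \<rho> * (D * exp (K * \<tau>)) * weight \<omega>"
          using W[OF \<tau>] by linarith
        have "D * exp (K * \<tau>) * 1 \<le> D * exp (K * \<tau>) * weight \<omega>"
          using D by (intro mult_left_mono) auto
        then show "norm (y \<tau> - y' \<tau>) \<le> D * exp (K * \<tau>) * weight \<omega>"
          using near_y[OF \<tau>] by linarith
      qed
      also have "\<dots> = D * (2 + \<rho>) * weight \<omega> * exp (K * \<tau>)"
        by (simp add: algebra_simps)
      finally show "norm (X \<omega> \<tau> - X' \<omega> \<tau>) + W (\<Psi> X \<tau>) (\<Psi> X' \<tau>) + norm (y \<tau> - y' \<tau>)
          \<le> D * (2 + \<rho>) * weight \<omega> * exp (K * \<tau>)" .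
    qed
    also have "\<dots> = 2 * (L * (2 + \<rho>) / K) * (D * (exp (K * t) * weight \<omega>))"
      by simp
    also have "\<dots> \<le> 2 * (1 / 4) * (D * (exp (K * t) * weight \<omega>))"
      using rate D by (intro mult_right_mono mult_left_mono) auto
    finally show "norm (minor_step (\<Psi> X) y \<omega> (X \<omega>) t - minor_step (\<Psi> X') y' \<omega> (X' \<omega>) t)
        \<le> D / 2 * (exp (K * t) * weight \<omega>)"
      by simp
  }
  have "norm (major_step (\<Psi> X) y t - major_step (\<Psi> X') y' t) \<le> L * (D * (2 + \<rho>)) / K * exp (K * t)"
  proof (rule major_step_diff[OF m y L t K_pos])
    fix \<tau> assume \<tau>: "\<tau> \<in> {0..T}"
    have "0 \<le> D * exp (K * \<tau>)" using D by simp
    then show "W (\<Psi> X \<tau>) (\<Psi> X' \<tau>) + norm (y \<tau> - y' \<tau>) \<le> D * (2 + \<rho>) * exp (K * \<tau>)"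
      using W[OF \<tau>] near_y[OF \<tau>] by (simp add: algebra_simps)
  qed
  also have "\<dots> = (L * (2 + \<rho>) / K) * (D * exp (K * t))"
    by simp
  also have "\<dots> \<le> (1 / 4) * (D * exp (K * t))"
    using rate D by (intro mult_right_mono) auto
  also have "\<dots> \<le> D / 2 * exp (K * t)"
    using D by simp
  finally show "norm (major_step (\<Psi> X) y t - major_step (\<Psi> X') y' t) \<le> D / 2 * exp (K * t)" .
qed

text \<open>The bound inside \<open>process\<close> is the value of the exponential bound at time
  \<open>T\<close>; the time-dependent bounds are the ones that linear growth reproduces.\<close>

definition invariant_set :: "real \<Rightarrow> real \<Rightarrow> real \<Rightarrow> ('a, 'b, 'a \<times> (real \<times> 'u) measure) state set" where
  "invariant_set C K l = {z. process (C * exp (K * T)) l (curry (fst z)) \<and>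
    (\<forall>\<omega>\<in>topspace data. \<forall>t\<in>{0..T}. norm (fst z (\<omega>, t)) \<le> C * exp (K * t) * weight \<omega>) \<and>
    (\<forall>t\<in>{0..T}. norm (snd z t) \<le> C * exp (K * t)) \<and>
    (\<forall>s\<in>{0..T}. \<forall>t\<in>{0..T}. norm (snd z t - snd z s) \<le> l * \<bar>t - s\<bar>)}"

text \<open>The value \<open>undefined\<close> outside makes the components of a fixed point
  extensional on \<open>{0..T}\<close>, as membership in the path space demands.\<close>

definition system_step ::
  "('a, 'b, 'a \<times> (real \<times> 'u) measure) state \<Rightarrow> ('a, 'b, 'a \<times> (real \<times> 'u) measure) state" where
  "system_step z =
    ((\<lambda>(\<omega>, t). if \<omega> \<in> topspace data \<and> t \<in> {0..T}
        then minor_step (\<Psi> (curry (fst z))) (snd z) \<omega> (curry (fst z) \<omega>) t else undefined),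
     (\<lambda>t. if t \<in> {0..T} then major_step (\<Psi> (curry (fst z))) (snd z) t else undefined))"

abbreviation near_weighted where
  "near_weighted K \<equiv> near (\<lambda>(\<omega>, t). exp (K * t) * weight \<omega>) (\<lambda>t. exp (K * t))"

text \<open>Bounds on norms pass to the limit, and continuity in the data passes by a three-term
  estimate. \<open>K'\<close> is the rate of the contracting norm and is independent of the rate
  \<open>K\<close> of the growth bounds.\<close>

lemma invariant_set_closed:
  fixes z :: "('a, 'b, 'a \<times> (real \<times> 'u) measure) state"
  assumes K': "K' \<ge> 0" and approx: "\<And>e. e > 0 \<Longrightarrow> \<exists>z'\<in>invariant_set C K l. near_weighted K' e z' z"
  shows "z \<in> invariant_set C K l"
proof -
  have X_approx: "\<exists>z'\<in>invariant_set C K l.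
      (\<forall>\<omega> t. norm (fst z' (\<omega>, t) - fst z (\<omega>, t)) \<le> e * (exp (K' * t) * weight \<omega>)) \<and>
      (\<forall>t. norm (snd z' t - snd z t) \<le> e * exp (K' * t))" if "e > 0" for e
    using approx[OF that] by (simp add: near_def)
  have "continuous_in_data (curry (fst z))"
    unfolding continuous_in_data_def
  proof (intro ballI allI impI)
    fix \<omega> e assume \<omega>: "\<omega> \<in> topspace data" and e: "(e :: real) > 0"
    \<comment> \<open>Nearness is uniform only relative to the weight. On the unit ball around the
      initial point of \<omega> the weight is at most \<open>1 + weight \<omega>\<close>, so
      \<open>k\<close> bounds the whole factor there.\<close>
    define k where "k = exp (K' * T) * (1 + weight \<omega>)"
    have k: "k > 0" by (simp add: k_def add_pos_nonneg)
    define \<delta> where "\<delta> = e / (3 * k)"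
    have \<delta>: "\<delta> > 0" "\<delta> * k = e / 3" using e k by (simp_all add: \<delta>_def)
    obtain z' where z': "z' \<in> invariant_set C K l"
      "\<And>\<omega> t. norm (fst z' (\<omega>, t) - fst z (\<omega>, t)) \<le> \<delta> * (exp (K' * t) * weight \<omega>)"
      using X_approx[OF \<delta>(1)] by blast
    have "continuous_in_data (curry (fst z'))"
      using z'(1) by (simp add: invariant_set_def process_def)
    moreover have "e / 3 > 0" using e by simp
    ultimately obtain N1 where N1: "openin data N1" "\<omega> \<in> N1"
      "\<And>\<omega>' t. \<omega>' \<in> N1 \<Longrightarrow> t \<in> {0..T} \<Longrightarrow> norm (curry (fst z') \<omega>' t - curry (fst z') \<omega> t) < e / 3"
      using \<omega> unfolding continuous_in_data_def by meson
    define N where "N = N1 \<inter> (ball (fst \<omega>) 1 \<times> topspace (relaxed_topology T))"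
    have "openin data (ball (fst \<omega>) 1 \<times> topspace (relaxed_topology T :: (real \<times> 'u) measure topology))"
      unfolding openin_prod_Times_iff by (intro disjI2 conjI openin_topspace) simp
    then have "openin data N"
      unfolding N_def by (rule openin_Int[OF N1(1)])
    moreover have "\<omega> \<in> N"
      using N1(2) \<omega> by (cases \<omega>) (simp add: N_def)
    moreover have "norm (curry (fst z) \<omega>' t - curry (fst z) \<omega> t) < e"
      if \<omega>': "\<omega>' \<in> N" and t: "t \<in> {0..T}" for \<omega>' t
    proof -
      have le: "norm (fst z' (\<omega>'', t) - fst z (\<omega>'', t)) \<le> e / 3" if "norm (fst \<omega>'' - fst \<omega>) \<le> 1" for \<omega>''
      proof -
        have "norm (fst \<omega>'') \<le> norm (fst \<omega>) + 1"
          using norm_triangle_sub[of "fst \<omega>''" "fst \<omega>"] that by linarith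
        then have "exp (K' * t) * weight \<omega>'' \<le> k"
          unfolding k_def using t K' by (intro mult_mono) (auto simp: mult_left_mono)
        then have "\<delta> * (exp (K' * t) * weight \<omega>'') \<le> \<delta> * k"
          using \<delta>(1) by (intro mult_left_mono) auto
        then show ?thesis
          using z'(2)[of \<omega>'' t] \<delta>(2) by linarith
      qed
      have "norm (fst \<omega>' - fst \<omega>) \<le> 1"
        using \<omega>' by (auto simp: N_def dist_norm norm_minus_commute)
      then have 1: "norm (fst z' (\<omega>', t) - fst z (\<omega>', t)) \<le> e / 3"
        and 2: "norm (fst z' (\<omega>, t) - fst z (\<omega>, t)) \<le> e / 3"
        using le by auto
      have 3: "norm (fst z' (\<omega>', t) - fst z' (\<omega>, t)) < e / 3"
        using N1(3)[of \<omega>' t] \<omega>' t by (simp add: N_def)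
      show ?thesis
        using 1 2 3 unfolding curry_def by norm
    qed
    ultimately show "\<exists>N. openin data N \<and> \<omega> \<in> N \<and>
        (\<forall>\<omega>'\<in>N. \<forall>t\<in>{0..T}. norm (curry (fst z) \<omega>' t - curry (fst z) \<omega> t) < e)"
      by blast
  qed
  \<comment> \<open>With an arbitrary \<open>B\<close>, one passage to the limit serves both the
    bound of the process and the exponential bound.\<close>
  moreover have "norm (fst z (\<omega>, t)) \<le> B" if B: "\<And>z'. z' \<in> invariant_set C K l \<Longrightarrow> norm (fst z' (\<omega>, t)) \<le> B" for \<omega> t B
  proof (rule le_of_le_add_small[where k = "exp (K' * t) * weight \<omega>"])
    fix e :: real assume "e > 0"
    then obtain z' where "z' \<in> invariant_set C K l"
      "norm (fst z' (\<omega>, t) - fst z (\<omega>, t)) \<le> e * (exp (K' * t) * weight \<omega>)"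
      using X_approx by blast
    then show "norm (fst z (\<omega>, t)) \<le> B + e * (exp (K' * t) * weight \<omega>)"
      using norm_le_approx B by blast
  qed simp
  moreover have "norm (fst z (\<omega>, t) - fst z (\<omega>, s)) \<le> B"
    if B: "\<And>z'. z' \<in> invariant_set C K l \<Longrightarrow> norm (fst z' (\<omega>, t) - fst z' (\<omega>, s)) \<le> B" for \<omega> s t B
  proof (rule le_of_le_add_small[where k = "exp (K' * t) * weight \<omega> + exp (K' * s) * weight \<omega>"])
    fix e :: real assume "e > 0"
    then obtain z' where "z' \<in> invariant_set C K l"
      "norm (fst z' (\<omega>, t) - fst z (\<omega>, t)) \<le> e * (exp (K' * t) * weight \<omega>)"
      "norm (fst z' (\<omega>, s) - fst z (\<omega>, s)) \<le> e * (exp (K' * s) * weight \<omega>)"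
      using X_approx by blast
    then show "norm (fst z (\<omega>, t) - fst z (\<omega>, s)) \<le> B + e * (exp (K' * t) * weight \<omega> + exp (K' * s) * weight \<omega>)"
      unfolding distrib_left[of e] using norm_diff_le_approx B by blast
  qed simp
  moreover have "norm (snd z t) \<le> B" if B: "\<And>z'. z' \<in> invariant_set C K l \<Longrightarrow> norm (snd z' t) \<le> B" for t B
  proof (rule le_of_le_add_small[where k = "exp (K' * t)"])
    fix e :: real assume "e > 0"
    then obtain z' where "z' \<in> invariant_set C K l" "norm (snd z' t - snd z t) \<le> e * exp (K' * t)"
      using X_approx by blast
    then show "norm (snd z t) \<le> B + e * exp (K' * t)"
      using norm_le_approx B by blast
  qed simp
  moreover have "norm (snd z t - snd z s) \<le> B"
    if B: "\<And>z'. z' \<in> invariant_set C K l \<Longrightarrow> norm (snd z' t - snd z' s) \<le> B" for s t B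
  proof (rule le_of_le_add_small[where k = "exp (K' * t) + exp (K' * s)"])
    fix e :: real assume "e > 0"
    then obtain z' where "z' \<in> invariant_set C K l"
      "norm (snd z' t - snd z t) \<le> e * exp (K' * t)" "norm (snd z' s - snd z s) \<le> e * exp (K' * s)"
      using X_approx by blast
    then show "norm (snd z t - snd z s) \<le> B + e * (exp (K' * t) + exp (K' * s))"
      unfolding distrib_left[of e] using norm_diff_le_approx B by blast
  qed simp
  ultimately show ?thesis
    by (auto simp: invariant_set_def process_def curry_def)
qed

lemma continuous_in_data_cong:
  assumes "\<And>\<omega> t. \<omega> \<in> topspace data \<Longrightarrow> t \<in> {0..T} \<Longrightarrow> X \<omega> t = X' \<omega> t" "continuous_in_data X"
  shows "continuous_in_data X'"
  unfolding continuous_in_data_def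
proof (intro ballI allI impI)
  fix \<omega> e assume \<omega>: "\<omega> \<in> topspace data" and "(e :: real) > 0"
  then obtain N where N: "openin data N" "\<omega> \<in> N"
    "\<And>\<omega>' t. \<omega>' \<in> N \<Longrightarrow> t \<in> {0..T} \<Longrightarrow> norm (X \<omega>' t - X \<omega> t) < e"
    using assms(2) unfolding continuous_in_data_def by meson
  then show "\<exists>N. openin data N \<and> \<omega> \<in> N \<and> (\<forall>\<omega>'\<in>N. \<forall>t\<in>{0..T}. norm (X' \<omega>' t - X' \<omega> t) < e)"
    using assms(1)[OF \<omega>] assms(1)[OF subsetD[OF openin_subset[OF N(1)]]]
    by (intro exI[of _ N]) simp
qed

text \<open>Write C for \<open>growth_const\<close> and K for \<open>growth_rate\<close>. Path, law
  and major state account for C (2 + \<rho>), the constant 1 of the growth condition for at most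
  another C, so each integral returns at most A C (3 + \<rho>) / K = C / 4 times the exponential.
  The two integrals of a minor agent use half of the available C; the other half covers the initial
  point because C is at least 2, and C / 2 also exceeds the norm of \<open>y0\<close>.
  \<open>state_bound\<close> dominates the moments, which are at most \<rho> times
  \<open>path_bound\<close>, as well as the major state. \<open>path_lipschitz\<close> is the
  resulting bound on the speed.\<close>

definition growth_const :: real where "growth_const = 2 + 2 * norm y0"
definition growth_rate :: real where "growth_rate = 4 * A * (3 + \<rho>)"
definition path_bound :: real where "path_bound = growth_const * exp (growth_rate * T)"
definition state_bound :: real where "state_bound = (1 + \<rho>) * path_bound"
definition path_lipschitz :: real where
  "path_lipschitz = 2 * A * (1 + path_bound + 2 * state_bound)"

abbreviation invariant :: "('a, 'b, 'a \<times> (real \<times> 'u) measure) state set" where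
  "invariant \<equiv> invariant_set growth_const growth_rate path_lipschitz"

lemma growth_consts:
  "growth_const \<ge> 2" "growth_rate > 0" "path_bound > 0" "state_bound \<ge> path_bound" "path_lipschitz \<ge> 0"
proof -
  show C: "growth_const \<ge> 2" by (simp add: growth_const_def)
  show K: "growth_rate > 0" using A_pos \<rho> by (simp add: growth_rate_def)
  show B: "path_bound > 0" using C by (simp add: path_bound_def)
  show c: "state_bound \<ge> path_bound" using B \<rho> by (simp add: state_bound_def distrib_right)
  show "path_lipschitz \<ge> 0" using A_pos B c by (simp add: path_lipschitz_def)
qed

lemma exp_le_path_bound: "t \<in> {0..T} \<Longrightarrow> growth_const * exp (growth_rate * t) \<le> path_bound"
  using growth_consts(1,2) by (simp add: path_bound_def)

lemma one_le_exp_growth: "t \<in> {0..T} \<Longrightarrow> growth_const * exp (growth_rate * t) \<ge> 2"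
proof -
  assume t: "t \<in> {0..T}"
  have "2 * 1 \<le> growth_const * exp (growth_rate * t)"
    using growth_consts(1,2) t by (intro mult_mono) auto
  then show ?thesis by simp
qed

lemma invariantD:
  assumes z: "z \<in> invariant"
  shows "process path_bound path_lipschitz (curry (fst z))"
    and "curve state_bound (\<Psi> (curry (fst z)))"
    and "bounded_path T state_bound (snd z)"
    and "\<And>t. t \<in> {0..T} \<Longrightarrow> moment p (\<Psi> (curry (fst z)) t) \<le> \<rho> * (growth_const * exp (growth_rate * t))"
proof -
  show X: "process path_bound path_lipschitz (curry (fst z))"
    using z by (simp add: invariant_set_def path_bound_def)
  show mom: "moment p (\<Psi> (curry (fst z)) t) \<le> \<rho> * (growth_const * exp (growth_rate * t))"
    if t: "t \<in> {0..T}" for t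
    using one_le_exp_growth[OF t] z t by (intro law_moment[OF X t]) (auto simp: invariant_set_def)
  have "\<rho> * (growth_const * exp (growth_rate * t)) \<le> state_bound" if "t \<in> {0..T}" for t
    using mult_left_mono[OF exp_le_path_bound[OF that] \<rho>] growth_consts(3)
    unfolding state_bound_def distrib_right by linarith
  then show "curve state_bound (\<Psi> (curry (fst z)))"
    using law_continuous[OF X] mom order_trans unfolding curve_def by blast
  have "norm (snd z t) \<le> state_bound" if t: "t \<in> {0..T}" for t
  proof -
    have "norm (snd z t) \<le> growth_const * exp (growth_rate * t)"
      using z t by (auto simp: invariant_set_def)
    then show ?thesis
      using exp_le_path_bound[OF t] growth_consts(4) by linarith
  qed
  then show "bounded_path T state_bound (snd z)"
    by (rule bounded_pathI_lipschitz[where l = path_lipschitz]) (use z in \<open>auto simp: invariant_set_def\<close>)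
qed

lemma system_step_invariant:
  assumes z: "z \<in> invariant"
  shows "system_step z \<in> invariant"
proof -
  define X where "X = curry (fst z)"
  define E where "E t = growth_const * exp (growth_rate * t)" for t
  note X = invariantD(1)[OF z, folded X_def]
  note m = invariantD(2)[OF z, folded X_def]
  note y = invariantD(3)[OF z]
  note mom = invariantD(4)[OF z, folded X_def E_def]
  have E2: "E t \<ge> 2" if "t \<in> {0..T}" for t
    using one_le_exp_growth[OF that] by (simp add: E_def)
  have X_le: "norm (X \<omega> t) \<le> E t * weight \<omega>" if "\<omega> \<in> topspace data" "t \<in> {0..T}" for \<omega> t
    using z that by (auto simp: invariant_set_def X_def E_def)
  have y_le: "norm (snd z t) \<le> E t" if "t \<in> {0..T}" for t
    using z that by (auto simp: invariant_set_def E_def)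
  \<comment> \<open>Each integral takes a quarter of the growth constant, which is how
    \<open>growth_rate\<close> was chosen.\<close>
  have rate: "A * (growth_const * (3 + \<rho>)) / growth_rate = growth_const / 4"
  proof -
    have "A \<noteq> 0" "3 + \<rho> \<noteq> 0" using A_pos \<rho> by auto
    then show ?thesis by (simp add: growth_rate_def divide_simps)
  qed
  have minor_eq: "curry (fst (system_step z)) \<omega> t = minor_step (\<Psi> X) (snd z) \<omega> (X \<omega>) t"
    if "\<omega> \<in> topspace data" "t \<in> {0..T}" for \<omega> t
    using that by (simp add: system_step_def X_def)
  have major_eq: "snd (system_step z) t = major_step (\<Psi> X) (snd z) t" if "t \<in> {0..T}" for t
    using that by (simp add: system_step_def X_def)
  have minor_le: "norm (minor_step (\<Psi> X) (snd z) \<omega> (X \<omega>) t) \<le> E t * weight \<omega>"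
    if \<omega>: "\<omega> \<in> topspace data" and t: "t \<in> {0..T}" for \<omega> t
  proof -
    have \<xi>: "snd \<omega> \<in> relaxed_controls T" using \<omega> by auto
    have w: "weight \<omega> \<ge> 1" by simp
    have "norm (minor_step (\<Psi> X) (snd z) \<omega> (X \<omega>) t)
        \<le> norm (fst \<omega>) + 2 * (A * (1 + growth_const * (2 + \<rho>) * weight \<omega>) / growth_rate * exp (growth_rate * t))"
    proof (rule minor_step_growth[OF m y process_path[OF X \<omega>] \<xi> t growth_consts(2)])
      fix \<tau> assume \<tau>: "\<tau> \<in> {0..T}"
      have "E \<tau> * 1 \<le> E \<tau> * weight \<omega>" "\<rho> * E \<tau> * 1 \<le> \<rho> * E \<tau> * weight \<omega>"
        using E2[OF \<tau>] \<rho> by (intro mult_left_mono; simp)+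
      then have "norm (X \<omega> \<tau>) + moment p (\<Psi> X \<tau>) + norm (snd z \<tau>)
          \<le> E \<tau> * weight \<omega> + \<rho> * E \<tau> * weight \<omega> + E \<tau> * weight \<omega>"
        using X_le[OF \<omega> \<tau>] mom[OF \<tau>] y_le[OF \<tau>] by linarith
      also have "\<dots> = growth_const * (2 + \<rho>) * weight \<omega> * exp (growth_rate * \<tau>)"
        by (simp add: E_def algebra_simps)
      finally show "norm (X \<omega> \<tau>) + moment p (\<Psi> X \<tau>) + norm (snd z \<tau>)
          \<le> growth_const * (2 + \<rho>) * weight \<omega> * exp (growth_rate * \<tau>)" .
    qed
    also have "\<dots> \<le> norm (fst \<omega>) + 2 * (A * (growth_const * (3 + \<rho>) * weight \<omega>) / growth_rate * exp (growth_rate * t))"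
    proof -
      have "1 * 1 \<le> growth_const * weight \<omega>"
        using growth_consts(1) by (intro mult_mono) auto
      then have "1 + growth_const * (2 + \<rho>) * weight \<omega> \<le> growth_const * (3 + \<rho>) * weight \<omega>"
        by (simp add: algebra_simps)
      then show ?thesis
        using A_pos growth_consts(2) by (intro add_left_mono mult_left_mono mult_right_mono divide_right_mono) auto
    qed
    also have "\<dots> = norm (fst \<omega>) + 2 * ((A * (growth_const * (3 + \<rho>)) / growth_rate) * (weight \<omega> * exp (growth_rate * t)))"
      by simp
    also have "\<dots> = norm (fst \<omega>) + E t * weight \<omega> / 2"
      unfolding rate by (simp add: E_def)
    also have "\<dots> \<le> E t * weight \<omega>"
    proof -
      have "2 * weight \<omega> \<le> E t * weight \<omega>"
        using E2[OF t] by (intro mult_right_mono) auto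
      then show ?thesis by simp
    qed
    finally show ?thesis .
  qed
  have major_le: "norm (major_step (\<Psi> X) (snd z) t) \<le> E t" if t: "t \<in> {0..T}" for t
  proof -
    have "norm (major_step (\<Psi> X) (snd z) t)
        \<le> norm y0 + A * (1 + growth_const * (2 + \<rho>)) / growth_rate * exp (growth_rate * t)"
    proof (rule major_step_growth[OF m y t growth_consts(2)])
      fix \<tau> assume \<tau>: "\<tau> \<in> {0..T}"
      \<comment> \<open>The major state is counted twice so that the constant
        \<open>2 + \<rho>\<close> of the minor agents serves here too.\<close>
      have "moment p (\<Psi> X \<tau>) + norm (snd z \<tau>) \<le> \<rho> * E \<tau> + 2 * E \<tau>"
        using mom[OF \<tau>] y_le[OF \<tau>] E2[OF \<tau>] by linarith
      then show "moment p (\<Psi> X \<tau>) + norm (snd z \<tau>) \<le> growth_const * (2 + \<rho>) * exp (growth_rate * \<tau>)"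
        by (simp add: E_def algebra_simps)
    qed
    also have "\<dots> \<le> norm y0 + A * (growth_const * (3 + \<rho>)) / growth_rate * exp (growth_rate * t)"
    proof -
      have "1 + growth_const * (2 + \<rho>) \<le> growth_const * (3 + \<rho>)"
        using growth_consts(1) by (simp add: algebra_simps)
      then show ?thesis
        using A_pos growth_consts(2) by (intro add_left_mono mult_left_mono mult_right_mono divide_right_mono) auto
    qed
    also have "\<dots> = norm y0 + E t / 4"
      unfolding rate by (simp add: E_def)
    also have "\<dots> \<le> E t"
    proof -
      have "growth_const * 1 \<le> E t"
        unfolding E_def using growth_consts(1,2) t by (intro mult_left_mono) auto
      then have "2 + 2 * norm y0 \<le> E t" by (simp add: growth_const_def)
      then show ?thesis using E2[OF t] by simp
    qed
    finally show ?thesis .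
  qed
  have "continuous_in_data (curry (fst (system_step z)))"
    by (rule continuous_in_data_cong[OF minor_eq[symmetric] minor_step_continuous_in_data[OF m y X]])
  moreover have "norm (minor_step (\<Psi> X) (snd z) \<omega> (X \<omega>) t - minor_step (\<Psi> X) (snd z) \<omega> (X \<omega>) s)
      \<le> path_lipschitz * weight \<omega> * \<bar>t - s\<bar>"
    if \<omega>: "\<omega> \<in> topspace data" and st: "s \<in> {0..T}" "t \<in> {0..T}" for \<omega> s t
  proof -
    have "snd \<omega> \<in> relaxed_controls T" using \<omega> by auto
    from minor_step_lipschitz[OF m y process_path[OF X \<omega>] this st]
    have "norm (minor_step (\<Psi> X) (snd z) \<omega> (X \<omega>) t - minor_step (\<Psi> X) (snd z) \<omega> (X \<omega>) s)
      \<le> 2 * A * (1 + path_bound * weight \<omega> + 2 * state_bound) * \<bar>t - s\<bar>" .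
    also have "\<dots> \<le> 2 * A * (weight \<omega> + path_bound * weight \<omega> + 2 * state_bound * weight \<omega>) * \<bar>t - s\<bar>"
    proof -
      \<comment> \<open>The bound on moments and major state does not scale with the datum;
        multiplying by \<open>weight \<omega> \<ge> 1\<close> gives the form that
        \<open>process\<close> asks for.\<close>
      have "state_bound * 1 \<le> state_bound * weight \<omega>"
        using growth_consts(3,4) by (intro mult_left_mono) auto
      then show ?thesis
        using A_pos by (intro mult_right_mono mult_left_mono add_mono) auto
    qed
    also have "\<dots> = path_lipschitz * weight \<omega> * \<bar>t - s\<bar>"
      by (simp add: path_lipschitz_def algebra_simps)
    finally show ?thesis .
  qed
  moreover have "norm (minor_step (\<Psi> X) (snd z) \<omega> (X \<omega>) t) \<le> path_bound * weight \<omega>"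
    if \<omega>: "\<omega> \<in> topspace data" and t: "t \<in> {0..T}" for \<omega> t
  proof -
    have "E t * weight \<omega> \<le> path_bound * weight \<omega>"
      using exp_le_path_bound[OF t] by (intro mult_right_mono) (auto simp: E_def)
    then show ?thesis using minor_le[OF \<omega> t] by linarith
  qed
  ultimately have "process path_bound path_lipschitz (curry (fst (system_step z)))"
    unfolding process_def using minor_eq by presburger
  moreover have "norm (major_step (\<Psi> X) (snd z) t - major_step (\<Psi> X) (snd z) s) \<le> path_lipschitz * \<bar>t - s\<bar>"
    if st: "s \<in> {0..T}" "t \<in> {0..T}" for s t
  proof -
    have "A * (1 + 2 * state_bound) \<le> A * (2 * (1 + path_bound + 2 * state_bound))"
      using A_pos growth_consts(3,4) by (intro mult_left_mono) auto
    also have "\<dots> = path_lipschitz"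
      by (simp add: path_lipschitz_def)
    finally have "A * (1 + 2 * state_bound) * \<bar>t - s\<bar> \<le> path_lipschitz * \<bar>t - s\<bar>"
      by (intro mult_right_mono) auto
    then show ?thesis
      using major_step_lipschitz[OF m y st] by linarith
  qed
  moreover have "norm (fst (system_step z) (\<omega>, t)) \<le> E t * weight \<omega>"
    if "\<omega> \<in> topspace data" "t \<in> {0..T}" for \<omega> t
    using minor_le[OF that] minor_eq[OF that] by (simp add: curry_def)
  ultimately show ?thesis
    unfolding invariant_set_def path_bound_def[symmetric]
    using major_le major_eq by (simp add: E_def[symmetric] del: topspace_prod_topology)
qed

lemma system_step_contraction:
  assumes z: "z \<in> invariant" "z' \<in> invariant" and D: "D \<ge> 0" and L: "lip state_bound L"
    and near: "near_weighted (contraction_rate L) D z z'"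
  shows "near_weighted (contraction_rate L) (D / 2) (system_step z) (system_step z')"
proof -
  define X X' where "X = curry (fst z)" and "X' = curry (fst z')"
  note X = invariantD(1)[OF z(1), folded X_def] invariantD(1)[OF z(2), folded X'_def]
  note m = invariantD(2)[OF z(1), folded X_def] invariantD(2)[OF z(2), folded X'_def]
  note y = invariantD(3)[OF z(1)] invariantD(3)[OF z(2)]
  have near': "norm (X \<omega> t - X' \<omega> t) \<le> D * (exp (contraction_rate L * t) * weight \<omega>)"
    "norm (snd z t - snd z' t) \<le> D * exp (contraction_rate L * t)" for \<omega> t
    using near by (cases \<omega>; simp add: near_def X_def X'_def)+
  show ?thesis
    using minor_contraction[OF X m y L D refl _ near'] D
    unfolding near_def system_step_def X_def[symmetric] X'_def[symmetric]
    by (auto simp del: topspace_prod_topology)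
qed

text \<open>A fixed point of \<open>system_step\<close> solves the integral equations: in the
  bounded class they are equivalent to the fixed point equations, and \<open>undefined\<close>
  outside supplies extensionality.\<close>

lemma system_solvable:
  obtains b l c X y where "process b l X" "curve c (\<Psi> X)" "bounded_path T c y"
    "solves_major T g (\<Psi> X) y0 \<zeta> y"
    "\<And>x0 \<xi>. \<xi> \<in> relaxed_controls T \<Longrightarrow> solves_minor T fI fII (\<Psi> X) y x0 \<xi> \<zeta> (X (x0, \<xi>))"
proof -
  obtain L where L: "lip state_bound L" by (rule ex_lip)
  define K where "K = contraction_rate L"
  have K: "K \<ge> 0" using L \<rho> by (simp add: K_def contraction_rate_def lip_def)
  \<comment> \<open>The iteration starts from the image of the zero state. \<open>near\<close>
    compares at all indices, and off the data and the time interval two images are both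
    \<open>undefined\<close>, hence equal; the zero state itself need not be near its image
    there.\<close>
  define z0 :: "('a, 'b, 'a \<times> (real \<times> 'u) measure) state" where "z0 = system_step (\<lambda>_. 0, \<lambda>_. 0)"
  have "(\<lambda>_. 0, \<lambda>_. 0) \<in> invariant"
    using growth_consts openin_topspace[of data]
    by (auto simp: invariant_set_def process_def continuous_in_data_def path_bound_def[symmetric] curry_def
        simp del: topspace_prod_topology)
  then have z0: "z0 \<in> invariant"
    unfolding z0_def by (rule system_step_invariant)
  have start: "near_weighted K (2 * path_bound) z0 (system_step z0)"
  proof -
    have exp1: "1 \<le> exp (K * t)" if "t \<in> {0..T}" for t using K that by simp
    have 1: "norm (fst z (\<omega>, t)) \<le> path_bound * (exp (K * t) * weight \<omega>)"
      if "z \<in> invariant" "\<omega> \<in> topspace data" "t \<in> {0..T}" for z \<omega> t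
    proof -
      have "norm (fst z (\<omega>, t)) \<le> path_bound * (1 * weight \<omega>)"
        using invariantD(1)[OF that(1)] that(2,3) unfolding process_def curry_def mult_1 by blast
      also have "\<dots> \<le> path_bound * (exp (K * t) * weight \<omega>)"
        using growth_consts(3) exp1[OF that(3)] by (intro mult_left_mono mult_right_mono) auto
      finally show ?thesis .
    qed
    have 2: "norm (snd z t) \<le> path_bound * exp (K * t)" if "z \<in> invariant" "t \<in> {0..T}" for z t
    proof -
      have "norm (snd z t) \<le> growth_const * exp (growth_rate * t)"
        using that by (auto simp: invariant_set_def)
      also have "\<dots> \<le> path_bound * 1"
        using exp_le_path_bound[OF that(2)] by simp
      also have "\<dots> \<le> path_bound * exp (K * t)"
        using growth_consts(3) exp1[OF that(2)] by (intro mult_left_mono) auto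
      finally show ?thesis .
    qed
    have "norm (fst z0 (\<omega>, t) - fst (system_step z0) (\<omega>, t)) \<le> 2 * path_bound * (exp (K * t) * weight \<omega>)" for \<omega> t
    proof (cases "\<omega> \<in> topspace data \<and> t \<in> {0..T}")
      case True
      then show ?thesis
        using 1[OF z0, of \<omega> t] 1[OF system_step_invariant[OF z0], of \<omega> t]
          norm_triangle_ineq4[of "fst z0 (\<omega>, t)" "fst (system_step z0) (\<omega>, t)"] by linarith
    next
      case False
      then have "fst z0 (\<omega>, t) = undefined" "fst (system_step z0) (\<omega>, t) = undefined"
        by (auto simp: z0_def system_step_def simp del: topspace_prod_topology)
      then show ?thesis using growth_consts(3) by simp
    qed
    moreover have "norm (snd z0 t - snd (system_step z0) t) \<le> 2 * path_bound * exp (K * t)" for t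
    proof (cases "t \<in> {0..T}")
      case True
      then show ?thesis
        using 2[OF z0, of t] 2[OF system_step_invariant[OF z0], of t]
          norm_triangle_ineq4[of "snd z0 t" "snd (system_step z0) t"] by linarith
    next
      case False
      then have "snd z0 t = undefined" "snd (system_step z0) t = undefined"
        by (auto simp: z0_def system_step_def)
      then show ?thesis using growth_consts(3) by simp
    qed
    ultimately show ?thesis by (simp add: near_def)
  qed
  have "\<exists>z\<in>invariant. system_step z = z"
  proof (rule weighted_fixpoint[where \<Phi> = system_step and M = invariant and u = "\<lambda>(\<omega>, t). exp (K * t) * weight \<omega>" and v = "\<lambda>t. exp (K * t)",
      OF z0 start])
    show "near_weighted K (D / 2) (system_step z) (system_step z')"
      if "z \<in> invariant" "z' \<in> invariant" "D \<ge> 0" "near_weighted K D z z'" for z z' D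
      using system_step_contraction[OF that(1,2,3) L] that(4) by (simp add: K_def)
    show "z \<in> invariant" if "\<And>e. e > 0 \<Longrightarrow> \<exists>z'\<in>invariant. near_weighted K e z' z" for z
      by (rule invariant_set_closed[OF K that])
  qed (use growth_consts(3) system_step_invariant in auto)
  then obtain z where z: "z \<in> invariant" "system_step z = z" by blast
  define X where "X = curry (fst z)"
  note X = invariantD(1)[OF z(1), folded X_def]
  note m = invariantD(2)[OF z(1), folded X_def]
  note y = invariantD(3)[OF z(1)]
  have z_eq: "fst z (\<omega>, t) = X \<omega> t" for \<omega> t
    by (simp add: X_def)
  have X_eq: "X \<omega> t = (if \<omega> \<in> topspace data \<and> t \<in> {0..T} then minor_step (\<Psi> X) (snd z) \<omega> (X \<omega>) t else undefined)" for \<omega> t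
    using arg_cong[OF z(2), of "\<lambda>z. fst z (\<omega>, t)"] unfolding system_step_def X_def[symmetric]
    by (simp add: z_eq del: topspace_prod_topology)
  have y_eq: "snd z t = (if t \<in> {0..T} then major_step (\<Psi> X) (snd z) t else undefined)" for t
    using arg_cong[OF z(2), of "\<lambda>z. snd z t"] unfolding system_step_def X_def[symmetric] by simp
  show thesis
  proof (rule that[OF X m y])
    show "solves_major T g (\<Psi> X) y0 \<zeta> (snd z)"
      unfolding solves_major_iff[OF m y] extensional_def using y_eq by auto
    fix x0 :: 'a and \<xi> :: "(real \<times> 'u) measure" assume \<xi>: "\<xi> \<in> relaxed_controls T"
    then have \<omega>: "(x0, \<xi>) \<in> topspace data" by simp
    show "solves_minor T fI fII (\<Psi> X) (snd z) x0 \<xi> \<zeta> (X (x0, \<xi>))"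
      unfolding solves_minor_iff[OF m y process_path[OF X \<omega>] \<xi>] extensional_def
      using X_eq[of "(x0, \<xi>)"] \<omega> by auto
  qed
qed

end

section \<open>Laws on path space and uniqueness of trajectories\<close>

lemma halving_iterate:
  fixes D :: real
  assumes "Q D" "D \<ge> 0" "\<And>D. D \<ge> 0 \<Longrightarrow> Q D \<Longrightarrow> Q (D / 2)"
  shows "Q (D / 2 ^ n)"
proof (induction n)
  case (Suc n)
  then show ?case using assms(3)[of "D / 2 ^ n"] assms(2) by (simp add: field_simps)
qed (use assms in simp)

section \<open>Continuity and measurability on path space, and curves of one-time laws\<close>

lemma continuous_map_mtopology_ofI:
  assumes "\<And>x. x \<in> topspace X \<Longrightarrow> f x \<in> mspace m"
    and "\<And>x e. x \<in> topspace X \<Longrightarrow> e > 0 \<Longrightarrow>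
      \<exists>N. openin X N \<and> x \<in> N \<and> (\<forall>y\<in>N. mdist m (f x) (f y) < e)"
  shows "continuous_map X (mtopology_of m) f"
  unfolding mtopology_of_def Metric_space.continuous_map_to_metric[OF Metric_space_mspace_mdist]
proof (intro ballI allI impI)
  fix x e assume x: "x \<in> topspace X" and "(e :: real) > 0"
  then obtain N where N: "openin X N" "x \<in> N" "\<forall>y\<in>N. mdist m (f x) (f y) < e"
    using assms(2) by blast
  have "f y \<in> mspace m" if "y \<in> N" for y
    using assms(1) openin_subset[OF N(1)] that by blast
  then show "\<exists>U. openin X U \<and> x \<in> U \<and> (\<forall>y\<in>U. f y \<in> Metric_space.mball (mspace m) (mdist m) (f x) e)"
    using N assms(1)[OF x] by (intro exI[of _ N]) (auto simp: Metric_space.in_mball[OF Metric_space_mspace_mdist])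
qed

lemma nonexpansive_imp_continuous_map:
  fixes f :: "'a \<Rightarrow> 'b::metric_space"
  assumes "\<And>x y. x \<in> mspace m \<Longrightarrow> y \<in> mspace m \<Longrightarrow> dist (f x) (f y) \<le> mdist m x y"
  shows "continuous_map (mtopology_of m) euclidean f"
proof -
  have "Lipschitz_continuous_map m euclidean_metric f"
    unfolding Lipschitz_continuous_map_def using assms by (auto intro!: exI[of _ 1])
  from Lipschitz_continuous_imp_continuous_map[OF this] show ?thesis by simp
qed

lemma continuous_map_mdist_point:
  assumes "a \<in> mspace m"
  shows "continuous_map (mtopology_of m) euclidean (\<lambda>x. mdist m x a)"
proof (rule nonexpansive_imp_continuous_map)
  fix x y assume "x \<in> mspace m" "y \<in> mspace m"
  then show "dist (mdist m x a) (mdist m y a) \<le> mdist m x y"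
    using mdist_triangle[of x m y a] mdist_triangle[of y m x a] assms mdist_commute[of m x y]
    by (simp add: dist_real_def abs_le_iff)
qed

lemma dist_le_mdist_path_space:
  fixes x x' :: "real \<Rightarrow> 'a::euclidean_space"
  assumes "x \<in> mspace (path_space T)" "x' \<in> mspace (path_space T)" "t \<in> {0..T}"
  shows "norm (x t - x' t) \<le> mdist (path_space T) x x'"
proof -
  have "top_of_set {0..T} \<noteq> trivial_topology"
    using assms(3) by (auto simp flip: null_topspace_iff_trivial)
  then have "\<forall>s\<in>{0..T}. mdist euclidean_metric (x s) (x' s) \<le> mdist (path_space T) x x'"
    using cfunspace_mdist_le[OF assms(1,2), of "mdist (path_space T) x x'"] by simp
  then show ?thesis
    using assms(3) by (simp add: dist_norm)
qed

lemma measurable_path_eval: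
  assumes "sets \<eta> = sets (borel_of (mtopology_of (path_space T :: (real \<Rightarrow> 'a::euclidean_space) metric)))"
    and t: "t \<in> {0..T}"
  shows "(\<lambda>x. x t) \<in> borel_measurable \<eta>"
proof (rule continuous_map_imp_borel_measurable[OF _ assms(1)])
  show "continuous_map (mtopology_of (path_space T)) euclidean (\<lambda>x :: real \<Rightarrow> 'a. x t)"
    by (intro nonexpansive_imp_continuous_map)
      (use dist_le_mdist_path_space[OF _ _ t] in \<open>simp add: dist_norm del: mspace_cfunspace\<close>)
qed

text \<open>The p-th moment about one reference path bounds the moments at all times, and dominated
  convergence gives continuity, with the values of the same path at two times as coupling. This
  makes the curve of an arbitrary motion admissible for the trajectory estimates.\<close>

lemma path_law_curve:
  fixes m :: "real \<Rightarrow> 'a::euclidean_space measure"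
  assumes \<eta>: "\<eta> \<in> P_space p (path_space T)" and p: "p > 0"
    and m: "\<And>t. t \<in> {0..T} \<Longrightarrow> m t = distr \<eta> borel (\<lambda>x. x t)"
  obtains c where "continuous_map (top_of_set {0..T}) (W_topology p euclidean_metric) m"
    "\<And>t. t \<in> {0..T} \<Longrightarrow> moment p (m t) \<le> c"
proof -
  have sets: "sets \<eta> = sets (borel_of (mtopology_of (path_space T)))" and prob: "prob_space \<eta>"
    using \<eta> by (simp_all add: P_space_def)
  interpret prob_space \<eta> by fact
  have space: "space \<eta> = mspace (path_space T)"
    using sets_eq_imp_space_eq[OF sets] by simp
  obtain a where a: "a \<in> mspace (path_space T)"
    "(\<integral>\<^sup>+ x. ennreal (mdist (path_space T) x a powr p) \<partial>\<eta>) < \<infinity>"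
    using \<eta> unfolding P_space_def by blast
  obtain b where b: "bounded_path T b a"
    using path_space_bounded[OF a(1)] .
  \<comment> \<open>\<open>G\<close> dominates \<open>norm (x t)\<close> at all times: a bound for
    the reference path plus the sup distance to it. The absolute value keeps it nonnegative.\<close>
  define G where "G x = \<bar>b\<bar> + mdist (path_space T) x a" for x
  have G_nonneg: "G x \<ge> 0" for x by (simp add: G_def)
  have "(\<lambda>x. mdist (path_space T) x a) \<in> borel_measurable \<eta>"
    by (rule continuous_map_imp_borel_measurable[OF continuous_map_mdist_point[OF a(1)] sets])
  then have int: "integrable \<eta> (\<lambda>x. G x powr p)"
    unfolding G_def using a(2) p by (intro integrable_powr_shift finite_measure_axioms) auto
  have le: "norm (x t) \<le> 1 * G x" if "x \<in> space \<eta>" "t \<in> {0..T}" for x t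
  proof -
    have "norm (x t - a t) \<le> mdist (path_space T) x a"
      using dist_le_mdist_path_space[OF _ a(1) that(2)] that(1) space by simp
    moreover have "norm (a t) \<le> b"
      using b that(2) by (simp add: bounded_path_def)
    ultimately show ?thesis
      using norm_triangle_sub[of "x t" "a t"] by (simp add: G_def)
  qed
  note meas = measurable_path_eval[OF sets]
  have bound: "integrable \<eta> (\<lambda>x. norm (x t) powr p)"
    "(\<integral>x. norm (x t) powr p \<partial>\<eta>) \<le> 1 powr p * (\<integral>x. G x powr p \<partial>\<eta>)" if "t \<in> {0..T}" for t
    using integrable_powr_dominated[OF int meas[OF that], of 1] p le[OF _ that] G_nonneg by auto
  show thesis
  proof (rule that)
    show "moment p (m t) \<le> 1 * (\<integral>x. G x powr p \<partial>\<eta>) powr (1 / p)" if "t \<in> {0..T}" for t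
      unfolding m[OF that] moment_law[OF meas[OF that]]
      by (rule powr_mean_scale[OF _ _ p]) (use bound[OF that] in auto)
    show "continuous_map (top_of_set {0..T}) (W_topology p euclidean_metric) m"
    proof (rule continuous_map_W_topology)
      show "m t \<in> P_space p euclidean_metric" if "t \<in> {0..T}" for t
        unfolding m[OF that] by (rule law_in_P_space[OF prob meas[OF that] bound(1)[OF that]])
      fix t assume t: "t \<in> {0..T}"
      show "((\<lambda>s. W_dist p euclidean_metric (m t) (m s)) \<longlongrightarrow> 0) (at t within {0..T})"
        unfolding tendsto_at_iff_sequentially o_def
      proof (intro allI impI)
        \<comment> \<open>Dominated convergence is sequential, so the limit in time is tested along
          sequences.\<close>
        fix S :: "nat \<Rightarrow> real" assume "\<forall>i. S i \<in> {0..T} - {t}" and lim: "S \<longlonglongrightarrow> t"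
        then have S: "S i \<in> {0..T}" for i by blast
        have diff_le: "norm (x t - x s) \<le> 2 * G x" if "x \<in> space \<eta>" "s \<in> {0..T}" for x s
          using norm_triangle_ineq4[of "x t" "x s"] le[OF that(1) t] le[OF that] by linarith
        have int_diff: "integrable \<eta> (\<lambda>x. norm (x t - x s) powr p)" if "s \<in> {0..T}" for s
          using integrable_powr_dominated(1)[OF int borel_measurable_diff[OF meas[OF t] meas[OF that]], of 2]
            p diff_le[OF _ that] G_nonneg by auto
        have "(\<lambda>i. \<integral>x. norm (x t - x (S i)) powr p \<partial>\<eta>) \<longlonglongrightarrow> (\<integral>x. 0 \<partial>\<eta>)"
        proof (rule integral_dominated_convergence[where w = "\<lambda>x. 2 powr p * G x powr p"])
          show "(\<lambda>x. norm (x t - x (S i)) powr p) \<in> borel_measurable \<eta>" for i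
            using int_diff[OF S] by (rule borel_measurable_integrable)
          show "integrable \<eta> (\<lambda>x. 2 powr p * G x powr p)"
            using int by simp
          show "AE x in \<eta>. norm (norm (x t - x (S i)) powr p) \<le> 2 powr p * G x powr p" for i
          proof (rule AE_I2)
            fix x assume x: "x \<in> space \<eta>"
            have "norm (x t - x (S i)) powr p \<le> (2 * G x) powr p"
              using diff_le[OF x S[of i]] p by (intro powr_mono2) auto
            then show "norm (norm (x t - x (S i)) powr p) \<le> 2 powr p * G x powr p"
              using G_nonneg by (simp add: powr_mult)
          qed
          show "AE x in \<eta>. (\<lambda>i. norm (x t - x (S i)) powr p) \<longlonglongrightarrow> 0"
          proof (rule AE_I2)
            fix x assume "x \<in> space \<eta>"
            then have "continuous_on {0..T} x"
              unfolding space mspace_path_space by simp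
            then have "(\<lambda>i. x (S i)) \<longlonglongrightarrow> x t"
              using lim t S by (intro continuous_on_tendsto_compose[of "{0..T}" x]) auto
            then have "(\<lambda>i. norm (x t - x (S i))) \<longlonglongrightarrow> 0"
              using tendsto_norm[OF tendsto_diff[OF tendsto_const[of "x t"]]] by fastforce
            then show "(\<lambda>i. norm (x t - x (S i)) powr p) \<longlonglongrightarrow> 0"
              using tendsto_powr'[of _ 0 sequentially "\<lambda>_. p" p] p by (simp add: tendsto_const)
          qed
        qed simp
        then have lim0: "(\<lambda>i. (\<integral>x. norm (x t - x (S i)) powr p \<partial>\<eta>) powr (1 / p)) \<longlonglongrightarrow> 0"
          using tendsto_powr'[of "\<lambda>i. \<integral>x. norm (x t - x (S i)) powr p \<partial>\<eta>" 0 sequentially "\<lambda>_. 1 / p" "1 / p"] p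
          by (simp add: tendsto_const)
        show "(\<lambda>i. W_dist p euclidean_metric (m t) (m (S i))) \<longlonglongrightarrow> 0"
        proof (rule tendsto_sandwich[OF _ _ tendsto_const lim0]; intro always_eventually allI)
          show "0 \<le> W_dist p euclidean_metric (m t) (m (S i))" for i
            by (simp add: W_dist_def)
          show "W_dist p euclidean_metric (m t) (m (S i)) \<le> (\<integral>x. norm (x t - x (S i)) powr p \<partial>\<eta>) powr (1 / p)" for i
            unfolding m[OF t] m[OF S] by (rule W_dist_law_le[OF meas[OF t] meas[OF S] int_diff[OF S] p])
        qed
      qed
    qed
  qed
qed

section \<open>Trajectories along a prescribed curve of distributions\<close>

context mean_field
begin

lemma curve_mono: "curve c m \<Longrightarrow> c \<le> c' \<Longrightarrow> curve c' m"
  unfolding curve_def by (meson order_trans)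

lemma bounded_path_mono: "bounded_path T c x \<Longrightarrow> c \<le> c' \<Longrightarrow> bounded_path T c' x"
  unfolding bounded_path_def by (meson order_trans)

text \<open>Bounded paths differ by at most \<open>b + b'\<close> to begin with, and repeated
  halving of the weighted difference forces it to vanish.\<close>

lemma exp_weighted_unique:
  fixes x x' :: "real \<Rightarrow> 'c::real_normed_vector"
  assumes x: "bounded_path T b x" "bounded_path T b' x'" "x \<in> extensional {0..T}" "x' \<in> extensional {0..T}"
    and "K \<ge> 0"
    and halve: "\<And>D t. D \<ge> 0 \<Longrightarrow> t \<in> {0..T} \<Longrightarrow>
      (\<And>\<tau>. \<tau> \<in> {0..T} \<Longrightarrow> norm (x \<tau> - x' \<tau>) \<le> D * exp (K * \<tau>)) \<Longrightarrow> norm (x t - x' t) \<le> D / 2 * exp (K * t)"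
  shows "x = x'"
proof (rule extensionalityI[OF x(3,4)])
  fix t assume t: "t \<in> {0..T}"
  have b: "norm (x \<tau>) \<le> b" "norm (x' \<tau>) \<le> b'" if "\<tau> \<in> {0..T}" for \<tau>
    using x(1,2) that by (auto simp: bounded_path_def)
  have D0: "b + b' \<ge> 0"
    using b[OF t] norm_ge_zero[of "x t"] norm_ge_zero[of "x' t"] by linarith
  define Q where "Q D \<longleftrightarrow> (\<forall>\<tau>\<in>{0..T}. norm (x \<tau> - x' \<tau>) \<le> D * exp (K * \<tau>))" for D
  have "Q (b + b')"
    unfolding Q_def
  proof
    fix \<tau> assume \<tau>: "\<tau> \<in> {0..T}"
    have "norm (x \<tau> - x' \<tau>) \<le> b + b'"
      using norm_triangle_ineq4[of "x \<tau>" "x' \<tau>"] b[OF \<tau>] by linarith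
    also have "\<dots> = (b + b') * 1" by simp
    also have "\<dots> \<le> (b + b') * exp (K * \<tau>)"
      using D0 \<tau> \<open>K \<ge> 0\<close> by (intro mult_left_mono) auto
    finally show "norm (x \<tau> - x' \<tau>) \<le> (b + b') * exp (K * \<tau>)" .
  qed
  then have "Q ((b + b') / 2 ^ n)" for n
    by (rule halving_iterate) (use D0 halve in \<open>auto simp: Q_def\<close>)
  then have "norm (x t - x' t) \<le> (b + b') * exp (K * t) / 2 ^ n" for n
    using t by (simp add: Q_def)
  from halving_imp_zero[OF this] show "x t = x' t" by simp
qed

text \<open>Solutions are continuous on a compact interval, hence bounded; the Lipschitz constant is
  taken for a bound common to both, and no invariant set is involved. A single integral has to be
  halved, hence the rate \<open>2 * L + 1\<close>.\<close>

lemma solves_major_unique: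
  assumes m: "curve c m" and y: "solves_major T g m y0 \<zeta> y" "solves_major T g m y0 \<zeta> y'"
  shows "y = y'"
proof -
  have "y \<in> mspace (path_space T)" "y' \<in> mspace (path_space T)"
    using y unfolding solves_major_def by blast+
  then obtain b b' where b: "bounded_path T b y" "bounded_path T b' y'"
    using path_space_bounded by metis
  define c' where "c' = max c (max b b')"
  have m': "curve c' m" and y': "bounded_path T c' y" "bounded_path T c' y'"
    using m b by (auto intro: curve_mono bounded_path_mono simp: c'_def)
  obtain L where L: "lip c' L" by (rule ex_lip)
  then have L0: "L \<ge> 0" by (simp add: lip_def)
  define K where "K = 2 * L + 1"
  have K: "K > 0" "L / K \<le> 1 / 2" using L0 by (simp_all add: K_def field_simps)
  have ext: "y \<in> extensional {0..T}" "y' \<in> extensional {0..T}"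
    and eq: "\<forall>t\<in>{0..T}. y t = major_step m y t" "\<forall>t\<in>{0..T}. y' t = major_step m y' t"
    using y solves_major_iff[OF m'] y' by auto
  show ?thesis
  proof (rule exp_weighted_unique[OF b ext, of K])
    fix D t :: real assume D: "D \<ge> 0" and t: "t \<in> {0..T}"
      and le: "\<And>\<tau>. \<tau> \<in> {0..T} \<Longrightarrow> norm (y \<tau> - y' \<tau>) \<le> D * exp (K * \<tau>)"
    have "norm (major_step m y t - major_step m y' t) \<le> L * D / K * exp (K * t)"
      by (rule major_step_diff[OF m' m' y' L t K(1)])
        (use le W_dist_self[OF curve_in_P[OF m]] p_ge_1 in auto)
    also have "\<dots> = (L / K) * (D * exp (K * t))" by simp
    also have "\<dots> \<le> (1 / 2) * (D * exp (K * t))"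
      using K D by (intro mult_right_mono) auto
    finally show "norm (y t - y' t) \<le> D / 2 * exp (K * t)"
      using eq t by simp
  qed (use K in auto)
qed

text \<open>The Lipschitz condition is global in the path variable, so the constant for
  \<open>c\<close> serves whatever the size of the two paths. There are two integrals to be halved
  together, hence the rate \<open>4 * L + 1\<close>.\<close>

lemma solves_minor_unique:
  assumes m: "curve c m" and y: "bounded_path T c y" and \<xi>: "\<xi> \<in> relaxed_controls T"
    and x: "solves_minor T fI fII m y x0 \<xi> \<zeta> x" "solves_minor T fI fII m y x0 \<xi> \<zeta> x'"
  shows "x = x'"
proof -
  have "x \<in> mspace (path_space T)" "x' \<in> mspace (path_space T)"
    using x unfolding solves_minor_def by blast+
  then obtain b b' where b: "bounded_path T b x" "bounded_path T b' x'"
    using path_space_bounded by metis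
  obtain L where L: "lip c L" by (rule ex_lip)
  then have L0: "L \<ge> 0" by (simp add: lip_def)
  define K where "K = 4 * L + 1"
  have K: "K > 0" "L / K \<le> 1 / 4" using L0 by (simp_all add: K_def field_simps)
  have ext: "x \<in> extensional {0..T}" "x' \<in> extensional {0..T}"
    and eq: "\<forall>t\<in>{0..T}. x t = minor_step m y (x0, \<xi>) x t" "\<forall>t\<in>{0..T}. x' t = minor_step m y (x0, \<xi>) x' t"
    using x solves_minor_iff[OF m y b(1) \<xi>] solves_minor_iff[OF m y b(2) \<xi>] by auto
  have \<xi>': "snd (x0, \<xi>) \<in> relaxed_controls T" using \<xi> by simp
  show ?thesis
  proof (rule exp_weighted_unique[OF b ext, of K])
    fix D t :: real assume D: "D \<ge> 0" and t: "t \<in> {0..T}"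
      and le: "\<And>\<tau>. \<tau> \<in> {0..T} \<Longrightarrow> norm (x \<tau> - x' \<tau>) \<le> D * exp (K * \<tau>)"
    have "norm (minor_step m y (x0, \<xi>) x t - minor_step m y (x0, \<xi>) x' t) \<le> 2 * (L * D / K * exp (K * t))"
      by (rule minor_step_diff[OF m m y y L b \<xi>' t K(1)])
        (use le W_dist_self[OF curve_in_P[OF m]] p_ge_1 in auto)
    also have "\<dots> = (L / K) * (2 * D * exp (K * t))" by simp
    also have "\<dots> \<le> (1 / 4) * (2 * D * exp (K * t))"
      using K D by (intro mult_right_mono) auto
    finally show "norm (x t - x' t) \<le> D / 2 * exp (K * t)"
      using eq t by simp
  qed (use K in auto)
qed

text \<open>The coupled system with a constant functional, for which \<open>max c 0\<close> bounds
  the moments and the distance of laws is zero. It yields the trajectories of all data at once as a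
  process, so that their continuity in the datum comes along.\<close>

lemma trajectories_of_curve:
  assumes m: "curve c m"
  obtains b l X c' y where "process b l X" "curve c' m" "bounded_path T c' y"
    "solves_major T g m y0 \<zeta> y"
    "\<And>x0 \<xi>. \<xi> \<in> relaxed_controls T \<Longrightarrow> solves_minor T fI fII m y x0 \<xi> \<zeta> (X (x0, \<xi>))"
proof -
  interpret law_functional T p A f fI fII g y0 \<zeta> "\<lambda>_. m" "max c 0"
  proof unfold_locales
    show "continuous_map (top_of_set {0..T}) (W_topology p euclidean_metric) m"
      using m by (simp add: curve_def)
    fix t D :: real assume t: "t \<in> {0..T}"
    show "moment p (m t) \<le> max c 0 * D" if "D \<ge> 1"
    proof -
      have "moment p (m t) \<le> max c 0 * 1"
        using m t by (auto simp: curve_def le_max_iff_disj)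
      also have "\<dots> \<le> max c 0 * D"
        using that by (intro mult_left_mono) auto
      finally show ?thesis .
    qed
    show "W (m t) (m t) \<le> max c 0 * D" if "D \<ge> 0"
      using that W_dist_self[OF curve_in_P[OF m t]] p_ge_1 by simp
  qed simp
  show thesis
    using system_solvable that by metis
qed

lemma major_trajectory_eq:
  assumes "curve c m" "solves_major T g m y0 \<zeta> y"
  shows "major_trajectory T g m y0 \<zeta> = y"
  unfolding major_trajectory_def using assms solves_major_unique by (intro the_equality) auto

lemma minor_trajectory_eq:
  assumes "curve c m" "bounded_path T c y" "\<xi> \<in> relaxed_controls T"
    "solves_minor T fI fII m y x0 \<xi> \<zeta> x"
  shows "minor_trajectory T fI fII m y x0 \<xi> \<zeta> = x"
  unfolding minor_trajectory_def using assms solves_minor_unique by (intro the_equality) auto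

end

section \<open>Uniqueness for the coupled system\<close>

context law_functional
begin

text \<open>The bounds are existential, so a solution is not tied to the constants of the
  construction; uniqueness among all motions relies on this.\<close>

definition system_solution ::
  "('a \<times> (real \<times> 'u) measure \<Rightarrow> real \<Rightarrow> 'a) \<Rightarrow> (real \<Rightarrow> 'b) \<Rightarrow> bool" where
  "system_solution X y \<longleftrightarrow> (\<exists>b l c. process b l X \<and> curve c (\<Psi> X) \<and> bounded_path T c y) \<and>
    solves_major T g (\<Psi> X) y0 \<zeta> y \<and>
    (\<forall>x0. \<forall>\<xi>\<in>relaxed_controls T. solves_minor T fI fII (\<Psi> X) y x0 \<xi> \<zeta> (X (x0, \<xi>)))"

lemma ex_system_solution: "\<exists>X y. system_solution X y"
  using system_solvable unfolding system_solution_def by metis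

lemma system_solution_steps:
  assumes "system_solution X y" "process b l X" "curve c (\<Psi> X)" "bounded_path T c y"
  shows "\<omega> \<in> topspace data \<Longrightarrow> t \<in> {0..T} \<Longrightarrow> X \<omega> t = minor_step (\<Psi> X) y \<omega> (X \<omega>) t"
    and "t \<in> {0..T} \<Longrightarrow> y t = major_step (\<Psi> X) y t"
    and "y \<in> extensional {0..T}"
proof -
  show "X \<omega> t = minor_step (\<Psi> X) y \<omega> (X \<omega>) t" if \<omega>: "\<omega> \<in> topspace data" and t: "t \<in> {0..T}" for \<omega> t
  proof -
    have \<xi>: "snd \<omega> \<in> relaxed_controls T" using \<omega> by auto
    then have "solves_minor T fI fII (\<Psi> X) y (fst \<omega>) (snd \<omega>) \<zeta> (X \<omega>)"
      using assms(1) unfolding system_solution_def by (metis prod.collapse)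
    then show ?thesis
      using solves_minor_iff[OF assms(3,4) process_path[OF assms(2) \<omega>] \<xi>] t by simp
  qed
  show "t \<in> {0..T} \<Longrightarrow> y t = major_step (\<Psi> X) y t" "y \<in> extensional {0..T}"
    using assms(1) solves_major_iff[OF assms(3,4)] by (auto simp: system_solution_def)
qed

text \<open>Two solutions share a bound \<open>d\<close>. The Lipschitz constant and the rate are
  chosen for it afterwards, and the contraction estimate is iterated on the two solutions
  themselves.\<close>

lemma system_solution_unique:
  assumes sol: "system_solution X y" "system_solution X' y'"
  shows "\<omega> \<in> topspace data \<Longrightarrow> t \<in> {0..T} \<Longrightarrow> X \<omega> t = X' \<omega> t" and "y = y'"
proof -
  obtain b l c where X: "process b l X" and m: "curve c (\<Psi> X)" and y: "bounded_path T c y"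
    using sol(1) unfolding system_solution_def by blast
  obtain b' l' c' where X': "process b' l' X'" and m': "curve c' (\<Psi> X')" and y': "bounded_path T c' y'"
    using sol(2) unfolding system_solution_def by blast
  define d where "d = max c c'"
  have m: "curve d (\<Psi> X)" "curve d (\<Psi> X')" and y: "bounded_path T d y" "bounded_path T d y'"
    using m m' y y' by (auto intro: curve_mono bounded_path_mono simp: d_def)
  obtain L where L: "lip d L" by (rule ex_lip)
  define K where "K = contraction_rate L"
  have K: "K \<ge> 0" using L \<rho> by (simp add: K_def contraction_rate_def lip_def)
  note eq = system_solution_steps[OF sol(1) X m(1) y(1)]
  note eq' = system_solution_steps[OF sol(2) X' m(2) y(2)]
  define Q where "Q D \<longleftrightarrow>
    (\<forall>\<omega>\<in>topspace data. \<forall>t\<in>{0..T}. norm (X \<omega> t - X' \<omega> t) \<le> D * (exp (K * t) * weight \<omega>)) \<and>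
    (\<forall>t\<in>{0..T}. norm (y t - y' t) \<le> D * exp (K * t))" for D
  \<comment> \<open>A finite first bound for both differences: the process bounds add up, and each
    major state is at most \<open>d\<close>.\<close>
  define D where "D = \<bar>b\<bar> + \<bar>b'\<bar> + 2 * \<bar>d\<bar>"
  have D: "D \<ge> 0" by (simp add: D_def)
  have Q0: "Q D"
    unfolding Q_def
  proof (intro conjI ballI)
    fix \<omega> t assume \<omega>: "\<omega> \<in> topspace data" and t: "t \<in> {0..T}"
    have "norm (X \<omega> t) \<le> b * weight \<omega>" "norm (X' \<omega> t) \<le> b' * weight \<omega>"
      using X X' \<omega> t unfolding process_def by blast+
    then have "norm (X \<omega> t - X' \<omega> t) \<le> (b + b') * weight \<omega>"
      using norm_triangle_ineq4[of "X \<omega> t" "X' \<omega> t"] unfolding distrib_right by linarith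
    also have "\<dots> \<le> D * (exp (K * t) * weight \<omega>)"
      unfolding mult.assoc[symmetric]
    proof (rule mult_right_mono)
      have "b + b' \<le> D * 1" by (simp add: D_def)
      also have "\<dots> \<le> D * exp (K * t)"
        using D K t by (intro mult_left_mono) auto
      finally show "b + b' \<le> D * exp (K * t)" .
    qed simp
    finally show "norm (X \<omega> t - X' \<omega> t) \<le> D * (exp (K * t) * weight \<omega>)" .
  next
    fix t assume t: "t \<in> {0..T}"
    have "norm (y t) \<le> d" "norm (y' t) \<le> d"
      using y t by (auto simp: bounded_path_def)
    then have "norm (y t - y' t) \<le> 2 * \<bar>d\<bar>"
      using norm_triangle_ineq4[of "y t" "y' t"] by linarith
    also have "\<dots> \<le> D * 1" by (simp add: D_def)
    also have "\<dots> \<le> D * exp (K * t)"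
      using D K t by (intro mult_left_mono) auto
    finally show "norm (y t - y' t) \<le> D * exp (K * t)" .
  qed
  have Q_half: "Q (D / 2)" if "D \<ge> 0" "Q D" for D
    unfolding Q_def
  proof (intro conjI ballI)
    have near: "norm (X \<omega> \<tau> - X' \<omega> \<tau>) \<le> D * (exp (K * \<tau>) * weight \<omega>)"
      if "\<omega> \<in> topspace data" "\<tau> \<in> {0..T}" for \<omega> \<tau>
      using \<open>Q D\<close> that unfolding Q_def by blast
    have near_y: "norm (y \<tau> - y' \<tau>) \<le> D * exp (K * \<tau>)" if "\<tau> \<in> {0..T}" for \<tau>
      using \<open>Q D\<close> that unfolding Q_def by blast
    note contr = minor_contraction[OF X X' m y L \<open>D \<ge> 0\<close> K_def]
    show "norm (y t - y' t) \<le> D / 2 * exp (K * t)" if t: "t \<in> {0..T}" for t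
      unfolding eq(2)[OF t] eq'(2)[OF t] by (intro contr(2)[OF t] near near_y)
    fix \<omega> t assume \<omega>: "\<omega> \<in> topspace data" and t: "t \<in> {0..T}"
    have "norm (minor_step (\<Psi> X) y \<omega> (X \<omega>) t - minor_step (\<Psi> X') y' \<omega> (X' \<omega>) t)
        \<le> D / 2 * (exp (K * t) * weight \<omega>)"
      by (intro contr(1)[OF t] near near_y \<omega>)
    then show "norm (X \<omega> t - X' \<omega> t) \<le> D / 2 * (exp (K * t) * weight \<omega>)"
      using eq(1)[OF \<omega> t] eq'(1)[OF \<omega> t] by simp
  qed
  have Q: "Q (D / 2 ^ n)" for n
    using Q0 D Q_half by (rule halving_iterate[of Q])
  show "X \<omega> t = X' \<omega> t" if "\<omega> \<in> topspace data" "t \<in> {0..T}" for \<omega> t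
  proof -
    have "norm (X \<omega> t - X' \<omega> t) \<le> D / 2 ^ n * (exp (K * t) * weight \<omega>)" for n
      using Q that unfolding Q_def by blast
    then have "norm (X \<omega> t - X' \<omega> t) \<le> D * (exp (K * t) * weight \<omega>) / 2 ^ n" for n
      by simp
    from halving_imp_zero[OF this] show ?thesis by simp
  qed
  show "y = y'"
  proof (rule extensionalityI[OF eq(3) eq'(3)])
    fix t assume "t \<in> {0..T}"
    then have "norm (y t - y' t) \<le> D * exp (K * t) / 2 ^ n" for n
      using Q unfolding Q_def by (metis times_divide_eq_left)
    from halving_imp_zero[OF this] show "y t = y' t" by simp
  qed
qed

end

section \<open>Existence and uniqueness of motions\<close>

locale mean_field_data = mean_field T p A f fI fII g y0 \<zeta>
  for T p A :: real
    and f :: "real \<Rightarrow> 'a::euclidean_space \<Rightarrow> 'a measure \<Rightarrow> 'b::euclidean_space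
              \<Rightarrow> 'u::metric_space \<Rightarrow> 'v::metric_space \<Rightarrow> 'a"
    and fI fII g y0 \<zeta> +
  fixes m0 :: "'a measure" and \<alpha> :: "('a \<times> (real \<times> 'u) measure) measure"
  assumes m0: "m0 \<in> P_space p euclidean_metric" and \<alpha>: "\<alpha> \<in> control_distributions T m0"
begin

lemma sets_\<alpha>: "sets \<alpha> = sets (borel_of data)"
  and fst_marginal: "distr \<alpha> borel fst = m0"
  using \<alpha> by (simp_all add: control_distributions_def Lambda_def borel_of_euclidean)

lemma space_\<alpha>: "space \<alpha> = topspace data"
  using sets_eq_imp_space_eq[OF sets_\<alpha>] by simp

lemma fst_measurable_\<alpha>: "fst \<in> borel_measurable \<alpha>"
  by (rule continuous_map_imp_borel_measurable[OF continuous_map_fst sets_\<alpha>])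

text \<open>\<open>Lambda\<close> prescribes only the marginal; a measure whose image is a
  probability is one itself.\<close>

lemma prob_\<alpha>: "prob_space \<alpha>"
proof (rule prob_space_distrD[OF fst_measurable_\<alpha>])
  show "prob_space (distr \<alpha> borel fst)"
    using m0 by (simp add: fst_marginal P_space_def)
qed

text \<open>\<open>P_space\<close> gives a moment about some point \<open>a\<close>, and
  \<open>1 + norm x \<le> 1 + norm a + dist x a\<close> carries it over to the weight.\<close>

lemma integrable_weight: "integrable \<alpha> (\<lambda>\<omega>. weight \<omega> powr p)"
proof -
  have sets: "sets m0 = sets borel" and prob: "prob_space m0"
    using m0 by (simp_all add: P_space_def borel_of_euclidean)
  obtain a where a: "(\<integral>\<^sup>+ x. ennreal (dist x a powr p) \<partial>m0) < \<infinity>"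
    using m0 by (auto simp: P_space_def)
  have "(\<lambda>x. dist x a) \<in> borel_measurable m0"
    using sets by (simp cong: measurable_cong_sets)
  then have "integrable m0 (\<lambda>x. (1 + norm a + dist x a) powr p)"
    using prob a p_ge_1 by (intro integrable_powr_shift prob_space.finite_measure) auto
  moreover have "(\<lambda>x. 1 + norm x) \<in> borel_measurable m0"
    using sets by (simp cong: measurable_cong_sets)
  ultimately have "integrable m0 (\<lambda>x. norm (1 + norm x) powr p)"
    by (rule integrable_powr_dominated(1)[where D = 1])
      (use p_ge_1 norm_triangle_sub[of _ a] in \<open>auto simp: dist_norm\<close>)
  then have "integrable (distr \<alpha> borel fst) (\<lambda>x. (1 + norm x) powr p)"
    by (simp add: fst_marginal)
  then show ?thesis
    by (subst (asm) integrable_distr_eq[OF fst_measurable_\<alpha>]) auto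
qed

definition mean_weight :: real where
  "mean_weight = (\<integral>\<omega>. weight \<omega> powr p \<partial>\<alpha>) powr (1 / p)"

text \<open>The restriction to \<open>{0..T}\<close> is there because motions are compared as
  extensional functions.\<close>

definition law :: "('a \<times> (real \<times> 'u) measure \<Rightarrow> real \<Rightarrow> 'a) \<Rightarrow> real \<Rightarrow> 'a measure" where
  "law X = (\<lambda>t\<in>{0..T}. distr \<alpha> borel (\<lambda>\<omega>. X \<omega> t))"

lemma continuous_in_data_measurable:
  assumes "continuous_in_data X" "t \<in> {0..T}"
  shows "(\<lambda>\<omega>. X \<omega> t) \<in> borel_measurable \<alpha>"
proof (rule continuous_map_imp_borel_measurable[OF _ sets_\<alpha>])
  have "continuous_map data (mtopology_of euclidean_metric) (\<lambda>\<omega>. X \<omega> t)"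
  proof (rule continuous_map_mtopology_ofI)
    fix \<omega> and e :: real assume "\<omega> \<in> topspace data" "e > 0"
    from assms(1)[unfolded continuous_in_data_def, rule_format, OF this]
    show "\<exists>N. openin data N \<and> \<omega> \<in> N \<and> (\<forall>\<omega>'\<in>N. mdist euclidean_metric (X \<omega> t) (X \<omega>' t) < e)"
      using assms(2) unfolding mdist_euclidean_metric dist_norm norm_minus_commute[of "X \<omega> t"] by blast
  qed simp
  then show "continuous_map data euclidean (\<lambda>\<omega>. X \<omega> t)" by simp
qed

lemma process_measurable: "process b l X \<Longrightarrow> t \<in> {0..T} \<Longrightarrow> (\<lambda>\<omega>. X \<omega> t) \<in> borel_measurable \<alpha>"
  using continuous_in_data_measurable by (auto simp: process_def)

text \<open>The origin of \<open>\<rho>\<close> for motions: a pointwise bound by \<open>D\<close>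
  times the weight becomes \<open>D\<close> times the p-norm of the weight under \<alpha>.\<close>

lemma weight_dominated:
  fixes Y :: "_ \<Rightarrow> 'c::euclidean_space"
  assumes "Y \<in> borel_measurable \<alpha>" "D \<ge> 0" "\<And>\<omega>. \<omega> \<in> topspace data \<Longrightarrow> norm (Y \<omega>) \<le> D * weight \<omega>"
  shows "integrable \<alpha> (\<lambda>\<omega>. norm (Y \<omega>) powr p)"
    and "(\<integral>\<omega>. norm (Y \<omega>) powr p \<partial>\<alpha>) powr (1 / p) \<le> mean_weight * D"
proof -
  note * = integrable_powr_dominated[OF integrable_weight assms(1) _ assms(2)]
  show "integrable \<alpha> (\<lambda>\<omega>. norm (Y \<omega>) powr p)"
    using p_ge_1 assms(3) by (intro *(1)) (auto simp: space_\<alpha> simp del: topspace_prod_topology)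
  have "(\<integral>\<omega>. norm (Y \<omega>) powr p \<partial>\<alpha>) \<le> D powr p * (\<integral>\<omega>. weight \<omega> powr p \<partial>\<alpha>)"
    using p_ge_1 assms(3) by (intro *(2)) (auto simp: space_\<alpha> simp del: topspace_prod_topology)
  then show "(\<integral>\<omega>. norm (Y \<omega>) powr p \<partial>\<alpha>) powr (1 / p) \<le> mean_weight * D"
    using powr_mean_scale[of D "\<integral>\<omega>. weight \<omega> powr p \<partial>\<alpha>" p] assms(2) p_ge_1
    by (simp add: mean_weight_def mult.commute)
qed

text \<open>Two processes and two times are allowed, so that one estimate yields both the Lipschitz
  dependence on the process and the continuity of the law in time.\<close>

lemma W_law_le:
  assumes X: "process b l X" "process b' l' X'" and st: "s \<in> {0..T}" "t \<in> {0..T}" and "D \<ge> 0"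
    and "\<And>\<omega>. \<omega> \<in> topspace data \<Longrightarrow> norm (X \<omega> s - X' \<omega> t) \<le> D * weight \<omega>"
  shows "W (law X s) (law X' t) \<le> mean_weight * D"
proof -
  have meas: "(\<lambda>\<omega>. X \<omega> s) \<in> borel_measurable \<alpha>" "(\<lambda>\<omega>. X' \<omega> t) \<in> borel_measurable \<alpha>"
    using process_measurable X st by blast+
  note dom = weight_dominated[OF borel_measurable_diff[OF meas] assms(5,6)]
  have "W (law X s) (law X' t) \<le> (\<integral>\<omega>. norm (X \<omega> s - X' \<omega> t) powr p \<partial>\<alpha>) powr (1 / p)"
    using W_dist_law_le[OF meas dom(1)] p_ge_1 st by (simp add: law_def)
  also have "\<dots> \<le> mean_weight * D" by (rule dom(2))
  finally show ?thesis .
qed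

text \<open>The signs are read off at one datum, which exists because \<alpha> is a probability; for
  \<open>l\<close> the times 0 and \<open>T\<close> are distinct.\<close>

lemma process_bound_nonneg:
  assumes "process b l X"
  shows "b \<ge> 0" "l \<ge> 0"
proof -
  obtain \<omega> where \<omega>: "\<omega> \<in> topspace data"
    using prob_space.not_empty[OF prob_\<alpha>] space_\<alpha> by blast
  have "norm (X \<omega> 0) \<le> b * weight \<omega>" "norm (X \<omega> T - X \<omega> 0) \<le> l * weight \<omega> * \<bar>T - 0\<bar>"
    using assms \<omega> T_pos unfolding process_def by (meson atLeastAtMost_iff less_imp_le order_refl)+
  then have "0 \<le> b * weight \<omega>" "0 \<le> l * weight \<omega> * \<bar>T - 0\<bar>"
    using norm_ge_zero order_trans by blast+
  moreover have "weight \<omega> > 0" by (simp add: add_pos_nonneg)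
  ultimately show "b \<ge> 0" "l \<ge> 0"
    using T_pos by (auto simp: zero_le_mult_iff)
qed

sublocale law_functional T p A f fI fII g y0 \<zeta> law mean_weight
proof unfold_locales
  show "mean_weight \<ge> 0" by (simp add: mean_weight_def)
  fix b l X assume X: "process b l X"
  show "continuous_map (top_of_set {0..T}) (W_topology p euclidean_metric) (law X)"
  proof (rule continuous_map_W_topology)
    fix t assume t: "t \<in> {0..T}"
    have "integrable \<alpha> (\<lambda>\<omega>. norm (X \<omega> t) powr p)"
      using X t process_bound_nonneg(1)[OF X]
      by (intro weight_dominated(1)[where D = b] process_measurable) (auto simp: process_def simp del: topspace_prod_topology)
    then show "law X t \<in> \<P>"
      using law_in_P_space[OF prob_\<alpha> process_measurable[OF X t]] t by (simp add: law_def)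
    have "((\<lambda>s. mean_weight * (l * \<bar>t - s\<bar>)) \<longlongrightarrow> mean_weight * (l * \<bar>t - t\<bar>)) (at t within {0..T})"
      by (intro tendsto_intros)
    then have lim: "((\<lambda>s. mean_weight * (l * \<bar>t - s\<bar>)) \<longlongrightarrow> 0) (at t within {0..T})"
      by simp
    have "W (law X t) (law X s) \<le> mean_weight * (l * \<bar>t - s\<bar>)" if s: "s \<in> {0..T}" for s
      using X s t process_bound_nonneg(2)[OF X]
      by (intro W_law_le[OF X X t s]) (auto simp: process_def mult_ac simp del: topspace_prod_topology)
    then show "((\<lambda>s. W (law X t) (law X s)) \<longlongrightarrow> 0) (at t within {0..T})"
      by (intro tendsto_sandwich[OF _ _ tendsto_const lim])
        (auto simp: W_nonneg eventually_at intro!: exI[of _ 1])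
  qed
  fix t D assume t: "t \<in> {0..T}"
  show "moment p (law X t) \<le> mean_weight * D"
    if "D \<ge> 1" "\<And>\<omega>. \<omega> \<in> topspace data \<Longrightarrow> norm (X \<omega> t) \<le> D * weight \<omega>"
    using weight_dominated(2)[OF process_measurable[OF X t] _ that(2)] that(1) t
      moment_law[OF process_measurable[OF X t]]
    by (simp add: law_def)
  show "W (law X t) (law X' t) \<le> mean_weight * D"
    if "process b' l' X'" "D \<ge> 0" "\<And>\<omega>. \<omega> \<in> topspace data \<Longrightarrow> norm (X \<omega> t - X' \<omega> t) \<le> D * weight \<omega>"
    for b' l' X'
    using W_law_le[OF X that(1) t t that(2,3)] .
qed

text \<open>Continuity in the data for the sup norm is continuity into the path space, so the image
  measure makes sense. Its moment is taken about the zero path, from which \<open>X \<omega>\<close>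
  is at distance at most \<open>b * weight \<omega>\<close>.\<close>

lemma path_law:
  assumes X: "process b l X" and path: "\<And>\<omega>. \<omega> \<in> topspace data \<Longrightarrow> X \<omega> \<in> mspace (path_space T)"
    and \<eta>: "\<eta> = distr \<alpha> (borel_of (mtopology_of (path_space T))) X"
  shows "\<eta> \<in> P_space p (path_space T)"
    and "t \<in> {0..T} \<Longrightarrow> distr \<eta> borel (\<lambda>x. x t) = law X t"
proof -
  have "continuous_map data (mtopology_of (path_space T)) X"
  proof (rule continuous_map_mtopology_ofI[OF path])
    fix \<omega> and e :: real assume \<omega>: "\<omega> \<in> topspace data" and e: "e > 0"
    have "continuous_in_data X" using X by (simp add: process_def)
    from this[unfolded continuous_in_data_def, rule_format, OF \<omega> half_gt_zero[OF e]]
    obtain N where N: "openin data N" "\<omega> \<in> N"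
      "\<And>\<omega>' t. \<omega>' \<in> N \<Longrightarrow> t \<in> {0..T} \<Longrightarrow> norm (X \<omega>' t - X \<omega> t) < e / 2" by blast
    have "mdist (path_space T) (X \<omega>) (X \<omega>') < e" if "\<omega>' \<in> N" for \<omega>'
    proof -
      \<comment> \<open>A supremum inherits only a weak inequality, hence the margin
        \<open>e / 2\<close>.\<close>
      have "mdist (path_space T) (X \<omega>) (X \<omega>') \<le> e / 2"
        using e N(3)[OF that] by (intro mdist_cfunspace_le) (auto simp: dist_norm norm_minus_commute less_imp_le)
      then show ?thesis using e by simp
    qed
    then show "\<exists>N. openin data N \<and> \<omega> \<in> N \<and> (\<forall>\<omega>'\<in>N. mdist (path_space T) (X \<omega>) (X \<omega>') < e)"
      using N(1,2) by blast
  qed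
  then have meas: "X \<in> \<alpha> \<rightarrow>\<^sub>M borel_of (mtopology_of (path_space T))"
    using continuous_map_imp_measurable_borel_of sets_\<alpha> by (metis measurable_cong_sets)
  have sets: "sets \<eta> = sets (borel_of (mtopology_of (path_space T)))"
    by (simp add: \<eta>)
  show "distr \<eta> borel (\<lambda>x. x t) = law X t" if t: "t \<in> {0..T}" for t
    using distr_distr[OF measurable_path_eval[OF refl t] meas] t
    by (simp add: \<eta> law_def o_def)
  define a :: "real \<Rightarrow> 'a" where "a = (\<lambda>t\<in>{0..T}. 0)"
  have a: "a \<in> mspace (path_space T)"
    unfolding mspace_path_space a_def by (auto intro: continuous_on_eq[where f = "\<lambda>_. 0"])
  have dist_meas: "(\<lambda>x. mdist (path_space T) x a) \<in> borel_measurable (borel_of (mtopology_of (path_space T)))"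
    by (rule continuous_map_imp_borel_measurable[OF continuous_map_mdist_point[OF a] refl])
  have "(\<integral>\<^sup>+ x. ennreal (mdist (path_space T) x a powr p) \<partial>\<eta>)
      = (\<integral>\<^sup>+ \<omega>. ennreal (mdist (path_space T) (X \<omega>) a powr p) \<partial>\<alpha>)"
    unfolding \<eta> by (rule nn_integral_distr[OF meas]) (use dist_meas in simp)
  also have "\<dots> = ennreal (\<integral>\<omega>. norm (mdist (path_space T) (X \<omega>) a) powr p \<partial>\<alpha>)"
  proof (subst nn_integral_eq_integral[symmetric])
    show "integrable \<alpha> (\<lambda>\<omega>. norm (mdist (path_space T) (X \<omega>) a) powr p)"
    proof (rule weight_dominated(1)[where D = b])
      show "(\<lambda>\<omega>. mdist (path_space T) (X \<omega>) a) \<in> borel_measurable \<alpha>"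
        using measurable_compose[OF meas dist_meas] .
      show "norm (mdist (path_space T) (X \<omega>) a) \<le> b * weight \<omega>" if "\<omega> \<in> topspace data" for \<omega>
      proof -
        have "norm (X \<omega> t) \<le> b * weight \<omega>" if "t \<in> {0..T}" for t
          using X that \<open>\<omega> \<in> topspace data\<close> unfolding process_def by blast
        then have "mdist (path_space T) (X \<omega>) a \<le> b * weight \<omega>"
          using process_bound_nonneg(1)[OF X] by (intro mdist_cfunspace_le) (auto simp: a_def)
        then show ?thesis by simp
      qed
    qed (rule process_bound_nonneg(1)[OF X])
  qed auto
  also have "\<dots> < \<infinity>" by simp
  finally show "\<eta> \<in> P_space p (path_space T)"
    unfolding P_space_def using sets a prob_space.prob_space_distr[OF prob_\<alpha> meas] \<eta> by blast
qed

text \<open>By uniqueness along the curve \<open>law X\<close>, the descriptions by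
  \<open>THE\<close> in the definition of a motion denote \<open>y\<close> and the paths of
  \<open>X\<close>.\<close>

lemma system_solution_motion:
  assumes "system_solution X y"
  shows "is_motion p T fI fII g y0 \<alpha> \<zeta> (law X) y"
proof -
  obtain b l c where X: "process b l X" and m: "curve c (law X)" and y: "bounded_path T c y"
    using assms unfolding system_solution_def by blast
  have minor: "solves_minor T fI fII (law X) y x0 \<xi> \<zeta> (X (x0, \<xi>))" if "\<xi> \<in> relaxed_controls T" for x0 \<xi>
    using assms that unfolding system_solution_def by blast
  have major: "solves_major T g (law X) y0 \<zeta> y"
    using assms unfolding system_solution_def by blast
  have path: "X \<omega> \<in> mspace (path_space T)" if "\<omega> \<in> topspace data" for \<omega>
    using minor[of "snd \<omega>" "fst \<omega>"] that unfolding solves_minor_def by auto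
  define \<eta> where "\<eta> = distr \<alpha> (borel_of (mtopology_of (path_space T))) X"
  note \<eta> = path_law[OF X path \<eta>_def]
  have "\<eta> = distr \<alpha> (borel_of (mtopology_of (path_space T)))
      (\<lambda>(x0, \<xi>). minor_trajectory T fI fII (law X) y x0 \<xi> \<zeta>)"
    unfolding \<eta>_def using minor_trajectory_eq[OF m y _ minor]
    by (intro distr_cong) (auto simp: space_\<alpha>)
  moreover have "law X \<in> {0..T} \<rightarrow>\<^sub>E \<P>"
    using curve_in_P[OF m] by (auto simp: PiE_iff law_def)
  moreover have "y \<in> {0..T} \<rightarrow>\<^sub>E UNIV"
    using system_solution_steps(3)[OF assms X m y] by (simp add: PiE_iff)
  moreover have "y = major_trajectory T g (law X) y0 \<zeta>"
    using major_trajectory_eq[OF m major] by simp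
  ultimately show ?thesis
    unfolding is_motion_def using \<eta> by metis
qed

text \<open>The trajectories along the curve \<open>m\<close> of a motion form a process
  \<open>X\<close>, and by uniqueness they are the ones in the definition of a motion. So the
  measure on path space is the image of \<alpha> under \<open>X\<close>; its evaluations are both
  \<open>m t\<close> and \<open>law X t\<close>, which closes the coupling.\<close>

lemma motion_system_solution:
  assumes "is_motion p T fI fII g y0 \<alpha> \<zeta> m y"
  obtains X where "system_solution X y" "m = law X"
proof -
  obtain \<eta> where m: "m \<in> {0..T} \<rightarrow>\<^sub>E \<P>" and \<eta>: "\<eta> \<in> P_space p (path_space T)"
    and y: "y = major_trajectory T g m y0 \<zeta>" and m_eq: "\<And>t. t \<in> {0..T} \<Longrightarrow> m t = distr \<eta> borel (\<lambda>x. x t)"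
    and \<eta>_eq: "\<eta> = distr \<alpha> (borel_of (mtopology_of (path_space T)))
            (\<lambda>(x0, \<xi>). minor_trajectory T fI fII m y x0 \<xi> \<zeta>)"
    using assms unfolding is_motion_def by blast
  have "p > 0" using p_ge_1 by simp
  then obtain c where c: "curve c m"
    using path_law_curve[OF \<eta> _ m_eq] unfolding curve_def by metis
  obtain b l X c' y' where X: "process b l X" and m': "curve c' m" and y': "bounded_path T c' y'"
    and major: "solves_major T g m y0 \<zeta> y'"
    and minor: "\<And>x0 \<xi>. \<xi> \<in> relaxed_controls T \<Longrightarrow> solves_minor T fI fII m y' x0 \<xi> \<zeta> (X (x0, \<xi>))"
    using trajectories_of_curve[OF c] by blast
  have "y = y'"
    using y major_trajectory_eq[OF m' major] by simp
  have path: "X \<omega> \<in> mspace (path_space T)" if "\<omega> \<in> topspace data" for \<omega>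
    using minor[of "snd \<omega>" "fst \<omega>"] that unfolding solves_minor_def by auto
  have "\<eta> = distr \<alpha> (borel_of (mtopology_of (path_space T))) X"
    unfolding \<eta>_eq \<open>y = y'\<close> using minor_trajectory_eq[OF m' y' _ minor]
    by (intro distr_cong) (auto simp: space_\<alpha>)
  from path_law(2)[OF X path this] have "m t = law X t" if "t \<in> {0..T}" for t
    using m_eq[OF that] that by simp
  then have "m = law X"
    using m by (intro extensionalityI[of m "{0..T}"]) (auto simp: PiE_iff law_def)
  moreover have "system_solution X y"
    unfolding system_solution_def \<open>m = law X\<close>[symmetric] using X m' y' major minor \<open>y = y'\<close> by blast
  ultimately show thesis using that by blast
qed

lemma ex1_motion: "\<exists>!(m, y). is_motion p T fI fII g y0 \<alpha> \<zeta> m y"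
proof -
  obtain X y where sol: "system_solution X y"
    using ex_system_solution by blast
  show ?thesis
  proof (rule ex1I[of _ "(law X, y)"])
    show "case (law X, y) of (m, y) \<Rightarrow> is_motion p T fI fII g y0 \<alpha> \<zeta> m y"
      using system_solution_motion[OF sol] by simp
    fix z assume z: "case z of (m, y) \<Rightarrow> is_motion p T fI fII g y0 \<alpha> \<zeta> m y"
    obtain m' y' where z_eq: "z = (m', y')" by force
    then have "is_motion p T fI fII g y0 \<alpha> \<zeta> m' y'" using z by simp
    then obtain X' where sol': "system_solution X' y'" "m' = law X'"
      by (rule motion_system_solution)
    note uniq = system_solution_unique[OF sol'(1) sol]
    \<comment> \<open>The two processes agree at the data and the times in \<open>{0..T}\<close>,
      and \<open>law\<close> depends on nothing else.\<close>
    have "law X' = law X"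
      unfolding law_def using uniq(1)
      by (intro restrict_ext distr_cong) (auto simp: space_\<alpha>)
    then show "z = (law X, y)"
      using uniq(2) sol'(2) z_eq by simp
  qed
qed

end

theorem mainTheorem1:
  fixes T p A :: real
    and f :: "real \<Rightarrow> real ^ 'd \<Rightarrow> (real ^ 'd) measure \<Rightarrow> real ^ 'e
              \<Rightarrow> 'u::polish_space \<Rightarrow> 'v::polish_space \<Rightarrow> real ^ 'd"
    and fI :: "real \<Rightarrow> real ^ 'd \<Rightarrow> (real ^ 'd) measure \<Rightarrow> real ^ 'e \<Rightarrow> 'u \<Rightarrow> real ^ 'd"
    and fII :: "real \<Rightarrow> real ^ 'd \<Rightarrow> (real ^ 'd) measure \<Rightarrow> real ^ 'e \<Rightarrow> 'v \<Rightarrow> real ^ 'd"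
    and g :: "real \<Rightarrow> real ^ 'e \<Rightarrow> (real ^ 'd) measure \<Rightarrow> 'v \<Rightarrow> real ^ 'e"
    and m0 :: "(real ^ 'd) measure"
    and y0 :: "real ^ 'e"
    and \<alpha> :: "((real ^ 'd) \<times> (real \<times> 'u) measure) measure"
    and \<zeta> :: "(real \<times> 'v) measure"
  assumes "T > 0" and "p \<ge> 1" and "A > 0"
    and "compact (UNIV :: 'u set)" and "compact (UNIV :: 'v set)"
    and "SLLL_minor p T A f fI fII"
    and "SLLL_major p T A g"
    and "m0 \<in> P_space p euclidean_metric"
    and "\<alpha> \<in> control_distributions T m0"
    and "\<zeta> \<in> relaxed_controls T"
  shows "\<exists>!(m, y). is_motion p T fI fII g y0 \<alpha> \<zeta> m y"
proof -
  interpret mean_field_data T p A f fI fII g y0 \<zeta> m0 \<alpha>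
    by unfold_locales (use assms in auto)
  show ?thesis by (rule ex1_motion)
qed

end
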